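(* Let $\mathcal{E}$ be a separable Hilbert space and let $B\in H^\infty_1(L(\mathcal{E}))$. Then for every $\alpha>-1$, $$\mathcal{A}_\alpha(B)\supseteq A^2_{\alpha-1,\mathcal{E}_1},\qquad \mathcal{A}_\alpha(B^* )\supseteq A^2_{\alpha-1,\mathcal{E}_2},$$ where $\mathcal{E}_1=\mathcal{H}(B(0))$ and $\mathcal{E}_2=\mathcal{H}(B(0)^* )$. (The inclusions are inclusions of sets of $\mathcal{E}$-valued analytic functions on the unit disk.)
   Context: Hilbert spaces are complex; $\mathbb{D}$ is the open unit disk. $L(\mathcal{E})$ is the algebra of bounded linear operators on $\mathcal{E}$, and $H^\infty_1(L(\mathcal{E}))$ is the set of analytic functions $B:\mathbb{D}\to L(\mathcal{E})$ with $\|B(z)\|\le 1$ for all $z\in\mathbb{D}$. For a contraction $A$ from a Hilbert space $\mathcal{H}$ to a Hilbert space $\mathcal{K}$, $\mathcal{M}(A)$ denotes the range of $A$ with the Hilbert space structure $\langle Ah_1,Ah_2\rangle_{\mathcal{M}(A)}=\langle h_1,h_2\rangle_{\mathcal{H}}$ for $h_1\in(\ker A)^\perp$, $h_2\in\mathcal{H}$. The de Branges-Rovnyak space of $A$ is $\mathcal{H}(A)=\mathcal{M}\bigl((I-AA^* )^{1/2}\bigr)\subseteq\mathcal{K}$. Thus $\mathcal{H}(B(0))$ is the range of $(I_{\mathcal{E}}-B(0)B(0)^* )^{1/2}$ and $\mathcal{H}(B(0)^* )$ is the range of $(I_{\mathcal{E}}-B(0)^*B(0))^{1/2}$, each with this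 range Hilbert space structure. For $\beta>-2$ and a separable Hilbert space $\mathcal{F}$, $A^2_{\beta,\mathcal{F}}$ is the reproducing kernel Hilbert space of $\mathcal{F}$-valued analytic functions on $\mathbb{D}$ with kernel $\frac{I_{\mathcal{F}}}{(1-z\overline{w})^{\beta+2}}$. Explicitly, with $c_{n,\beta}=\frac{\Gamma(n+\beta+2)}{n!\,\Gamma(\beta+2)}$, it consists of all $f(z)=\sum_{n\ge0}f_nz^n$, $f_n\in\mathcal{F}$, with $\sum_{n\ge 0}\|f_n\|_{\mathcal{F}}^2/c_{n,\beta}<\infty$. When $\mathcal{F}=\mathcal{E}_1$ or $\mathcal{E}_2$, the norm used is that of the range space $\mathcal{E}_1=\mathcal{H}(B(0))$ or $\mathcal{E}_2=\mathcal{H}(B(0)^* )$, and since $\mathcal{E}_i\subseteq\mathcal{E}$ such functions are regarded as $\mathcal{E}$-valued functions. For $\alpha>-1$, $T_B$ is the operator of multiplication by $B$ on $A^2_{\alpha,\mathcal{E}}$; it is a contraction. Define $$\mathcal{A}_\alpha(B)=\mathcal{M}\bigl((I-T_BT_B^* )^{1/2}\bigr),\qquad \mathcal{A}_\alpha(B^* )=\mathcal{M}\bigl((I-T_B^*T_B)^{1/2}\bigr),$$ both subspaces of $A^2_{\alpha,\mathcal{E}}$. *)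

theory Defs
  imports "HOL-Analysis.Analysis" "HOL-Library.Function_Algebras"
begin

section \<open>Complex vector spaces\<close>

class complex_vector = ab_group_add +
  fixes scaleC :: "complex \<Rightarrow> 'a \<Rightarrow> 'a"  (infixr \<open>*\<^sub>C\<close> 75)
  assumes scaleC_add_right: "a *\<^sub>C (x + y) = a *\<^sub>C x + a *\<^sub>C y"
    and scaleC_add_left: "(a + b) *\<^sub>C x = a *\<^sub>C x + b *\<^sub>C x"
    and scaleC_scaleC: "a *\<^sub>C (b *\<^sub>C x) = (a * b) *\<^sub>C x"
    and scaleC_one: "1 *\<^sub>C x = x"

global_interpretation complex_vector: vector_space "scaleC :: complex \<Rightarrow> 'a \<Rightarrow> 'a::complex_vector"
  by unfold_locales (simp_all add: scaleC_add_right scaleC_add_left scaleC_scaleC scaleC_one)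

instantiation "fun" :: (type, complex_vector) complex_vector
begin

definition scaleC_fun :: "complex \<Rightarrow> ('a \<Rightarrow> 'b) \<Rightarrow> 'a \<Rightarrow> 'b"
  where "scaleC_fun c f = (\<lambda>x. c *\<^sub>C f x)"

instance
  by standard
    (simp_all add: scaleC_fun_def plus_fun_def fun_eq_iff scaleC_add_right scaleC_add_left
      scaleC_scaleC scaleC_one)

end


section \<open>Hilbert spaces inside an ambient vector space\<close>

text \<open>
  The same vectors carry different Hilbert space structures (for instance \<open>\<H>(A) \<subseteq> \<K>\<close> with
  its range norm), so a Hilbert space is a subspace of an ambient complex vector space together
  with its own inner product. The vector operations are those of the ambient type.
  Inner products are linear in the first argument. Only the values of the inner product, and
  of operators, on the carrier matter.
\<close>

record 'a inner_space =
  hcarrier :: "'a set"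
  hinner :: "'a \<Rightarrow> 'a \<Rightarrow> complex"

definition hnorm :: "'a inner_space \<Rightarrow> 'a \<Rightarrow> real"
  where "hnorm H x = sqrt (Re (hinner H x x))"

definition hdist :: "'a::complex_vector inner_space \<Rightarrow> 'a \<Rightarrow> 'a \<Rightarrow> real"
  where "hdist H x y = (if x \<in> hcarrier H \<and> y \<in> hcarrier H then hnorm H (x - y) else 0)"

text \<open>The value of \<open>hdist\<close> off the carrier only serves the library's \<open>Metric_space\<close> locale,
  which asks for nonnegativity and symmetry on the whole type.\<close>

locale hilbert_space =
  fixes H :: "'a::complex_vector inner_space"
  assumes subspace: "complex_vector.subspace (hcarrier H)"
    and inner_add: "\<lbrakk>x \<in> hcarrier H; y \<in> hcarrier H; z \<in> hcarrier H\<rbrakk>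
      \<Longrightarrow> hinner H (x + y) z = hinner H x z + hinner H y z"
    and inner_scaleC: "\<lbrakk>x \<in> hcarrier H; y \<in> hcarrier H\<rbrakk>
      \<Longrightarrow> hinner H (c *\<^sub>C x) y = c * hinner H x y"
    and inner_commute: "\<lbrakk>x \<in> hcarrier H; y \<in> hcarrier H\<rbrakk>
      \<Longrightarrow> hinner H x y = cnj (hinner H y x)"
    and inner_nonneg: "x \<in> hcarrier H \<Longrightarrow> hinner H x x \<in> \<real>\<^sub>\<ge>\<^sub>0"
    and inner_definite: "\<lbrakk>x \<in> hcarrier H; hinner H x x = 0\<rbrakk> \<Longrightarrow> x = 0"
    and complete: "Metric_space.mcomplete (hcarrier H) (hdist H)"

definition separable_hilbert :: "'a::complex_vector inner_space \<Rightarrow> bool"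
  where "separable_hilbert H \<longleftrightarrow>
    hilbert_space H \<and> separable_space (Metric_space.mtopology (hcarrier H) (hdist H))"


section \<open>Bounded operators\<close>

definition bounded_ops ::
    "'a::complex_vector inner_space \<Rightarrow> 'b::complex_vector inner_space \<Rightarrow> ('a \<Rightarrow> 'b) set"
  where "bounded_ops H K = {A.
    (\<forall>x\<in>hcarrier H. A x \<in> hcarrier K) \<and>
    (\<forall>x\<in>hcarrier H. \<forall>y\<in>hcarrier H. A (x + y) = A x + A y) \<and>
    (\<forall>c. \<forall>x\<in>hcarrier H. A (c *\<^sub>C x) = c *\<^sub>C A x) \<and>
    (\<exists>M. \<forall>x\<in>hcarrier H. hnorm K (A x) \<le> M * hnorm H x)}"

definition opnorm :: "'a inner_space \<Rightarrow> 'b inner_space \<Rightarrow> ('a \<Rightarrow> 'b) \<Rightarrow> real"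
  where "opnorm H K A = (SUP x\<in>{x \<in> hcarrier H. hnorm H x \<le> 1}. hnorm K (A x))"

text \<open>On bounded operators between Hilbert spaces, the adjoint and the positive square root
  below are determined on the carrier, and only there; so \<open>SOME\<close> is used rather than \<open>THE\<close>.\<close>

definition adj ::
    "'a::complex_vector inner_space \<Rightarrow> 'b::complex_vector inner_space \<Rightarrow> ('a \<Rightarrow> 'b) \<Rightarrow> 'b \<Rightarrow> 'a"
  where "adj H K A = (SOME A'. A' \<in> bounded_ops K H \<and>
    (\<forall>x\<in>hcarrier H. \<forall>y\<in>hcarrier K. hinner K (A x) y = hinner H x (A' y)))"

definition positive_op :: "'a::complex_vector inner_space \<Rightarrow> ('a \<Rightarrow> 'a) \<Rightarrow> bool"
  where "positive_op H A \<longleftrightarrow>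
    A \<in> bounded_ops H H \<and> (\<forall>x\<in>hcarrier H. hinner H (A x) x \<in> \<real>\<^sub>\<ge>\<^sub>0)"

definition sqrt_op :: "'a::complex_vector inner_space \<Rightarrow> ('a \<Rightarrow> 'a) \<Rightarrow> 'a \<Rightarrow> 'a"
  where "sqrt_op H A = (SOME R. positive_op H R \<and> (\<forall>x\<in>hcarrier H. R (R x) = A x))"


section \<open>Range spaces and de Branges--Rovnyak spaces\<close>

definition ker_perp :: "'a inner_space \<Rightarrow> ('a \<Rightarrow> 'b::zero) \<Rightarrow> 'a set"
  where "ker_perp H A =
    {h \<in> hcarrier H. \<forall>k\<in>hcarrier H. A k = 0 \<longrightarrow> hinner H h k = 0}"

definition range_space :: "'a inner_space \<Rightarrow> ('a \<Rightarrow> 'b::zero) \<Rightarrow> 'b inner_space"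
  where "range_space H A =
    \<lparr>hcarrier = A ` hcarrier H,
     hinner = (\<lambda>x y. THE c. \<exists>h1\<in>ker_perp H A. \<exists>h2\<in>hcarrier H.
       x = A h1 \<and> y = A h2 \<and> c = hinner H h1 h2)\<rparr>"

definition dBR_space ::
    "'a::complex_vector inner_space \<Rightarrow> 'b::complex_vector inner_space \<Rightarrow> ('a \<Rightarrow> 'b) \<Rightarrow> 'b inner_space"
  where "dBR_space H K A = range_space K (sqrt_op K (id - (A \<circ> adj H K A)))"


section \<open>Weighted Bergman spaces\<close>

text \<open>Functions on the open unit disk are represented by functions on \<^typ>\<open>complex\<close>
  that vanish off the disk. The power series converges in the norm of \<open>F\<close>.\<close>

definition has_taylor ::
    "'a::complex_vector inner_space \<Rightarrow> (complex \<Rightarrow> 'a) \<Rightarrow> (nat \<Rightarrow> 'a) \<Rightarrow> bool"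
  where "has_taylor F f a \<longleftrightarrow>
    (\<forall>n. a n \<in> hcarrier F) \<and>
    (\<forall>z\<in>ball 0 1. f z \<in> hcarrier F \<and>
      (\<lambda>N. hnorm F (f z - (\<Sum>n<N. z ^ n *\<^sub>C a n))) \<longlonglongrightarrow> 0) \<and>
    (\<forall>z. z \<notin> ball 0 1 \<longrightarrow> f z = 0)"

definition taylor ::
    "'a::complex_vector inner_space \<Rightarrow> (complex \<Rightarrow> 'a) \<Rightarrow> nat \<Rightarrow> 'a"
  where "taylor F f = (THE a. has_taylor F f a)"

definition bergman_coeff :: "real \<Rightarrow> nat \<Rightarrow> real"
  where "bergman_coeff \<beta> n = Gamma (real n + \<beta> + 2) / (fact n * Gamma (\<beta> + 2))"

text \<open>Since \<open>(1 - t) powr - (\<beta> + 2) = (\<Sum>n. bergman_coeff \<beta> n * t ^ n)\<close>, the inner product below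
  is the one with reproducing kernel \<open>I / (1 - z * cnj w) powr (\<beta> + 2)\<close>.\<close>

definition bergman_space ::
    "real \<Rightarrow> 'a::complex_vector inner_space \<Rightarrow> (complex \<Rightarrow> 'a) inner_space"
  where "bergman_space \<beta> F =
    \<lparr>hcarrier = {f. \<exists>a. has_taylor F f a \<and>
       summable (\<lambda>n. (hnorm F (a n))\<^sup>2 / bergman_coeff \<beta> n)},
     hinner = (\<lambda>f g. \<Sum>n. hinner F (taylor F f n) (taylor F g n)
       / complex_of_real (bergman_coeff \<beta> n))\<rparr>"


section \<open>Sub-Bergman spaces\<close>

text \<open>Analyticity is complex differentiability in operator norm. \<open>B\<close> is unconstrained off
  the disk.\<close>

definition analytic_op_on_disk ::
    "'a::complex_vector inner_space \<Rightarrow> (complex \<Rightarrow> 'a \<Rightarrow> 'a) \<Rightarrow> bool"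
  where "analytic_op_on_disk E B \<longleftrightarrow>
    (\<forall>z\<in>ball 0 1. B z \<in> bounded_ops E E) \<and>
    (\<forall>z\<in>ball 0 1. \<exists>D\<in>bounded_ops E E.
      ((\<lambda>w. opnorm E E (inverse (w - z) *\<^sub>C (B w - B z) - D)) \<longlongrightarrow> 0) (at z))"

definition Hinf1 :: "'a::complex_vector inner_space \<Rightarrow> (complex \<Rightarrow> 'a \<Rightarrow> 'a) set"
  where "Hinf1 E = {B. analytic_op_on_disk E B \<and> (\<forall>z\<in>ball 0 1. opnorm E E (B z) \<le> 1)}"

definition mult_op :: "(complex \<Rightarrow> 'a \<Rightarrow> 'a) \<Rightarrow> (complex \<Rightarrow> 'a::zero) \<Rightarrow> complex \<Rightarrow> 'a"
  where "mult_op B f = (\<lambda>z. if z \<in> ball 0 1 then B z (f z) else 0)"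

definition sub_bergman ::
    "real \<Rightarrow> 'a::complex_vector inner_space \<Rightarrow> (complex \<Rightarrow> 'a \<Rightarrow> 'a) \<Rightarrow> (complex \<Rightarrow> 'a) inner_space"
  where "sub_bergman \<alpha> E B =
    (let H = bergman_space \<alpha> E; T = mult_op B in
      range_space H (sqrt_op H (id - (T \<circ> adj H H T))))"

definition sub_bergman_star ::
    "real \<Rightarrow> 'a::complex_vector inner_space \<Rightarrow> (complex \<Rightarrow> 'a \<Rightarrow> 'a) \<Rightarrow> (complex \<Rightarrow> 'a) inner_space"
  where "sub_bergman_star \<alpha> E B =
    (let H = bergman_space \<alpha> E; T = mult_op B in
      range_space H (sqrt_op H (id - (adj H H T \<circ> T))))"

end

theory Submission
  imports Defs "HOL-Complex_Analysis.Complex_Analysis"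
begin

text \<open>
  Write \<open>c n\<close> and \<open>d n\<close> for the coefficients \<open>bergman_coeff\<close> at \<open>\<alpha>\<close> and \<open>\<alpha> - 1\<close>, and \<open>M\<close> for
  multiplication by \<open>B\<close> on the Bergman space with parameter \<open>\<alpha>\<close>. The range of the square root of
  \<open>I - M M\<^sup>*\<close> consists of those \<open>f\<close> for which \<open>|\<langle>g, f\<rangle>|\<^sup>2\<close> is bounded by a multiple of
  \<open>\<parallel>g\<parallel>\<^sup>2 - \<parallel>M\<^sup>* g\<parallel>\<^sup>2\<close>, uniformly in \<open>g\<close> (\<open>in_defect_range\<close>). A function in the left-hand space of the
  first inclusion has Taylor coefficients \<open>f\<^sub>n\<close> with \<open>|\<langle>y, f\<^sub>n\<rangle>|\<^sup>2 \<le> N\<^sub>n\<^sup>2 (\<parallel>y\<parallel>\<^sup>2 - \<parallel>B(0)\<^sup>* y\<parallel>\<^sup>2)\<close> and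
  \<open>\<Sum> N\<^sub>n\<^sup>2 / d n < \<infinity>\<close>. By the Cauchy--Schwarz inequality the first inclusion follows from
  \<open>\<Sum> d n / (c n)\<^sup>2 (\<parallel>g\<^sub>n\<parallel>\<^sup>2 - \<parallel>B(0)\<^sup>* g\<^sub>n\<parallel>\<^sup>2) \<le> C (\<parallel>g\<parallel>\<^sup>2 - \<parallel>M\<^sup>* g\<parallel>\<^sup>2)\<close>,
  and the second one from the same inequality with \<open>B(0)\<close> and \<open>M\<close> in place of their adjoints.

  Both inequalities have one elementary source. The Taylor coefficients \<open>X\<^sub>n\<close> of \<open>B\<close> form a
  contractive lower triangular Toeplitz matrix:
  \<open>p\<^sub>N = \<Sum>n\<le>N. \<parallel>g\<^sub>n\<parallel>\<^sup>2 - \<parallel>\<Sum>k\<le>n. X\<^sub>n\<^sub>-\<^sub>k g\<^sub>k\<parallel>\<^sup>2\<close> is nonnegative for all \<open>g\<close> and \<open>N\<close>. Keep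
  \<open>g\<^sub>0, \<dots>, g\<^sub>n\<^sub>-\<^sub>1\<close> fixed; then \<open>p\<^sub>n\<close> is a quadratic function of \<open>g\<^sub>n\<close> with quadratic part
  \<open>\<parallel>g\<^sub>n\<parallel>\<^sup>2 - \<parallel>X\<^sub>0 g\<^sub>n\<parallel>\<^sup>2\<close>, and it is nonnegative everywhere, in particular at half the given
  entry. This alone gives \<open>\<parallel>g\<^sub>n\<parallel>\<^sup>2 - \<parallel>X\<^sub>0 g\<^sub>n\<parallel>\<^sup>2 \<le> 2 p\<^sub>n + 2 p\<^sub>n\<^sub>-\<^sub>1\<close>
  (\<open>defect_le_partial_defects\<close>), and summation by parts turns it into a weighted inequality for
  any decreasing weights whose differences do not grow too fast (\<open>weighted_defect_bound\<close>).

  For \<open>M\<close> the weights are \<open>1 / c n\<close>, whose differences are comparable to \<open>d n / (c n)\<^sup>2\<close>. For \<open>M\<^sup>*\<close>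
  the coefficients \<open>X\<^sub>n\<^sup>*\<close> act on reversed finite sequences; they again form a contractive Toeplitz
  matrix, the weights are \<open>c n\<close> read backwards, and their differences are exactly \<open>d n\<close>.

  Around this core the file develops Hilbert space theory on carriers: representation of
  functionals by minimisation, adjoints, square roots of \<open>I - X\<close> by an iteration with a scalar
  majorant, and the Bergman space as a Hilbert space of coefficient sequences.
\<close>


section \<open>Inner product spaces on a carrier\<close>

text \<open>
  The axioms of the locale \<open>hilbert_space\<close> without completeness. The separation lets the metric
  structure be used before completeness is known, which is how the Bergman space is shown to be
  a Hilbert space.
\<close>

locale prehilbert =
  fixes H :: "'a::complex_vector inner_space"
  assumes subspace: "complex_vector.subspace (hcarrier H)"
    and inner_add: "\<lbrakk>x \<in> hcarrier H; y \<in> hcarrier H; z \<in> hcarrier H\<rbrakk>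
      \<Longrightarrow> hinner H (x + y) z = hinner H x z + hinner H y z"
    and inner_scaleC: "\<lbrakk>x \<in> hcarrier H; y \<in> hcarrier H\<rbrakk>
      \<Longrightarrow> hinner H (c *\<^sub>C x) y = c * hinner H x y"
    and inner_commute: "\<lbrakk>x \<in> hcarrier H; y \<in> hcarrier H\<rbrakk>
      \<Longrightarrow> hinner H x y = cnj (hinner H y x)"
    and inner_nonneg: "x \<in> hcarrier H \<Longrightarrow> hinner H x x \<in> \<real>\<^sub>\<ge>\<^sub>0"
    and inner_definite: "\<lbrakk>x \<in> hcarrier H; hinner H x x = 0\<rbrakk> \<Longrightarrow> x = 0"
begin

lemma carrier_zero [simp, intro]: "0 \<in> hcarrier H"
  using subspace by (rule complex_vector.subspace_0)

lemma carrier_add [simp, intro]: "x \<in> hcarrier H \<Longrightarrow> y \<in> hcarrier H \<Longrightarrow> x + y \<in> hcarrier H"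
  using subspace by (rule complex_vector.subspace_add)

lemma carrier_diff [simp, intro]: "x \<in> hcarrier H \<Longrightarrow> y \<in> hcarrier H \<Longrightarrow> x - y \<in> hcarrier H"
  using subspace by (rule complex_vector.subspace_diff)

lemma carrier_scaleC [simp, intro]: "x \<in> hcarrier H \<Longrightarrow> c *\<^sub>C x \<in> hcarrier H"
  using subspace by (rule complex_vector.subspace_scale)

lemma carrier_sum [simp, intro]: "(\<And>i. i \<in> I \<Longrightarrow> f i \<in> hcarrier H) \<Longrightarrow> sum f I \<in> hcarrier H"
  using subspace by (rule complex_vector.subspace_sum)

lemma inner_add_right:
  assumes "x \<in> hcarrier H" "y \<in> hcarrier H" "z \<in> hcarrier H"
  shows "hinner H x (y + z) = hinner H x y + hinner H x z"
  using assms inner_add[of y z x] inner_commute[of x] by (metis carrier_add complex_cnj_add)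

lemma inner_scaleC_right:
  assumes "x \<in> hcarrier H" "y \<in> hcarrier H"
  shows "hinner H x (c *\<^sub>C y) = cnj c * hinner H x y"
  using assms inner_scaleC[of y x c] inner_commute[of x] by (metis carrier_scaleC complex_cnj_mult)

lemma inner_zero_left [simp]: "x \<in> hcarrier H \<Longrightarrow> hinner H 0 x = 0"
  using inner_scaleC[of 0 x 0] by simp

lemma inner_zero_right [simp]: "x \<in> hcarrier H \<Longrightarrow> hinner H x 0 = 0"
  using inner_scaleC_right[of x 0 0] by simp

lemma inner_diff:
  assumes "x \<in> hcarrier H" "y \<in> hcarrier H" "z \<in> hcarrier H"
  shows "hinner H (x - y) z = hinner H x z - hinner H y z"
  using inner_add[of "x - y" y z] assms by (simp add: algebra_simps)

lemma inner_diff_right: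
  assumes "x \<in> hcarrier H" "y \<in> hcarrier H" "z \<in> hcarrier H"
  shows "hinner H x (y - z) = hinner H x y - hinner H x z"
  using inner_add_right[of x "y - z" z] assms by (simp add: algebra_simps)

lemma inner_sum:
  assumes "\<And>i. i \<in> I \<Longrightarrow> f i \<in> hcarrier H" "y \<in> hcarrier H"
  shows "hinner H (sum f I) y = (\<Sum>i\<in>I. hinner H (f i) y)"
  using assms
proof (induction I rule: infinite_finite_induct)
  case (insert i I)
  have "hinner H (f i + sum f I) y = hinner H (f i) y + hinner H (sum f I) y"
    by (intro inner_add carrier_sum) (use insert in auto)
  then show ?case using insert by simp
qed auto

lemma inner_sum_right:
  assumes "\<And>i. i \<in> I \<Longrightarrow> f i \<in> hcarrier H" "y \<in> hcarrier H"
  shows "hinner H y (sum f I) = (\<Sum>i\<in>I. hinner H y (f i))"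
proof -
  have "hinner H y (sum f I) = cnj (hinner H (sum f I) y)"
    by (intro inner_commute carrier_sum) (use assms in auto)
  also have "\<dots> = (\<Sum>i\<in>I. cnj (hinner H (f i) y))"
    by (simp add: inner_sum assms)
  also have "\<dots> = (\<Sum>i\<in>I. hinner H y (f i))"
    by (intro sum.cong) (use assms inner_commute[of y] in auto)
  finally show ?thesis .
qed

lemma inner_self: "x \<in> hcarrier H \<Longrightarrow> hinner H x x = of_real ((hnorm H x)\<^sup>2)"
  using inner_nonneg[of x] unfolding hnorm_def
  by (auto simp: complex_nonneg_Reals_iff complex_eq_iff)

lemma hnorm_nonneg [simp]: "x \<in> hcarrier H \<Longrightarrow> 0 \<le> hnorm H x"
  using inner_nonneg[of x] unfolding hnorm_def by (auto simp: complex_nonneg_Reals_iff)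

lemma hnorm_eq_0: "x \<in> hcarrier H \<Longrightarrow> hnorm H x = 0 \<longleftrightarrow> x = 0"
  using inner_definite[of x] inner_self[of x] by auto

lemma hnorm_zero [simp]: "hnorm H 0 = 0"
  using hnorm_eq_0[of 0] by simp

lemma hnorm_scaleC:
  assumes "x \<in> hcarrier H"
  shows "hnorm H (c *\<^sub>C x) = cmod c * hnorm H x"
proof -
  have "hinner H (c *\<^sub>C x) (c *\<^sub>C x) = c * cnj c * hinner H x x"
    using assms by (simp add: inner_scaleC inner_scaleC_right)
  also have "c * cnj c = of_real ((cmod c)\<^sup>2)" by (rule complex_norm_square[symmetric])
  also have "of_real ((cmod c)\<^sup>2) * hinner H x x = of_real ((cmod c * hnorm H x)\<^sup>2)"
    using assms by (simp add: inner_self power_mult_distrib)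
  finally have "(hnorm H (c *\<^sub>C x))\<^sup>2 = (cmod c * hnorm H x)\<^sup>2"
    using assms by (metis carrier_scaleC inner_self of_real_eq_iff)
  then show ?thesis using assms by (simp add: power2_eq_iff_nonneg)
qed

lemma hnorm_minus_commute:
  assumes "x \<in> hcarrier H" "y \<in> hcarrier H"
  shows "hnorm H (x - y) = hnorm H (y - x)"
  using hnorm_scaleC[of "x - y" "-1"] assms
  by (simp add: complex_vector.scale_right_diff_distrib)

lemma hnorm_add_sq:
  assumes "x \<in> hcarrier H" "y \<in> hcarrier H"
  shows "(hnorm H (x + y))\<^sup>2 = (hnorm H x)\<^sup>2 + 2 * Re (hinner H x y) + (hnorm H y)\<^sup>2"
proof -
  have "of_real ((hnorm H (x + y))\<^sup>2) = hinner H (x + y) (x + y)"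
    using assms by (simp add: inner_self)
  also have "\<dots> = hinner H x x + hinner H x y + cnj (hinner H x y) + hinner H y y"
    using assms inner_commute[of y x] by (simp add: inner_add inner_add_right)
  finally have "Re (of_real ((hnorm H (x + y))\<^sup>2)) =
      Re (hinner H x x + hinner H x y + cnj (hinner H x y) + hinner H y y)" by (rule arg_cong)
  then show ?thesis using assms by (simp add: inner_self)
qed

lemma hnorm_diff_sq:
  assumes "x \<in> hcarrier H" "y \<in> hcarrier H"
  shows "(hnorm H (x - y))\<^sup>2 = (hnorm H x)\<^sup>2 - 2 * Re (hinner H x y) + (hnorm H y)\<^sup>2"
  using hnorm_add_sq[of "x - y" y] assms by (simp add: inner_diff inner_self)

lemma Cauchy_Schwarz:
  assumes "x \<in> hcarrier H" "y \<in> hcarrier H"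
  shows "cmod (hinner H x y) \<le> hnorm H x * hnorm H y"
proof (cases "y = 0")
  case False
  define n where "n = hnorm H y"
  have n: "n > 0" using False assms hnorm_eq_0[of y] hnorm_nonneg[of y] by (simp add: n_def less_le)
  define c where "c = hinner H x y / of_real (n\<^sup>2)"
  have "hinner H x (c *\<^sub>C y) = (hinner H x y * cnj (hinner H x y)) / of_real (n\<^sup>2)"
    using assms by (simp add: inner_scaleC_right c_def)
  also have "hinner H x y * cnj (hinner H x y) = of_real ((cmod (hinner H x y))\<^sup>2)"
    by (rule complex_norm_square[symmetric])
  also have "\<dots> / of_real (n\<^sup>2) = of_real ((cmod (hinner H x y))\<^sup>2 / n\<^sup>2)" by simp
  finally have "hinner H x (c *\<^sub>C y) = of_real ((cmod (hinner H x y))\<^sup>2 / n\<^sup>2)" .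
  moreover have "(hnorm H (c *\<^sub>C y))\<^sup>2 = (cmod (hinner H x y))\<^sup>2 / n\<^sup>2"
  proof -
    have "hnorm H (c *\<^sub>C y) = cmod (hinner H x y) / n"
      using assms n by (simp add: hnorm_scaleC c_def norm_divide norm_power n_def[symmetric])
        (simp add: power2_eq_square)
    then show ?thesis by (simp add: power_divide)
  qed
  moreover have "(hnorm H (x - c *\<^sub>C y))\<^sup>2 =
      (hnorm H x)\<^sup>2 - 2 * Re (hinner H x (c *\<^sub>C y)) + (hnorm H (c *\<^sub>C y))\<^sup>2"
    by (intro hnorm_diff_sq carrier_scaleC assms)
  ultimately have "(hnorm H (x - c *\<^sub>C y))\<^sup>2 = (hnorm H x)\<^sup>2 - (cmod (hinner H x y))\<^sup>2 / n\<^sup>2"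
    by (simp only: Re_complex_of_real)
  then have "(cmod (hinner H x y))\<^sup>2 / n\<^sup>2 \<le> (hnorm H x)\<^sup>2"
    using zero_le_power2[of "hnorm H (x - c *\<^sub>C y)"] by linarith
  then have "(cmod (hinner H x y))\<^sup>2 \<le> (hnorm H x * n)\<^sup>2"
    using n by (simp add: pos_divide_le_eq power_mult_distrib)
  then show ?thesis unfolding n_def by (rule power2_le_imp_le) (use assms in simp)
qed (use assms in simp)

lemma hnorm_triangle:
  assumes "x \<in> hcarrier H" "y \<in> hcarrier H"
  shows "hnorm H (x + y) \<le> hnorm H x + hnorm H y"
proof (rule power2_le_imp_le)
  have "Re (hinner H x y) \<le> hnorm H x * hnorm H y"
    using Cauchy_Schwarz[OF assms] complex_Re_le_cmod order_trans by blast
  then show "(hnorm H (x + y))\<^sup>2 \<le> (hnorm H x + hnorm H y)\<^sup>2"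
    using hnorm_add_sq[OF assms] by (simp add: power2_sum)
qed (use assms in simp)

lemma hnorm_triangle_diff:
  assumes "x \<in> hcarrier H" "y \<in> hcarrier H" "z \<in> hcarrier H"
  shows "hnorm H (x - z) \<le> hnorm H (x - y) + hnorm H (y - z)"
  using hnorm_triangle[of "x - y" "y - z"] assms by simp

lemma hnorm_diff_ineq:
  assumes "x \<in> hcarrier H" "y \<in> hcarrier H"
  shows "\<bar>hnorm H x - hnorm H y\<bar> \<le> hnorm H (x - y)"
  using hnorm_triangle[of "x - y" y] hnorm_triangle[of "y - x" x] hnorm_minus_commute[of x y] assms
  by simp

lemma hnorm_sum:
  assumes "\<And>i. i \<in> I \<Longrightarrow> f i \<in> hcarrier H"
  shows "hnorm H (sum f I) \<le> (\<Sum>i\<in>I. hnorm H (f i))"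
  using assms
proof (induction I rule: infinite_finite_induct)
  case (insert i I)
  have "hnorm H (f i + sum f I) \<le> hnorm H (f i) + hnorm H (sum f I)"
    by (intro hnorm_triangle carrier_sum) (use insert in auto)
  also have "hnorm H (sum f I) \<le> (\<Sum>i\<in>I. hnorm H (f i))" using insert by auto
  finally show ?case using insert by simp
qed auto

lemma inner_ext:
  assumes "x \<in> hcarrier H" "y \<in> hcarrier H" "\<And>z. z \<in> hcarrier H \<Longrightarrow> hinner H z x = hinner H z y"
  shows "x = y"
proof -
  have "hinner H (x - y) (x - y) = 0"
    using assms(1,2) assms(3)[of "x - y"] inner_diff_right[of "x - y" x y] by simp
  then show ?thesis using inner_definite[of "x - y"] assms by simp
qed

lemma inner_ext_left:
  assumes "x \<in> hcarrier H" "y \<in> hcarrier H" "\<And>z. z \<in> hcarrier H \<Longrightarrow> hinner H x z = hinner H y z"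
  shows "x = y"
  using assms inner_commute by (metis inner_ext)

lemma hnorm_le_of_inner_self:
  assumes x: "x \<in> hcarrier H" and K: "0 \<le> K" "cmod (hinner H x x) \<le> K * hnorm H x"
  shows "hnorm H x \<le> K"
proof -
  have "cmod (hinner H x x) = hnorm H x * hnorm H x"
    using x by (simp add: inner_self power2_eq_square norm_mult)
  then show ?thesis using K hnorm_nonneg[OF x] by (cases "hnorm H x = 0") auto
qed

lemma tendsto_hinner:
  assumes "\<And>n. x n \<in> hcarrier H" "a \<in> hcarrier H" "y \<in> hcarrier H" "(\<lambda>n. hnorm H (x n - a)) \<longlonglongrightarrow> 0"
  shows "(\<lambda>n. hinner H (x n) y) \<longlonglongrightarrow> hinner H a y"
proof (rule Lim_transform2[OF tendsto_const], rule Lim_null_comparison)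
  show "\<forall>\<^sub>F n in sequentially. norm (hinner H a y - hinner H (x n) y) \<le> hnorm H (x n - a) * hnorm H y"
    using Cauchy_Schwarz[of "x _ - a" y] assms
    by (intro always_eventually allI) (simp add: inner_diff norm_minus_commute)
  show "(\<lambda>n. hnorm H (x n - a) * hnorm H y) \<longlonglongrightarrow> 0"
    using tendsto_mult_right[OF assms(4), of "hnorm H y"] by simp
qed

lemma tendsto_hinner_right:
  assumes "\<And>n. x n \<in> hcarrier H" "a \<in> hcarrier H" "y \<in> hcarrier H" "(\<lambda>n. hnorm H (x n - a)) \<longlonglongrightarrow> 0"
  shows "(\<lambda>n. hinner H y (x n)) \<longlonglongrightarrow> hinner H y a"
  using tendsto_cnj[OF tendsto_hinner[OF assms]] inner_commute[of y] assms by simp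

lemma tendsto_hnorm:
  assumes "\<And>n. x n \<in> hcarrier H" "a \<in> hcarrier H" "(\<lambda>n. hnorm H (x n - a)) \<longlonglongrightarrow> 0"
  shows "(\<lambda>n. hnorm H (x n)) \<longlonglongrightarrow> hnorm H a"
  by (rule LIM_zero_cancel, rule Lim_null_comparison[OF _ assms(3)])
    (use hnorm_diff_ineq assms in \<open>auto intro!: always_eventually\<close>)

lemma limit_add:
  assumes "\<And>n. x n \<in> hcarrier H" "\<And>n. y n \<in> hcarrier H" "a \<in> hcarrier H" "b \<in> hcarrier H"
    and lim: "(\<lambda>n. hnorm H (x n - a)) \<longlonglongrightarrow> 0" "(\<lambda>n. hnorm H (y n - b)) \<longlonglongrightarrow> 0"
  shows "(\<lambda>n. hnorm H (x n + y n - (a + b))) \<longlonglongrightarrow> 0"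
proof (rule Lim_null_comparison[OF always_eventually tendsto_add_zero[OF lim]], rule allI)
  fix n
  have "x n - a \<in> hcarrier H" "y n - b \<in> hcarrier H" using assms by auto
  then show "norm (hnorm H (x n + y n - (a + b))) \<le> hnorm H (x n - a) + hnorm H (y n - b)"
    using hnorm_triangle[of "x n - a" "y n - b"] hnorm_nonneg[OF carrier_add[of "x n - a" "y n - b"]]
    by (simp add: add_diff_add)
qed

lemma limit_unique:
  assumes "\<And>n. x n \<in> hcarrier H" "a \<in> hcarrier H" "b \<in> hcarrier H"
    "(\<lambda>n. hnorm H (x n - a)) \<longlonglongrightarrow> 0" "(\<lambda>n. hnorm H (x n - b)) \<longlonglongrightarrow> 0"
  shows "a = b"
  by (rule inner_ext[OF assms(2,3)])
    (rule LIMSEQ_unique[OF tendsto_hinner_right[OF assms(1,2) _ assms(4)]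
      tendsto_hinner_right[OF assms(1,3) _ assms(5)]])

lemma Metric_space: "Metric_space (hcarrier H) (hdist H)"
proof
  fix x y z
  show "0 \<le> hdist H x y" by (simp add: hdist_def)
  show "hdist H x y = hdist H y x" using hnorm_minus_commute[of x y] by (auto simp: hdist_def)
  assume x: "x \<in> hcarrier H" and y: "y \<in> hcarrier H"
  then show "hdist H x y = 0 \<longleftrightarrow> x = y" using hnorm_eq_0[of "x - y"] by (simp add: hdist_def)
  assume z: "z \<in> hcarrier H"
  then show "hdist H x z \<le> hdist H x y + hdist H y z"
    using x y hnorm_triangle_diff[of x y z] by (simp add: hdist_def)
qed

text \<open>
  The metric is \<open>0\<close> off the carrier, so metric completeness has to be translated once into a
  statement about norms of differences.
\<close>

lemma mcomplete_iff:
  "Metric_space.mcomplete (hcarrier H) (hdist H) \<longleftrightarrow>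
    (\<forall>x. (\<forall>n. x n \<in> hcarrier H) \<and> (\<forall>\<epsilon>>0. \<exists>N. \<forall>m\<ge>N. \<forall>n\<ge>N. hnorm H (x m - x n) < \<epsilon>)
      \<longrightarrow> (\<exists>a\<in>hcarrier H. (\<lambda>n. hnorm H (x n - a)) \<longlonglongrightarrow> 0))"
proof -
  interpret M: Metric_space "hcarrier H" "hdist H" by (rule Metric_space)
  have 1: "M.MCauchy x \<longleftrightarrow> (\<forall>n. x n \<in> hcarrier H) \<and>
      (\<forall>\<epsilon>>0. \<exists>N. \<forall>m\<ge>N. \<forall>n\<ge>N. hnorm H (x m - x n) < \<epsilon>)" for x
    unfolding M.MCauchy_def hdist_def by (fastforce simp: image_subset_iff)
  have 2: "limitin M.mtopology x a sequentially \<longleftrightarrow> a \<in> hcarrier H \<and> (\<lambda>n. hnorm H (x n - a)) \<longlonglongrightarrow> 0"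
    if x: "\<forall>n. x n \<in> hcarrier H" for x :: "nat \<Rightarrow> 'a" and a
    using x by (cases "a \<in> hcarrier H")
      (auto simp: M.limit_metric_sequentially LIMSEQ_iff hdist_def)
  show ?thesis unfolding M.mcomplete_def 1
    by (intro iff_allI imp_cong refl) (simp add: 2 Bex_def)
qed

end

sublocale hilbert_space \<subseteq> prehilbert
  by unfold_locales (fact subspace inner_add inner_scaleC inner_commute inner_nonneg inner_definite)+

lemma (in hilbert_space) Cauchy_converges:
  assumes "\<And>n. x n \<in> hcarrier H" "\<And>\<epsilon>. \<epsilon> > 0 \<Longrightarrow> \<exists>N. \<forall>m\<ge>N. \<forall>n\<ge>N. hnorm H (x m - x n) < \<epsilon>"
  obtains a where "a \<in> hcarrier H" "(\<lambda>n. hnorm H (x n - a)) \<longlonglongrightarrow> 0"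
proof -
  have "\<exists>a\<in>hcarrier H. (\<lambda>n. hnorm H (x n - a)) \<longlonglongrightarrow> 0"
    by (rule complete[unfolded mcomplete_iff, rule_format]) (use assms in auto)
  then show thesis using that by auto
qed

section \<open>Representation of functionals and adjoints\<close>

lemma bounded_opsD:
  assumes "A \<in> bounded_ops H K"
  shows "x \<in> hcarrier H \<Longrightarrow> A x \<in> hcarrier K"
    and "x \<in> hcarrier H \<Longrightarrow> y \<in> hcarrier H \<Longrightarrow> A (x + y) = A x + A y"
    and "x \<in> hcarrier H \<Longrightarrow> A (c *\<^sub>C x) = c *\<^sub>C A x"
  using assms by (auto simp: bounded_ops_def)

lemma bounded_ops_bound:
  assumes "prehilbert H" "A \<in> bounded_ops H K"
  obtains M where "M \<ge> 0" "\<And>x. x \<in> hcarrier H \<Longrightarrow> hnorm K (A x) \<le> M * hnorm H x"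
proof -
  interpret prehilbert H by fact
  obtain M where M: "\<And>x. x \<in> hcarrier H \<Longrightarrow> hnorm K (A x) \<le> M * hnorm H x"
    using assms(2) unfolding bounded_ops_def by blast
  have "hnorm K (A x) \<le> \<bar>M\<bar> * hnorm H x" if "x \<in> hcarrier H" for x
    using M[OF that] mult_right_mono[OF abs_ge_self hnorm_nonneg[OF that], of M] by linarith
  then show thesis using that[of "\<bar>M\<bar>"] by simp
qed

lemma bounded_ops_diff:
  assumes "prehilbert H" "A \<in> bounded_ops H K" "x \<in> hcarrier H" "y \<in> hcarrier H"
  shows "A (x - y) = A x - A y"
proof -
  interpret H: prehilbert H by fact
  have "A (x - y) + A y = A (x - y + y)"
    using bounded_opsD(2)[OF assms(2), of "x - y" y] assms(3,4) by simp
  then show ?thesis by (simp add: eq_diff_eq)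
qed

lemma bounded_ops_zero: "prehilbert H \<Longrightarrow> A \<in> bounded_ops H K \<Longrightarrow> A 0 = (0 :: 'a::complex_vector)"
  using bounded_opsD(3)[of A H K 0 0] prehilbert.carrier_zero[of H] by simp

lemma bounded_ops_sum:
  assumes "prehilbert H" "A \<in> bounded_ops H K" "\<And>i. i \<in> I \<Longrightarrow> f i \<in> hcarrier H"
  shows "A (sum f I) = (\<Sum>i\<in>I. A (f i))"
  using assms(3)
proof (induction I rule: infinite_finite_induct)
  case (insert i I)
  interpret prehilbert H by fact
  have "A (f i + sum f I) = A (f i) + A (sum f I)"
    by (intro bounded_opsD(2)[OF assms(2)] carrier_sum) (use insert in auto)
  then show ?case using insert by simp
qed (use bounded_ops_zero[OF assms(1,2)] in auto)

text \<open>
  One minimisation serves three purposes: with \<open>R = id\<close> this is the Riesz representation theorem;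
  with \<open>R\<close> self-adjoint, on a domain that is in general incomplete for \<open>\<parallel>R g\<parallel>\<close>, it characterises the
  range of \<open>R\<close>; and the last conclusion, that \<open>h\<close> lies in the closure of the range, puts \<open>h\<close> into
  \<open>ker_perp\<close>. The vector \<open>h\<close> is the limit of \<open>R g\<close> along a minimising sequence of
  \<open>\<parallel>R g\<parallel>\<^sup>2 - 2 Re (l g)\<close>: the parallelogram law makes such a sequence Cauchy after applying \<open>R\<close>, and
  the first-order condition at the minimum is the representation.
\<close>

lemma (in hilbert_space) bounded_form_represented:
  fixes R :: "'b::complex_vector \<Rightarrow> 'a" and l :: "'b \<Rightarrow> complex"
  assumes V: "complex_vector.subspace V"
    and R: "\<And>g. g \<in> V \<Longrightarrow> R g \<in> hcarrier H"
      "\<And>g h. g \<in> V \<Longrightarrow> h \<in> V \<Longrightarrow> R (g + h) = R g + R h"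
      "\<And>c g. g \<in> V \<Longrightarrow> R (c *\<^sub>C g) = c *\<^sub>C R g"
    and l: "\<And>g h. g \<in> V \<Longrightarrow> h \<in> V \<Longrightarrow> l (g + h) = l g + l h"
      "\<And>c g. g \<in> V \<Longrightarrow> l (c *\<^sub>C g) = c * l g"
    and bound: "\<And>g. g \<in> V \<Longrightarrow> cmod (l g) \<le> C * hnorm H (R g)"
  obtains h where "h \<in> hcarrier H" "\<And>g. g \<in> V \<Longrightarrow> l g = hinner H (R g) h"
    "\<And>k. k \<in> hcarrier H \<Longrightarrow> (\<And>g. g \<in> V \<Longrightarrow> hinner H (R g) k = 0) \<Longrightarrow> hinner H h k = 0"
proof -
  note V_closed = complex_vector.subspace_add[OF V] complex_vector.subspace_scale[OF V]
  define \<Phi> where "\<Phi> g = (hnorm H (R g))\<^sup>2 - 2 * Re (l g)" for g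
  define m where "m = Inf (\<Phi> ` V)"
  have V0: "0 \<in> V" using V by (rule complex_vector.subspace_0)
  have lower: "\<Phi> g \<ge> - C\<^sup>2" if "g \<in> V" for g
  proof -
    have "Re (l g) \<le> C * hnorm H (R g)"
      using bound[OF that] complex_Re_le_cmod[of "l g"] by linarith
    moreover have "(hnorm H (R g) - C)\<^sup>2 \<ge> 0" by simp
    ultimately show ?thesis by (simp add: \<Phi>_def power2_diff algebra_simps)
  qed
  then have bdd: "bdd_below (\<Phi> ` V)" by (intro bdd_belowI2)
  then have m_le: "m \<le> \<Phi> g" if "g \<in> V" for g
    using that unfolding m_def by (intro cInf_lower) auto
  have "\<exists>g\<in>V. \<Phi> g < m + inverse (real (Suc n))" for n
    using V0 cInf_less_iff[of "\<Phi> ` V" "m + inverse (real (Suc n))"] bdd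
    unfolding m_def by auto
  then obtain G where G: "\<And>n. G n \<in> V" "\<And>n. \<Phi> (G n) < m + inverse (real (Suc n))"
    by metis
  have expand: "\<Phi> (g + t *\<^sub>C k) = \<Phi> g + 2 * Re (cnj t * hinner H (R g) (R k) - t * l k)
      + (cmod t)\<^sup>2 * (hnorm H (R k))\<^sup>2" if "g \<in> V" "k \<in> V" for g k t
  proof -
    have "(hnorm H (R g + t *\<^sub>C R k))\<^sup>2 = (hnorm H (R g))\<^sup>2 + 2 * Re (hinner H (R g) (t *\<^sub>C R k))
        + (hnorm H (t *\<^sub>C R k))\<^sup>2"
      by (intro hnorm_add_sq) (use that R(1) in auto)
    then show ?thesis
      using that V_closed R l unfolding \<Phi>_def
      by (simp add: inner_scaleC_right hnorm_scaleC power_mult_distrib algebra_simps)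
  qed
  have close: "(hnorm H (R (G i) - R (G j)))\<^sup>2 \<le> 2 * (inverse (Suc i) + inverse (Suc j))" for i j
  proof -
    have *: "\<Phi> (g + (1/2) *\<^sub>C k) = (\<Phi> g + \<Phi> (g + k)) / 2 - (hnorm H (R k))\<^sup>2 / 4"
      if "g \<in> V" "k \<in> V" for g k
      using expand[OF that, of "1/2"] expand[OF that, of 1] by (simp add: power2_eq_square field_simps)
    define k where "k = G j + (-1) *\<^sub>C G i"
    have k: "k \<in> V" unfolding k_def by (intro V_closed G)
    have "G i + k = G j" by (simp add: k_def)
    moreover have "R k = R (G j) - R (G i)"
      using R(2)[OF G(1), of "(-1) *\<^sub>C G i" j] R(3)[OF G(1), of "-1" i] V_closed(2)[OF G(1), of "-1" i]
      by (simp add: k_def)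
    moreover have "m \<le> \<Phi> (G i + (1/2) *\<^sub>C k)"
      using k G(1) V_closed by (intro m_le) auto
    ultimately have "m \<le> (\<Phi> (G i) + \<Phi> (G j)) / 2 - (hnorm H (R (G j) - R (G i)))\<^sup>2 / 4"
      using *[OF G(1) k, of i] by simp
    moreover have "hnorm H (R (G j) - R (G i)) = hnorm H (R (G i) - R (G j))"
      by (intro hnorm_minus_commute R(1) G(1))
    ultimately have "m \<le> (\<Phi> (G i) + \<Phi> (G j)) / 2 - (hnorm H (R (G i) - R (G j)))\<^sup>2 / 4" by simp
    moreover have "s \<le> 2 * (a + b)" if "m \<le> (p + q) / 2 - s / 4" "p < m + a" "q < m + b" for s a b p q :: real
      using that by argo
    ultimately show ?thesis using G(2)[of i] G(2)[of j] by blast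
  qed
  obtain h where h: "h \<in> hcarrier H" "(\<lambda>n. hnorm H (R (G n) - h)) \<longlonglongrightarrow> 0"
  proof (rule Cauchy_converges)
    show "R (G n) \<in> hcarrier H" for n using R(1) G(1) by blast
    fix \<epsilon> :: real assume "\<epsilon> > 0"
    then obtain N where N: "inverse (real (Suc N)) < \<epsilon>\<^sup>2 / 4"
      using reals_Archimedean[of "\<epsilon>\<^sup>2 / 4"] by auto
    have "hnorm H (R (G i) - R (G j)) < \<epsilon>" if "i \<ge> N" "j \<ge> N" for i j
    proof (rule power2_less_imp_less)
      have "inverse (real (Suc i)) \<le> inverse (real (Suc N))" "inverse (real (Suc j)) \<le> inverse (real (Suc N))"
        using that by (simp_all add: le_imp_inverse_le)
      then show "(hnorm H (R (G i) - R (G j)))\<^sup>2 < \<epsilon>\<^sup>2"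
        using close[of i j] N by argo
    qed (use \<open>\<epsilon> > 0\<close> in simp)
    then show "\<exists>N. \<forall>i\<ge>N. \<forall>j\<ge>N. hnorm H (R (G i) - R (G j)) < \<epsilon>" by blast
  qed
  have GR: "R (G n) \<in> hcarrier H" for n using R(1) G(1) by blast
  have variation: "0 \<le> 2 * Re (cnj t * hinner H h (R k) - t * l k) + (cmod t)\<^sup>2 * (hnorm H (R k))\<^sup>2"
    if k: "k \<in> V" for k t
  proof (rule tendsto_le[OF sequentially_bot _ tendsto_const])
    show "(\<lambda>n. 2 * Re (cnj t * hinner H (R (G n)) (R k) - t * l k) + (cmod t)\<^sup>2 * (hnorm H (R k))\<^sup>2
        + inverse (real (Suc n)))
      \<longlonglongrightarrow> 2 * Re (cnj t * hinner H h (R k) - t * l k) + (cmod t)\<^sup>2 * (hnorm H (R k))\<^sup>2"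
    proof -
      have "(\<lambda>n. 2 * Re (cnj t * hinner H (R (G n)) (R k) - t * l k) + (cmod t)\<^sup>2 * (hnorm H (R k))\<^sup>2
          + inverse (real (Suc n)))
        \<longlonglongrightarrow> 2 * Re (cnj t * hinner H h (R k) - t * l k) + (cmod t)\<^sup>2 * (hnorm H (R k))\<^sup>2 + 0"
        using tendsto_hinner[OF GR h(1) R(1)[OF k] h(2)]
        by (intro tendsto_intros LIMSEQ_inverse_real_of_nat)
      then show ?thesis by simp
    qed
    show "\<forall>\<^sub>F n in sequentially. 0 \<le> 2 * Re (cnj t * hinner H (R (G n)) (R k) - t * l k)
        + (cmod t)\<^sup>2 * (hnorm H (R k))\<^sup>2 + inverse (real (Suc n))"
    proof (intro always_eventually allI)
      fix n
      have "m \<le> \<Phi> (G n + t *\<^sub>C k)" using k G(1) V_closed by (intro m_le) auto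
      then show "0 \<le> 2 * Re (cnj t * hinner H (R (G n)) (R k) - t * l k)
        + (cmod t)\<^sup>2 * (hnorm H (R k))\<^sup>2 + inverse (real (Suc n))"
        using expand[OF G(1) k, of n t] G(2)[of n] by linarith
    qed
  qed
  show thesis
  proof (rule that[OF h(1)])
    fix g assume g: "g \<in> V"
    define d where "d = hinner H (R g) h - l g"
    define N where "N = (hnorm H (R g))\<^sup>2"
    have "Re (cnj t * hinner H h (R g) - t * l g) = Re (t * d)" for t
      using inner_commute[OF R(1)[OF g] h(1)] by (simp add: d_def algebra_simps)
    then have pos: "0 \<le> 2 * Re (t * d) + (cmod t)\<^sup>2 * N" for t
      using variation[OF g, of t] by (simp add: N_def)
    have "d = 0"
    proof (rule ccontr)
      assume d: "d \<noteq> 0"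
      \<comment> \<open>Move against the gradient \<open>cnj d\<close>; this step length keeps the quadratic term below the
        linear one.\<close>
      define s where "s = 1 / (1 + N)"
      have N: "N \<ge> 0" by (simp add: N_def)
      have s: "s > 0" "s * N < 1" using N by (auto simp: s_def field_simps)
      have "- of_real s * cnj d * d = of_real (- s * (cmod d)\<^sup>2)"
        by (simp add: complex_norm_square mult.commute del: of_real_power)
      then have "Re (- of_real s * cnj d * d) = - s * (cmod d)\<^sup>2" by (simp only: Re_complex_of_real)
      moreover have "cmod (- of_real s * cnj d) = s * cmod d" using s(1) by (simp add: norm_mult)
      ultimately have "0 \<le> 2 * (- s * (cmod d)\<^sup>2) + (s * cmod d)\<^sup>2 * N"
        using pos[of "- of_real s * cnj d"] by (simp only:)
      also have "\<dots> = s * (cmod d)\<^sup>2 * (s * N - 2)" by (simp add: algebra_simps power2_eq_square)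
      also have "\<dots> < 0" using s d by (intro mult_pos_neg) auto
      finally show False by simp
    qed
    then show "l g = hinner H (R g) h" by (simp add: d_def)
  next
    fix k assume k: "k \<in> hcarrier H" "\<And>g. g \<in> V \<Longrightarrow> hinner H (R g) k = 0"
    have "(\<lambda>n. hinner H (R (G n)) k) \<longlonglongrightarrow> hinner H h k"
      by (rule tendsto_hinner[OF GR h(1) k(1) h(2)])
    then show "hinner H h k = 0" using k(2)[OF G(1)] LIMSEQ_unique[OF _ tendsto_const] by auto
  qed
qed

lemma (in hilbert_space) adj_exists:
  assumes K: "hilbert_space K" and A: "A \<in> bounded_ops H K"
  shows "\<exists>A'. A' \<in> bounded_ops K H \<and>
    (\<forall>x\<in>hcarrier H. \<forall>y\<in>hcarrier K. hinner K (A x) y = hinner H x (A' y))"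
proof -
  interpret K: hilbert_space K by fact
  obtain M where M: "M \<ge> 0" "\<And>x. x \<in> hcarrier H \<Longrightarrow> hnorm K (A x) \<le> M * hnorm H x"
    using bounded_ops_bound[OF prehilbert_axioms A] by blast
  have "\<exists>z\<in>hcarrier H. \<forall>x\<in>hcarrier H. hinner K (A x) y = hinner H x z" if y: "y \<in> hcarrier K" for y
  proof -
    have bound: "cmod (hinner K (A x) y) \<le> (M * hnorm K y) * hnorm H x" if x: "x \<in> hcarrier H" for x
      using K.Cauchy_Schwarz[OF bounded_opsD(1)[OF A x] y]
        mult_right_mono[OF M(2)[OF x], of "hnorm K y"] y by (simp add: mult_ac)
    show ?thesis
      by (rule bounded_form_represented[OF subspace _ _ _ _ _ bound, of id])
        (use bounded_opsD[OF A] y in \<open>auto simp: K.inner_add K.inner_scaleC\<close>)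
  qed
  then obtain A' where A': "\<And>y. y \<in> hcarrier K \<Longrightarrow> A' y \<in> hcarrier H"
    "\<And>x y. x \<in> hcarrier H \<Longrightarrow> y \<in> hcarrier K \<Longrightarrow> hinner K (A x) y = hinner H x (A' y)"
    by metis
  have "A' \<in> bounded_ops K H"
    unfolding bounded_ops_def
  proof (intro CollectI conjI ballI allI exI)
    show "A' (y + z) = A' y + A' z" if "y \<in> hcarrier K" "z \<in> hcarrier K" for y z
      using A' that bounded_opsD[OF A]
      by (intro inner_ext) (simp_all add: K.inner_add_right inner_add_right flip: A'(2))
    show "A' (c *\<^sub>C y) = c *\<^sub>C A' y" if "y \<in> hcarrier K" for c y
      using A' that bounded_opsD[OF A]
      by (intro inner_ext) (simp_all add: K.inner_scaleC_right inner_scaleC_right flip: A'(2))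
    show "hnorm H (A' y) \<le> M * hnorm K y" if y: "y \<in> hcarrier K" for y
    proof -
      have "cmod (hinner H (A' y) (A' y)) = cmod (hinner K (A (A' y)) y)" using A' y by simp
      also have "\<dots> \<le> hnorm K (A (A' y)) * hnorm K y"
        using A' y bounded_opsD[OF A] by (intro K.Cauchy_Schwarz) auto
      also have "\<dots> \<le> M * hnorm H (A' y) * hnorm K y"
        using A' y M by (intro mult_right_mono) auto
      finally show ?thesis using A' y M(1) by (intro hnorm_le_of_inner_self) (simp_all add: mult_ac)
    qed
  qed (use A' in auto)
  then show ?thesis using A' by auto
qed

lemma
  assumes "hilbert_space H" "hilbert_space K" "A \<in> bounded_ops H K"
  shows adj_bounded: "adj H K A \<in> bounded_ops K H"
    and inner_adj: "x \<in> hcarrier H \<Longrightarrow> y \<in> hcarrier K \<Longrightarrow> hinner K (A x) y = hinner H x (adj H K A y)"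
  using someI_ex[OF hilbert_space.adj_exists[OF assms]] unfolding adj_def[symmetric] by auto

lemma adj_contraction:
  assumes H: "hilbert_space H" and K: "hilbert_space K" and A: "A \<in> bounded_ops H K"
    and contr: "\<And>x. x \<in> hcarrier H \<Longrightarrow> hnorm K (A x) \<le> hnorm H x" and y: "y \<in> hcarrier K"
  shows "hnorm H (adj H K A y) \<le> hnorm K y"
proof -
  interpret H: hilbert_space H by fact
  interpret K: hilbert_space K by fact
  let ?z = "adj H K A y"
  have z: "?z \<in> hcarrier H" using bounded_opsD(1)[OF adj_bounded[OF H K A] y] .
  have "cmod (hinner H ?z ?z) = cmod (hinner K (A ?z) y)" using inner_adj[OF H K A z y] by simp
  also have "\<dots> \<le> hnorm K (A ?z) * hnorm K y"
    using bounded_opsD(1)[OF A z] y by (rule K.Cauchy_Schwarz)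
  also have "\<dots> \<le> hnorm H ?z * hnorm K y" using contr[OF z] y by (intro mult_right_mono) auto
  finally show ?thesis using z y by (intro H.hnorm_le_of_inner_self) (simp_all add: mult_ac)
qed

lemma adj_adj:
  assumes H: "hilbert_space H" and K: "hilbert_space K" and A: "A \<in> bounded_ops H K"
    and x: "x \<in> hcarrier H"
  shows "adj K H (adj H K A) x = A x"
proof -
  interpret H: hilbert_space H by fact
  interpret K: hilbert_space K by fact
  note A' = adj_bounded[OF H K A]
  note A'' = adj_bounded[OF K H A']
  show ?thesis
  proof (rule K.inner_ext)
    fix z assume z: "z \<in> hcarrier K"
    have "hinner K z (adj K H (adj H K A) x) = hinner H (adj H K A z) x"
      using inner_adj[OF K H A' z x] by simp
    also have "\<dots> = cnj (hinner H x (adj H K A z))"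
      using bounded_opsD(1)[OF A' z] x by (rule H.inner_commute)
    also have "\<dots> = cnj (hinner K (A x) z)" using inner_adj[OF H K A x z] by simp
    also have "\<dots> = hinner K z (A x)"
      using K.inner_commute[OF z bounded_opsD(1)[OF A x]] by simp
    finally show "hinner K z (adj K H (adj H K A) x) = hinner K z (A x)" .
  qed (use bounded_opsD(1)[OF A''] bounded_opsD(1)[OF A] x in auto)
qed



section \<open>Square roots of defect operators\<close>

definition self_adjoint :: "'a inner_space \<Rightarrow> ('a \<Rightarrow> 'a) \<Rightarrow> bool"
  where "self_adjoint H X \<longleftrightarrow>
    (\<forall>x\<in>hcarrier H. \<forall>y\<in>hcarrier H. hinner H (X x) y = hinner H x (X y))"

text \<open>
  In a complex space real values of \<open>\<langle>R x, x\<rangle>\<close> already force self-adjointness, by polarisation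
  with \<open>x + y\<close> and \<open>x + \<i> y\<close>.
\<close>

lemma positive_op_self_adjoint:
  assumes "prehilbert H" "positive_op H R"
  shows "self_adjoint H R"
  unfolding self_adjoint_def
proof (intro ballI)
  fix x y assume x: "x \<in> hcarrier H" and y: "y \<in> hcarrier H"
  interpret prehilbert H by fact
  have R: "R \<in> bounded_ops H H" and pos: "\<And>x. x \<in> hcarrier H \<Longrightarrow> Im (hinner H (R x) x) = 0"
    using assms(2) by (auto simp: positive_op_def complex_nonneg_Reals_iff)
  note [simp] = bounded_opsD[OF R] inner_add inner_add_right inner_scaleC inner_scaleC_right
  have "Im (hinner H (R x) y) + Im (hinner H (R y) x) = 0"
    using pos[of "x + y"] pos[of x] pos[of y] x y by simp
  moreover have "Re (hinner H (R y) x) - Re (hinner H (R x) y) = 0"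
    using pos[of "x + \<i> *\<^sub>C y"] pos[of x] pos[of y] x y by simp
  ultimately have "hinner H (R x) y = cnj (hinner H (R y) x)"
    by (simp add: complex_eq_iff)
  also have "\<dots> = hinner H x (R y)" using inner_commute[of x "R y"] x y by simp
  finally show "hinner H (R x) y = hinner H x (R y)" .
qed

text \<open>
  The operator \<open>Y = I - (I - X)\<^sup>1\<^sup>/\<^sup>2\<close> solves \<open>Y = (X + Y\<^sup>2) / 2\<close>. Iterating this equation from \<open>0\<close> is
  dominated by the same iteration for the number \<open>1\<close> in place of \<open>X\<close>, which increases and is
  bounded by \<open>1\<close>.
\<close>

primrec sqrt_majorant :: "nat \<Rightarrow> real" where
  "sqrt_majorant 0 = 0"
| "sqrt_majorant (Suc n) = (1 + (sqrt_majorant n)\<^sup>2) / 2"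

lemma sqrt_majorant_bounds: "0 \<le> sqrt_majorant n" "sqrt_majorant n \<le> 1"
proof -
  have "0 \<le> sqrt_majorant n \<and> sqrt_majorant n \<le> 1"
    by (induction n) (auto simp: power_le_one)
  then show "0 \<le> sqrt_majorant n" "sqrt_majorant n \<le> 1" by auto
qed

lemma sqrt_majorant_mono: "incseq sqrt_majorant"
proof (rule incseq_SucI)
  fix n
  have "0 \<le> (sqrt_majorant n - 1)\<^sup>2" by simp
  then show "sqrt_majorant n \<le> sqrt_majorant (Suc n)" by (simp add: power2_diff)
qed

lemma sqrt_majorant_Cauchy: "Cauchy sqrt_majorant"
proof -
  obtain L where "sqrt_majorant \<longlonglongrightarrow> L"
    using incseq_convergent[OF sqrt_majorant_mono] sqrt_majorant_bounds(2) by metis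
  then show ?thesis by (rule LIMSEQ_imp_Cauchy)
qed

primrec sqrt_iter :: "('a \<Rightarrow> 'a) \<Rightarrow> nat \<Rightarrow> 'a \<Rightarrow> 'a::complex_vector" where
  "sqrt_iter X 0 x = 0"
| "sqrt_iter X (Suc n) x = (1/2) *\<^sub>C (X x + sqrt_iter X n (sqrt_iter X n x))"

locale self_adjoint_contraction = hilbert_space H for H :: "'a::complex_vector inner_space" +
  fixes X :: "'a \<Rightarrow> 'a"
  assumes X: "X \<in> bounded_ops H H" and self_adjoint: "self_adjoint H X"
    and contraction: "x \<in> hcarrier H \<Longrightarrow> hnorm H (X x) \<le> hnorm H x"
begin

abbreviation "Y \<equiv> sqrt_iter X"
abbreviation "t \<equiv> sqrt_majorant"

lemma iter_carrier [simp]: "x \<in> hcarrier H \<Longrightarrow> Y n x \<in> hcarrier H"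
  using bounded_opsD(1)[OF X] by (induction n arbitrary: x) auto

lemma iter_add: "x \<in> hcarrier H \<Longrightarrow> y \<in> hcarrier H \<Longrightarrow> Y n (x + y) = Y n x + Y n y"
  using bounded_opsD(1,2)[OF X] by (induction n arbitrary: x y) (auto simp: scaleC_add_right)

lemma iter_diff: "x \<in> hcarrier H \<Longrightarrow> y \<in> hcarrier H \<Longrightarrow> Y n (x - y) = Y n x - Y n y"
  using iter_add[of "x - y" y n] by (simp add: algebra_simps)

lemma iter_norm: "x \<in> hcarrier H \<Longrightarrow> hnorm H (Y n x) \<le> t n * hnorm H x"
proof (induction n arbitrary: x)
  case (Suc n)
  have "hnorm H (Y n (Y n x)) \<le> t n * hnorm H (Y n x)" using Suc by simp
  also have "\<dots> \<le> t n * (t n * hnorm H x)"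
    using Suc sqrt_majorant_bounds by (intro mult_left_mono) auto
  finally have "hnorm H (X x + Y n (Y n x)) \<le> hnorm H x + t n * (t n * hnorm H x)"
    using hnorm_triangle[of "X x" "Y n (Y n x)"] contraction[OF Suc.prems] bounded_opsD(1)[OF X Suc.prems]
      Suc.prems by simp
  moreover have "hnorm H (Y (Suc n) x) = hnorm H (X x + Y n (Y n x)) / 2"
    using Suc.prems bounded_opsD(1)[OF X Suc.prems] by (simp add: hnorm_scaleC)
  ultimately show ?case by (simp add: algebra_simps power2_eq_square add_divide_distrib)
qed simp

lemma iter_self_adjoint:
  "x \<in> hcarrier H \<Longrightarrow> y \<in> hcarrier H \<Longrightarrow> hinner H (Y n x) y = hinner H x (Y n y)"
proof (induction n arbitrary: x y)
  case (Suc n)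
  then show ?case using bounded_opsD(1)[OF X] self_adjoint
    by (simp add: inner_scaleC inner_scaleC_right inner_add inner_add_right self_adjoint_def)
qed simp

text \<open>
  The difference of the squares splits as \<open>Y\<^sub>n\<^sub>+\<^sub>1 (Y\<^sub>n\<^sub>+\<^sub>1 - Y\<^sub>n) + (Y\<^sub>n\<^sub>+\<^sub>1 - Y\<^sub>n) Y\<^sub>n\<close>, which is
  bounded by the corresponding difference for the majorant.
\<close>

lemma iter_step: "x \<in> hcarrier H \<Longrightarrow> hnorm H (Y (Suc n) x - Y n x) \<le> (t (Suc n) - t n) * hnorm H x"
proof (induction n arbitrary: x)
  case 0
  then show ?case using contraction[of x] bounded_opsD(1)[OF X, of x] by (simp add: hnorm_scaleC)
next
  case (Suc n)
  note x = Suc.prems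
  define a where "a = Y (Suc n) (Y (Suc n) x - Y n x)"
  define b where "b = Y (Suc n) (Y n x) - Y n (Y n x)"
  have c: "a \<in> hcarrier H" "b \<in> hcarrier H" using x unfolding a_def b_def
    by (intro carrier_diff iter_carrier; simp)+
  have "Y (Suc (Suc n)) x - Y (Suc n) x = (1/2) *\<^sub>C (a + b)"
  proof -
    have "a = Y (Suc n) (Y (Suc n) x) - Y (Suc n) (Y n x)"
      unfolding a_def by (intro iter_diff iter_carrier x)
    then have "Y (Suc n) (Y (Suc n) x) - Y n (Y n x) = a + b" by (simp add: b_def del: sqrt_iter.simps)
    moreover have "Y (Suc (Suc n)) x - Y (Suc n) x = (1/2) *\<^sub>C (X x + Y (Suc n) (Y (Suc n) x))
      - (1/2) *\<^sub>C (X x + Y n (Y n x))"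
      by (simp only: sqrt_iter.simps)
    ultimately show ?thesis
      by (simp add: complex_vector.scale_right_diff_distrib[symmetric] del: sqrt_iter.simps)
  qed
  then have "hnorm H (Y (Suc (Suc n)) x - Y (Suc n) x) = hnorm H (a + b) / 2"
    using c by (simp add: hnorm_scaleC del: sqrt_iter.simps)
  also have "hnorm H (a + b) \<le> hnorm H a + hnorm H b" using c by (rule hnorm_triangle)
  also have "hnorm H a \<le> t (Suc n) * hnorm H (Y (Suc n) x - Y n x)"
    unfolding a_def by (intro iter_norm carrier_diff iter_carrier x)
  also have "\<dots> \<le> t (Suc n) * ((t (Suc n) - t n) * hnorm H x)"
    by (intro mult_left_mono Suc.IH x sqrt_majorant_bounds)
  also have "hnorm H b \<le> (t (Suc n) - t n) * hnorm H (Y n x)"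
    unfolding b_def by (intro Suc.IH iter_carrier x)
  also have "\<dots> \<le> (t (Suc n) - t n) * (t n * hnorm H x)"
    using incseq_SucD[OF sqrt_majorant_mono, of n] by (intro mult_left_mono iter_norm x) simp
  finally have "hnorm H (Y (Suc (Suc n)) x - Y (Suc n) x) \<le>
      (t (Suc n) * ((t (Suc n) - t n) * hnorm H x) + (t (Suc n) - t n) * (t n * hnorm H x)) / 2"
    by simp
  also have "\<dots> = ((t (Suc n))\<^sup>2 - (t n)\<^sup>2) / 2 * hnorm H x"
    by (simp add: algebra_simps power2_eq_square del: sqrt_majorant.simps)
  also have "((t (Suc n))\<^sup>2 - (t n)\<^sup>2) / 2 = t (Suc (Suc n)) - t (Suc n)"
    unfolding sqrt_majorant.simps(2)[of "Suc n"] sqrt_majorant.simps(2)[of n] by (simp add: field_simps)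
  finally show ?case .
qed

lemma iter_dist:
  assumes x: "x \<in> hcarrier H"
  shows "hnorm H (Y (n + k) x - Y n x) \<le> (t (n + k) - t n) * hnorm H x"
proof (induction k)
  case (Suc k)
  have "hnorm H (Y (Suc (n + k)) x - Y n x) \<le> hnorm H (Y (Suc (n + k)) x - Y (n + k) x) + hnorm H (Y (n + k) x - Y n x)"
    by (intro hnorm_triangle_diff iter_carrier x)
  also have "\<dots> \<le> (t (Suc (n + k)) - t (n + k)) * hnorm H x + (t (n + k) - t n) * hnorm H x"
    by (intro add_mono Suc iter_step x)
  finally show ?case by (simp add: algebra_simps del: sqrt_iter.simps sqrt_majorant.simps)
qed (use x in simp)

lemma iter_dist':
  assumes x: "x \<in> hcarrier H"
  shows "hnorm H (Y m x - Y n x) \<le> \<bar>t m - t n\<bar> * hnorm H x"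
proof (cases "n \<le> m")
  case True
  then have "hnorm H (Y m x - Y n x) \<le> (t m - t n) * hnorm H x" using iter_dist[OF x, of n "m - n"] by simp
  also have "\<dots> \<le> \<bar>t m - t n\<bar> * hnorm H x" using x by (intro mult_right_mono) auto
  finally show ?thesis .
next
  case False
  then have "hnorm H (Y n x - Y m x) \<le> (t n - t m) * hnorm H x" using iter_dist[OF x, of m "n - m"] by simp
  also have "\<dots> \<le> \<bar>t m - t n\<bar> * hnorm H x" using x by (intro mult_right_mono) auto
  finally show ?thesis using hnorm_minus_commute[of "Y n x" "Y m x"] x by simp
qed

text \<open>
  The increments of the iteration are bounded by those of a convergent scalar sequence, so it
  converges at every vector; its limit \<open>Z\<close> satisfies \<open>2 Z = X + Z\<^sup>2\<close>, that is \<open>(I - Z)\<^sup>2 = I - X\<close>,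
  and \<open>I - Z\<close> is positive because \<open>Z\<close> is a self-adjoint contraction.
\<close>

lemma positive_root_exists:
  "\<exists>R. positive_op H R \<and> (\<forall>x\<in>hcarrier H. R (R x) = (id - X) x)"
proof -
  have "\<exists>y\<in>hcarrier H. (\<lambda>n. hnorm H (Y n x - y)) \<longlonglongrightarrow> 0" if x: "x \<in> hcarrier H" for x
  proof (rule Cauchy_converges)
    fix \<epsilon> :: real assume "\<epsilon> > 0"
    define \<delta> where "\<delta> = \<epsilon> / (hnorm H x + 1)"
    have pos: "hnorm H x + 1 > 0" using hnorm_nonneg[OF x] by linarith
    have \<delta>: "\<delta> > 0" using \<open>\<epsilon> > 0\<close> pos by (simp add: \<delta>_def)
    obtain N where N: "\<And>m n. m \<ge> N \<Longrightarrow> n \<ge> N \<Longrightarrow> \<bar>t m - t n\<bar> < \<delta>"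
      using sqrt_majorant_Cauchy \<delta> unfolding Cauchy_def dist_real_def by meson
    have "hnorm H (Y m x - Y n x) < \<epsilon>" if "m \<ge> N" "n \<ge> N" for m n
    proof -
      have "hnorm H (Y m x - Y n x) \<le> \<bar>t m - t n\<bar> * hnorm H x" by (rule iter_dist'[OF x])
      also have "\<dots> \<le> \<bar>t m - t n\<bar> * (hnorm H x + 1)" by (intro mult_left_mono) auto
      also have "\<dots> < \<delta> * (hnorm H x + 1)" using N[OF that] pos by (intro mult_strict_right_mono)
      also have "\<dots> = \<epsilon>" using pos by (simp add: \<delta>_def)
      finally show ?thesis .
    qed
    then show "\<exists>N. \<forall>m\<ge>N. \<forall>n\<ge>N. hnorm H (Y m x - Y n x) < \<epsilon>" by blast
  qed (use x in auto)
  then obtain Z where Z: "\<And>x. x \<in> hcarrier H \<Longrightarrow> Z x \<in> hcarrier H"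
    and lim: "\<And>x. x \<in> hcarrier H \<Longrightarrow> (\<lambda>n. hnorm H (Y n x - Z x)) \<longlonglongrightarrow> 0"
    by metis
  have Z_self: "hinner H (Z x) y = hinner H x (Z y)" if "x \<in> hcarrier H" "y \<in> hcarrier H" for x y
  proof (rule LIMSEQ_unique)
    show "(\<lambda>n. hinner H (Y n x) y) \<longlonglongrightarrow> hinner H (Z x) y"
      using that Z lim by (intro tendsto_hinner) auto
    have "(\<lambda>n. hinner H x (Y n y)) \<longlonglongrightarrow> hinner H x (Z y)"
      using that Z lim by (intro tendsto_hinner_right) auto
    then show "(\<lambda>n. hinner H (Y n x) y) \<longlonglongrightarrow> hinner H x (Z y)"
      using that by (simp add: iter_self_adjoint)
  qed
  have Z_norm: "hnorm H (Z x) \<le> hnorm H x" if x: "x \<in> hcarrier H" for x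
  proof (rule LIMSEQ_le_const2)
    show "(\<lambda>n. hnorm H (Y n x)) \<longlonglongrightarrow> hnorm H (Z x)" using x Z lim by (intro tendsto_hnorm) auto
    show "\<exists>N. \<forall>n\<ge>N. hnorm H (Y n x) \<le> hnorm H x"
    proof (intro exI allI impI)
      fix n
      have "hnorm H (Y n x) \<le> t n * hnorm H x" by (rule iter_norm[OF x])
      also have "\<dots> \<le> 1 * hnorm H x" using sqrt_majorant_bounds x by (intro mult_right_mono) auto
      finally show "hnorm H (Y n x) \<le> hnorm H x" by simp
    qed
  qed
  have Z_add: "Z (x + y) = Z x + Z y" if "x \<in> hcarrier H" "y \<in> hcarrier H" for x y
    using that Z by (intro inner_ext) (simp_all add: inner_add_right inner_add flip: Z_self)
  have Z_scaleC: "Z (c *\<^sub>C x) = c *\<^sub>C Z x" if "x \<in> hcarrier H" for x c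
    using that Z by (intro inner_ext) (simp_all add: inner_scaleC_right inner_scaleC flip: Z_self)
  have Z_diff: "Z (x - y) = Z x - Z y" if "x \<in> hcarrier H" "y \<in> hcarrier H" for x y
    using Z_add[of "x - y" y] that by (simp add: algebra_simps)
  have fixpoint: "Z x + Z x = X x + Z (Z x)" if x: "x \<in> hcarrier H" for x
  proof (rule limit_unique[where x = "\<lambda>n. Y (Suc n) x + Y (Suc n) x"])
    have half: "Y (Suc n) x + Y (Suc n) x = X x + Y n (Y n x)" for n
      using x by (simp add: scaleC_add_left[symmetric] scaleC_one)
    have "(\<lambda>n. hnorm H (Y (Suc n) x - Z x)) \<longlonglongrightarrow> 0" using lim[OF x] by (rule LIMSEQ_Suc)
    then show "(\<lambda>n. hnorm H (Y (Suc n) x + Y (Suc n) x - (Z x + Z x))) \<longlonglongrightarrow> 0"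
      using x Z by (intro limit_add iter_carrier) auto
    have l2: "(\<lambda>n. hnorm H (Y n x - Z x) + hnorm H (Y n (Z x) - Z (Z x))) \<longlonglongrightarrow> 0"
      using tendsto_add[OF lim[OF x] lim[OF Z[OF x]]] by simp
    have "(\<lambda>n. hnorm H (X x + Y n (Y n x) - (X x + Z (Z x)))) \<longlonglongrightarrow> 0"
    proof (rule Lim_null_comparison[OF always_eventually l2], rule allI)
      fix n
      have "hnorm H (Y n (Y n x) - Z (Z x)) \<le> hnorm H (Y n (Y n x) - Y n (Z x)) + hnorm H (Y n (Z x) - Z (Z x))"
        using x Z by (intro hnorm_triangle_diff) auto
      also have "Y n (Y n x) - Y n (Z x) = Y n (Y n x - Z x)" using x Z by (simp add: iter_diff)
      also have "hnorm H \<dots> \<le> t n * hnorm H (Y n x - Z x)" using x Z by (intro iter_norm) auto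
      also have "\<dots> \<le> 1 * hnorm H (Y n x - Z x)" using sqrt_majorant_bounds x Z by (intro mult_right_mono) auto
      finally show "norm (hnorm H (X x + Y n (Y n x) - (X x + Z (Z x))))
          \<le> hnorm H (Y n x - Z x) + hnorm H (Y n (Z x) - Z (Z x))"
        using x Z by simp
    qed
    then show "(\<lambda>n. hnorm H (Y (Suc n) x + Y (Suc n) x - (X x + Z (Z x)))) \<longlonglongrightarrow> 0"
      unfolding half .
  qed (use x Z bounded_opsD(1)[OF X x] in \<open>auto simp del: sqrt_iter.simps\<close>)
  show ?thesis
  proof (intro exI conjI ballI)
    show "positive_op H (\<lambda>x. x - Z x)"
      unfolding positive_op_def
    proof (intro conjI ballI)
      show "(\<lambda>x. x - Z x) \<in> bounded_ops H H"
        unfolding bounded_ops_def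
      proof (intro CollectI conjI ballI allI exI)
        show "hnorm H (x - Z x) \<le> 2 * hnorm H x" if x: "x \<in> hcarrier H" for x
          using hnorm_triangle[of "x - Z x" "Z x"] hnorm_triangle_diff[of x 0 "Z x"] Z_norm[OF x] x Z[OF x]
            hnorm_minus_commute[of 0 "Z x"] by simp
      qed (use Z Z_add Z_scaleC in \<open>auto simp: complex_vector.scale_right_diff_distrib\<close>)
      fix x assume x: "x \<in> hcarrier H"
      have "hinner H (Z x) x = cnj (hinner H (Z x) x)"
        using Z_self[OF x x] inner_commute[OF Z[OF x] x] by simp
      then have Im: "Im (hinner H (Z x) x) = 0" by (simp add: complex_eq_iff)
      have "Re (hinner H (Z x) x) \<le> hnorm H (Z x) * hnorm H x"
        using Cauchy_Schwarz[OF Z[OF x] x] complex_Re_le_cmod order_trans by blast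
      also have "\<dots> \<le> hnorm H x * hnorm H x" using Z_norm[OF x] x by (intro mult_right_mono) auto
      finally show "hinner H (x - Z x) x \<in> \<real>\<^sub>\<ge>\<^sub>0" using Im x Z[OF x]
        by (simp add: complex_nonneg_Reals_iff inner_diff inner_self power2_eq_square)
    qed
    fix x assume x: "x \<in> hcarrier H"
    have "(x - Z x) - Z (x - Z x) = x - (Z x + Z x) + Z (Z x)" using x Z by (simp add: Z_diff)
    then show "(x - Z x) - Z (x - Z x) = (id - X) x" unfolding fixpoint[OF x] by simp
  qed
qed

abbreviation "S \<equiv> sqrt_op H (id - X)"

lemma root_bounded: "S \<in> bounded_ops H H"
  and root_self_adjoint: "self_adjoint H S"
  and root_square: "x \<in> hcarrier H \<Longrightarrow> S (S x) = x - X x"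
proof -
  have *: "positive_op H S \<and> (\<forall>x\<in>hcarrier H. S (S x) = (id - X) x)"
    unfolding sqrt_op_def by (rule someI_ex[OF positive_root_exists])
  then show "S \<in> bounded_ops H H" by (simp add: positive_op_def)
  show "self_adjoint H S" using * positive_op_self_adjoint[OF prehilbert_axioms] by blast
  show "x \<in> hcarrier H \<Longrightarrow> S (S x) = x - X x" using * by simp
qed

lemma root_norm:
  assumes x: "x \<in> hcarrier H"
  shows "(hnorm H (S x))\<^sup>2 = (hnorm H x)\<^sup>2 - Re (hinner H (X x) x)"
proof -
  have Sx: "S x \<in> hcarrier H" using bounded_opsD(1)[OF root_bounded x] .
  have "of_real ((hnorm H (S x))\<^sup>2) = hinner H (S x) (S x)" by (rule inner_self[OF Sx, symmetric])
  also have "\<dots> = hinner H (S (S x)) x" using root_self_adjoint x Sx by (simp add: self_adjoint_def)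
  also have "\<dots> = of_real ((hnorm H x)\<^sup>2) - hinner H (X x) x"
    using x bounded_opsD(1)[OF X x] by (simp add: root_square inner_diff inner_self)
  finally have "Re (of_real ((hnorm H (S x))\<^sup>2)) = Re (of_real ((hnorm H x)\<^sup>2) - hinner H (X x) x)"
    by (rule arg_cong)
  then show ?thesis by simp
qed

end


section \<open>Ranges of self-adjoint operators\<close>

text \<open>
  The hypothesis says that \<open>R g \<mapsto> \<langle>g, f\<rangle>\<close> is a bounded functional on the range of \<open>R\<close>. A vector
  representing it is a preimage of \<open>f\<close>.
\<close>

lemma (in hilbert_space) range_self_adjoint:
  assumes R: "R \<in> bounded_ops H H" "self_adjoint H R" and f: "f \<in> hcarrier H"
    and bound: "\<And>g. g \<in> hcarrier H \<Longrightarrow> cmod (hinner H g f) \<le> C * hnorm H (R g)"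
  shows "\<exists>h\<in>ker_perp H R. f = R h"
proof -
  obtain h where h: "h \<in> hcarrier H" "\<And>g. g \<in> hcarrier H \<Longrightarrow> hinner H g f = hinner H (R g) h"
    "\<And>k. k \<in> hcarrier H \<Longrightarrow> (\<And>g. g \<in> hcarrier H \<Longrightarrow> hinner H (R g) k = 0) \<Longrightarrow> hinner H h k = 0"
    by (rule bounded_form_represented[OF subspace bounded_opsD[OF R(1)] _ _ bound])
      (auto simp: inner_add inner_scaleC f)
  have "f = R h"
    using h(1,2) R f bounded_opsD(1)[OF R(1)] by (intro inner_ext) (auto simp: self_adjoint_def)
  moreover have "h \<in> ker_perp H R"
    using h(1,3) R unfolding ker_perp_def self_adjoint_def by auto
  ultimately show ?thesis by blast
qed

context hilbert_space
begin

text \<open>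
  The range norm is defined through preimages orthogonal to the kernel, so one has to know that
  such a preimage exists and that the inner product does not depend on the choices.
\<close>

lemma range_space_norm:
  assumes R: "R \<in> bounded_ops H H" "self_adjoint H R" and x: "x \<in> R ` hcarrier H"
  obtains h where "h \<in> hcarrier H" "x = R h" "hnorm (range_space H R) x = hnorm H h"
proof -
  obtain h0 where h0: "h0 \<in> hcarrier H" "x = R h0" using x by blast
  have "\<exists>h\<in>ker_perp H R. x = R h"
  proof (rule range_self_adjoint[OF R])
    fix g assume g: "g \<in> hcarrier H"
    have "hinner H g x = hinner H (R g) h0" using R(2) g h0 by (simp add: self_adjoint_def)
    then show "cmod (hinner H g x) \<le> hnorm H h0 * hnorm H (R g)"
      using Cauchy_Schwarz[OF bounded_opsD(1)[OF R(1) g] h0(1)] by (simp add: mult.commute)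
  qed (use h0 bounded_opsD(1)[OF R(1)] in auto)
  then obtain h where h: "h \<in> ker_perp H R" "x = R h" by blast
  have hc: "h \<in> hcarrier H" using h by (simp add: ker_perp_def)
  have "hinner (range_space H R) x x = hinner H h h"
    unfolding range_space_def inner_space.simps
  proof (rule the_equality)
    show "\<exists>h1\<in>ker_perp H R. \<exists>h2\<in>hcarrier H. x = R h1 \<and> x = R h2 \<and> hinner H h h = hinner H h1 h2"
      using h hc by blast
    fix c assume "\<exists>h1\<in>ker_perp H R. \<exists>h2\<in>hcarrier H. x = R h1 \<and> x = R h2 \<and> c = hinner H h1 h2"
    then obtain h1 h2 where *: "h1 \<in> ker_perp H R" "h2 \<in> hcarrier H" "R h1 = x" "R h2 = x"
      "c = hinner H h1 h2" by metis
    have h1: "h1 \<in> hcarrier H" using * by (simp add: ker_perp_def)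
    have "R (h1 - h) = 0" "R (h2 - h) = 0"
      using * h hc h1 bounded_ops_diff[OF prehilbert_axioms R(1)] by auto
    then have orth: "hinner H k (h1 - h) = 0" "hinner H k (h2 - h) = 0" if "k \<in> ker_perp H R" for k
      using that * hc h1 by (auto simp: ker_perp_def)
    have "hinner H (h1 - h) (h1 - h) = 0"
      using orth[OF *(1)] orth[OF h(1)] h1 hc by (simp add: inner_diff)
    then have "h1 = h" using inner_definite[of "h1 - h"] h1 hc by simp
    moreover have "hinner H h h2 = hinner H h h" using orth(2)[OF h(1)] hc * by (simp add: inner_diff_right)
    ultimately show "c = hinner H h h" using * by simp
  qed
  then have "hnorm (range_space H R) x = hnorm H h" by (simp add: hnorm_def)
  then show thesis using that hc h by blast
qed

lemma range_space_inner_bound: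
  assumes R: "R \<in> bounded_ops H H" "self_adjoint H R" and x: "x \<in> R ` hcarrier H"
    and y: "y \<in> hcarrier H"
  shows "cmod (hinner H x y) \<le> hnorm (range_space H R) x * hnorm H (R y)"
proof -
  obtain h where h: "h \<in> hcarrier H" "x = R h" "hnorm (range_space H R) x = hnorm H h"
    by (rule range_space_norm[OF R x])
  have "hinner H x y = hinner H h (R y)" using R(2) h y by (simp add: self_adjoint_def)
  then show ?thesis using Cauchy_Schwarz[OF h(1) bounded_opsD(1)[OF R(1) y]] h by simp
qed

end

section \<open>The coefficients of the Bergman kernel\<close>

lemma
  assumes "\<beta> > -2"
  shows bergman_coeff_0: "bergman_coeff \<beta> 0 = 1"
    and bergman_coeff_Suc: "bergman_coeff \<beta> (Suc n) = bergman_coeff \<beta> n * (real n + \<beta> + 2) / (real n + 1)"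
    and bergman_coeff_pos: "bergman_coeff \<beta> n > 0"
proof -
  have pos: "Gamma (real n + \<beta> + 2) > 0" for n using assms by (intro Gamma_real_pos) linarith
  then show "bergman_coeff \<beta> n > 0" using pos[of 0] by (simp add: bergman_coeff_def)
  show "bergman_coeff \<beta> 0 = 1" using pos[of 0] by (simp add: bergman_coeff_def)
  have "real n + \<beta> + 2 \<notin> \<int>\<^sub>\<le>\<^sub>0" using assms by (auto elim!: nonpos_Ints_cases)
  then have "Gamma (real (Suc n) + \<beta> + 2) = (real n + \<beta> + 2) * Gamma (real n + \<beta> + 2)"
    using Gamma_plus1[of "real n + \<beta> + 2"] by (simp add: algebra_simps)
  then show "bergman_coeff \<beta> (Suc n) = bergman_coeff \<beta> n * (real n + \<beta> + 2) / (real n + 1)"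
    by (simp add: bergman_coeff_def field_simps)
qed

text \<open>
  This identity and the next one are the relations between the parameters \<open>\<alpha>\<close> and \<open>\<alpha> - 1\<close> on
  which the inclusions rest.
\<close>

lemma bergman_coeff_shift:
  assumes "\<alpha> > -1"
  shows "bergman_coeff \<alpha> n * (\<alpha> + 1) = bergman_coeff (\<alpha> - 1) n * (real n + \<alpha> + 1)"
proof (induction n)
  case 0
  then show ?case using assms by (simp add: bergman_coeff_0)
next
  case (Suc n)
  have "bergman_coeff \<alpha> (Suc n) * (\<alpha> + 1) = bergman_coeff \<alpha> n * (\<alpha> + 1) * (real n + \<alpha> + 2) / (real n + 1)"
    using assms by (simp add: bergman_coeff_Suc)
  also have "\<dots> = bergman_coeff (\<alpha> - 1) n * (real n + \<alpha> + 1) / (real n + 1) * (real n + \<alpha> + 2)"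
    unfolding Suc by simp
  also have "\<dots> = bergman_coeff (\<alpha> - 1) (Suc n) * (real (Suc n) + \<alpha> + 1)"
    using assms bergman_coeff_Suc[of "\<alpha> - 1" n] by (simp add: algebra_simps)
  finally show ?case .
qed

lemma bergman_coeff_diff:
  assumes "\<alpha> > -1"
  shows "bergman_coeff \<alpha> (Suc n) - bergman_coeff \<alpha> n = bergman_coeff (\<alpha> - 1) (Suc n)"
proof -
  have "bergman_coeff \<alpha> (Suc n) * (real n + 1) = bergman_coeff \<alpha> n * (real n + \<alpha> + 2)"
    using bergman_coeff_Suc[of \<alpha> n] assms by simp
  then have "(bergman_coeff \<alpha> (Suc n) - bergman_coeff \<alpha> n) * (real n + \<alpha> + 2)
      = bergman_coeff \<alpha> (Suc n) * (\<alpha> + 1)" by (simp add: algebra_simps)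
  also have "\<dots> = bergman_coeff (\<alpha> - 1) (Suc n) * (real n + \<alpha> + 2)"
    using bergman_coeff_shift[OF assms, of "Suc n"] by (simp add: algebra_simps)
  finally show ?thesis using assms by simp
qed

lemma bergman_coeff_summable:
  assumes \<alpha>: "\<alpha> > -1" and t: "0 \<le> t" "t < 1"
  shows "summable (\<lambda>n. bergman_coeff \<alpha> n * t ^ n)"
proof -
  define q where "q = (1 + t) / 2"
  have q: "q < 1" "t \<le> q" using t by (auto simp: q_def)
  obtain N where N: "real N * (q - t) \<ge> t * (\<alpha> + 1)"
  proof (cases "t = q")
    case True
    then have "t = 1" by (simp add: q_def)
    then show ?thesis using t by simp
  next
    case False
    then have "q - t > 0" using q by simp
    then show ?thesis using that reals_Archimedean3[of "q - t"] less_imp_le by blast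
  qed
  show ?thesis
  proof (rule summable_ratio_test[OF q(1), of N])
    fix n assume n: "n \<ge> N"
    have "t * (real n + \<alpha> + 2) \<le> q * (real n + 1)"
    proof -
      have "real N * (q - t) \<le> real n * (q - t)" using n q by (intro mult_right_mono) auto
      then have "t * (\<alpha> + 1) \<le> real n * (q - t)" using N by linarith
      then show ?thesis using q by (simp add: algebra_simps)
    qed
    then have "t * (real n + \<alpha> + 2) / (real n + 1) \<le> q" by (simp add: pos_divide_le_eq)
    then have "(bergman_coeff \<alpha> n * t ^ n) * (t * (real n + \<alpha> + 2) / (real n + 1))
        \<le> (bergman_coeff \<alpha> n * t ^ n) * q"
      using bergman_coeff_pos[of \<alpha> n] \<alpha> t by (intro mult_left_mono) auto
    moreover have "bergman_coeff \<alpha> (Suc n) * t ^ Suc n =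
        (bergman_coeff \<alpha> n * t ^ n) * (t * (real n + \<alpha> + 2) / (real n + 1))"
      using bergman_coeff_Suc[of \<alpha> n] \<alpha> by simp
    ultimately show "norm (bergman_coeff \<alpha> (Suc n) * t ^ Suc n) \<le> q * norm (bergman_coeff \<alpha> n * t ^ n)"
      using bergman_coeff_pos[of \<alpha>] \<alpha> t by (simp add: abs_mult less_imp_le mult.commute del: power_Suc)
  qed
qed


section \<open>Vector-valued power series\<close>

text \<open>
  Moving the series up by one degree gives it the value \<open>0\<close> at \<open>0\<close>, as the theorem on isolated
  zeros requires, also when the nonzero coefficient is the constant one.
\<close>

lemma power_series_zero:
  fixes a :: "nat \<Rightarrow> complex"
  assumes "\<And>z. z \<in> ball 0 1 \<Longrightarrow> (\<lambda>n. a n * z ^ n) sums 0"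
  shows "a n = 0"
proof (rule ccontr)
  assume n: "a n \<noteq> 0"
  define b where "b k = (case k of 0 \<Rightarrow> 0 | Suc k \<Rightarrow> a k)" for k
  have b: "(\<lambda>k. b k * (z - 0) ^ k) sums 0" if "norm (z - 0) < 1" for z
  proof -
    have "(\<lambda>k. z * (a k * z ^ k)) sums (z * 0)" using that by (intro sums_mult assms) simp
    then have "(\<lambda>k. b (Suc k) * z ^ Suc k) sums 0" by (simp add: b_def mult_ac)
    from sums_Suc[OF this] show ?thesis by (simp add: b_def)
  qed
  have bn: "b (Suc n) \<noteq> 0" using n by (simp add: b_def)
  obtain s where s: "s > 0" "\<And>z::complex. cmod z \<le> s \<Longrightarrow> z \<noteq> 0 \<Longrightarrow> False"
    by (rule powser_0_nonzero[of 1 0 b "\<lambda>_. 0" "Suc n"]) (use b bn in \<open>auto simp: dist_norm\<close>)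
  show False using s(2)[of "of_real s"] s(1) by simp
qed

context prehilbert
begin

lemma has_taylorD:
  assumes "has_taylor H f a"
  shows "a n \<in> hcarrier H" "z \<in> ball 0 1 \<Longrightarrow> f z \<in> hcarrier H"
    "z \<in> ball 0 1 \<Longrightarrow> (\<lambda>N. hnorm H (f z - (\<Sum>n<N. z ^ n *\<^sub>C a n))) \<longlonglongrightarrow> 0"
    "z \<notin> ball 0 1 \<Longrightarrow> f z = 0"
  using assms unfolding has_taylor_def by blast+

lemma has_taylor_inner:
  assumes f: "has_taylor H f a" and z: "z \<in> ball 0 1" and y: "y \<in> hcarrier H"
  shows "(\<lambda>n. hinner H (a n) y * z ^ n) sums hinner H (f z) y"
proof -
  note * = has_taylorD[OF f]
  have c: "(\<Sum>n<N. z ^ n *\<^sub>C a n) \<in> hcarrier H" for N by (intro carrier_sum carrier_scaleC *)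
  have "(\<lambda>N. hinner H (\<Sum>n<N. z ^ n *\<^sub>C a n) y) \<longlonglongrightarrow> hinner H (f z) y"
    using *(3)[OF z] hnorm_minus_commute[OF *(2)[OF z] c] by (intro tendsto_hinner c * z y) simp
  also have "(\<lambda>N. hinner H (\<Sum>n<N. z ^ n *\<^sub>C a n) y) = (\<lambda>N. \<Sum>n<N. hinner H (a n) y * z ^ n)"
  proof
    fix N
    have "hinner H (\<Sum>n<N. z ^ n *\<^sub>C a n) y = (\<Sum>n<N. hinner H (z ^ n *\<^sub>C a n) y)"
      by (intro inner_sum carrier_scaleC * y)
    then show "hinner H (\<Sum>n<N. z ^ n *\<^sub>C a n) y = (\<Sum>n<N. hinner H (a n) y * z ^ n)"
      using * y by (simp add: inner_scaleC mult.commute)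
  qed
  finally show ?thesis unfolding sums_def .
qed

lemma has_taylor_unique:
  assumes f: "has_taylor H f a" and g: "has_taylor H f b"
  shows "a = b"
proof
  fix n
  note * = has_taylorD(1)[OF f] has_taylorD(1)[OF g]
  have "hinner H (a n - b n) (a n - b n) = 0"
  proof (rule power_series_zero[of "\<lambda>k. hinner H (a k - b k) (a n - b n)"])
    fix z :: complex assume z: "z \<in> ball 0 1"
    have y: "a n - b n \<in> hcarrier H" using * by auto
    show "(\<lambda>k. hinner H (a k - b k) (a n - b n) * z ^ k) sums 0"
      using sums_diff[OF has_taylor_inner[OF f z y] has_taylor_inner[OF g z y]] *
      by (simp add: inner_diff left_diff_distrib)
  qed
  then show "a n = b n" using inner_definite[of "a n - b n"] * by simp
qed

lemma taylor_eq: "has_taylor H f a \<Longrightarrow> taylor H f = a"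
  unfolding taylor_def using has_taylor_unique by blast

lemma has_taylor_eq:
  assumes f: "has_taylor H f a" and g: "has_taylor H g a"
  shows "f = g"
proof
  fix z
  show "f z = g z"
  proof (cases "z \<in> ball 0 1")
    case z: True
    show ?thesis
    proof (rule inner_ext_left[OF has_taylorD(2)[OF f z] has_taylorD(2)[OF g z]])
      fix y assume y: "y \<in> hcarrier H"
      show "hinner H (f z) y = hinner H (g z) y"
        using sums_unique2[OF has_taylor_inner[OF f z y] has_taylor_inner[OF g z y]] .
    qed
  qed (use has_taylorD(4)[OF f] has_taylorD(4)[OF g] in auto)
qed

lemma has_taylor_add:
  assumes f: "has_taylor H f a" and g: "has_taylor H g b"
  shows "has_taylor H (f + g) (\<lambda>n. a n + b n)"
  unfolding has_taylor_def
proof (intro conjI allI ballI impI)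
  note * = has_taylorD[OF f] has_taylorD[OF g]
  fix z :: complex assume z: "z \<in> ball 0 1"
  have c: "(\<Sum>n<N. z ^ n *\<^sub>C a n) \<in> hcarrier H" "(\<Sum>n<N. z ^ n *\<^sub>C b n) \<in> hcarrier H" for N
    by (intro carrier_sum carrier_scaleC *)+
  have "hnorm H ((f + g) z - (\<Sum>n<N. z ^ n *\<^sub>C (a n + b n))) =
      hnorm H ((\<Sum>n<N. z ^ n *\<^sub>C a n) + (\<Sum>n<N. z ^ n *\<^sub>C b n) - (f z + g z))" for N
    using hnorm_minus_commute[OF carrier_add[OF *(2)[OF z] *(6)[OF z]] carrier_add[OF c]]
    by (simp add: scaleC_add_right sum.distrib)
  moreover have "(\<lambda>N. hnorm H ((\<Sum>n<N. z ^ n *\<^sub>C a n) + (\<Sum>n<N. z ^ n *\<^sub>C b n) - (f z + g z))) \<longlonglongrightarrow> 0"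
    using *(3)[OF z] *(7)[OF z] hnorm_minus_commute[OF *(2)[OF z] c(1)] hnorm_minus_commute[OF *(6)[OF z] c(2)]
    by (intro limit_add c *(2)[OF z] *(6)[OF z]) simp_all
  ultimately show "(\<lambda>N. hnorm H ((f + g) z - (\<Sum>n<N. z ^ n *\<^sub>C (a n + b n)))) \<longlonglongrightarrow> 0" by simp
qed (use has_taylorD[OF f] has_taylorD[OF g] in auto)

lemma has_taylor_scaleC:
  assumes f: "has_taylor H f a"
  shows "has_taylor H (c *\<^sub>C f) (\<lambda>n. c *\<^sub>C a n)"
  unfolding has_taylor_def
proof (intro conjI allI ballI impI)
  note * = has_taylorD[OF f]
  fix z :: complex assume z: "z \<in> ball 0 1"
  have s: "(\<Sum>n<N. z ^ n *\<^sub>C a n) \<in> hcarrier H" for N by (intro carrier_sum carrier_scaleC *)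
  have "(c *\<^sub>C f) z - (\<Sum>n<N. z ^ n *\<^sub>C (c *\<^sub>C a n)) = c *\<^sub>C (f z - (\<Sum>n<N. z ^ n *\<^sub>C a n))" for N
    by (simp add: scaleC_fun_def complex_vector.scale_right_diff_distrib complex_vector.scale_sum_right
        scaleC_scaleC mult.commute)
  then have "hnorm H ((c *\<^sub>C f) z - (\<Sum>n<N. z ^ n *\<^sub>C (c *\<^sub>C a n))) =
      cmod c * hnorm H (f z - (\<Sum>n<N. z ^ n *\<^sub>C a n))" for N
    using *(2)[OF z] s by (simp add: hnorm_scaleC)
  then show "(\<lambda>N. hnorm H ((c *\<^sub>C f) z - (\<Sum>n<N. z ^ n *\<^sub>C (c *\<^sub>C a n)))) \<longlonglongrightarrow> 0"
    using tendsto_mult_right_zero[OF *(3)[OF z], of "cmod c"] by simp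
qed (use has_taylorD[OF f] in \<open>auto simp: scaleC_fun_def\<close>)

lemma has_taylor_zero: "has_taylor H 0 (\<lambda>_. 0)"
  by (simp add: has_taylor_def)

lemma hnorm_add_sq_le:
  assumes "x \<in> hcarrier H" "y \<in> hcarrier H"
  shows "(hnorm H (x + y))\<^sup>2 \<le> 2 * (hnorm H x)\<^sup>2 + 2 * (hnorm H y)\<^sup>2"
proof -
  have "0 \<le> (hnorm H (x - y))\<^sup>2" by simp
  then show ?thesis using hnorm_add_sq[OF assms] hnorm_diff_sq[OF assms] by linarith
qed

lemma inner_le_sq:
  assumes "x \<in> hcarrier H" "y \<in> hcarrier H"
  shows "cmod (hinner H x y) \<le> (hnorm H x)\<^sup>2 + (hnorm H y)\<^sup>2"
proof -
  have "0 \<le> (hnorm H x - hnorm H y)\<^sup>2" by simp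
  then have "hnorm H x * hnorm H y \<le> ((hnorm H x)\<^sup>2 + (hnorm H y)\<^sup>2) / 2"
    by (simp add: power2_diff)
  also have "\<dots> \<le> (hnorm H x)\<^sup>2 + (hnorm H y)\<^sup>2" using assms by simp
  finally show ?thesis using Cauchy_Schwarz[OF assms] by linarith
qed

end

lemma (in hilbert_space) absolutely_summable_has_limit:
  assumes x: "\<And>n. x n \<in> hcarrier H" and s: "summable (\<lambda>n. hnorm H (x n))"
  shows "\<exists>y\<in>hcarrier H. (\<lambda>N. hnorm H (y - (\<Sum>n<N. x n))) \<longlonglongrightarrow> 0"
proof -
  have c: "(\<Sum>n<N. x n) \<in> hcarrier H" for N using x by auto
  obtain y where y: "y \<in> hcarrier H" "(\<lambda>N. hnorm H ((\<Sum>n<N. x n) - y)) \<longlonglongrightarrow> 0"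
  proof (rule Cauchy_converges[of "\<lambda>N. \<Sum>n<N. x n"])
    fix \<epsilon> :: real assume "\<epsilon> > 0"
    then obtain N where N: "\<And>m n. m \<ge> N \<Longrightarrow> norm (sum (\<lambda>n. hnorm H (x n)) {m..<n}) < \<epsilon>"
      using s unfolding summable_Cauchy by meson
    have one: "hnorm H ((\<Sum>k<n. x k) - (\<Sum>k<m. x k)) < \<epsilon>" if "m \<ge> N" "m \<le> n" for m n
    proof -
      have "(\<Sum>k<n. x k) - (\<Sum>k<m. x k) = sum x {m..<n}"
        using sum_diff_nat_ivl[of 0 m n x] that by (simp add: lessThan_atLeast0)
      also have "hnorm H \<dots> \<le> sum (\<lambda>n. hnorm H (x n)) {m..<n}" using x by (intro hnorm_sum) auto
      finally show ?thesis using N[OF that(1), of n] by simp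
    qed
    have "hnorm H ((\<Sum>k<m. x k) - (\<Sum>k<n. x k)) < \<epsilon>" if "m \<ge> N" "n \<ge> N" for m n
      using one[of m n] one[of n m] that hnorm_minus_commute[OF c c, of m n] by (cases "m \<le> n") auto
    then show "\<exists>N. \<forall>m\<ge>N. \<forall>n\<ge>N. hnorm H ((\<Sum>k<m. x k) - (\<Sum>k<n. x k)) < \<epsilon>" by blast
  qed (use c in auto)
  then show ?thesis using hnorm_minus_commute[OF c y(1)] by auto
qed


section \<open>The weighted Bergman space as a Hilbert space\<close>

locale bergman = E: hilbert_space E for E :: "'e::complex_vector inner_space" +
  fixes \<alpha> :: real
  assumes alpha: "\<alpha> > -1"
begin

abbreviation "c \<equiv> bergman_coeff \<alpha>"
abbreviation "H \<equiv> bergman_space \<alpha> E"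
abbreviation "T \<equiv> taylor E"

lemma c_pos [simp]: "c n > 0" using alpha by (intro bergman_coeff_pos) simp
lemma c_nonneg [simp]: "c n \<ge> 0" using c_pos[of n] by linarith
lemma c_nz [simp]: "c n \<noteq> 0" using c_pos[of n] by linarith

definition ell2 :: "(nat \<Rightarrow> 'e) \<Rightarrow> bool" where
  "ell2 a \<longleftrightarrow> (\<forall>n. a n \<in> hcarrier E) \<and> summable (\<lambda>n. (hnorm E (a n))\<^sup>2 / c n)"

lemma H_carrier_iff: "f \<in> hcarrier H \<longleftrightarrow> has_taylor E f (T f) \<and> ell2 (T f)"
proof -
  have "f \<in> hcarrier H \<longleftrightarrow> (\<exists>a. has_taylor E f a \<and> summable (\<lambda>n. (hnorm E (a n))\<^sup>2 / c n))"
    by (simp add: bergman_space_def)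
  also have "\<dots> \<longleftrightarrow> (\<exists>a. has_taylor E f a \<and> ell2 a)"
    using E.has_taylorD(1) unfolding ell2_def by blast
  also have "\<dots> \<longleftrightarrow> has_taylor E f (T f) \<and> ell2 (T f)"
    using E.taylor_eq by metis
  finally show ?thesis .
qed

lemma H_intro: "has_taylor E f a \<Longrightarrow> ell2 a \<Longrightarrow> f \<in> hcarrier H"
  using H_carrier_iff E.taylor_eq by metis

lemma T_carrier [simp]: "f \<in> hcarrier H \<Longrightarrow> T f n \<in> hcarrier E"
  using H_carrier_iff by (auto simp: ell2_def)

text \<open>
  By \<open>2 u v \<le> u\<^sup>2 + v\<^sup>2\<close> the terms are dominated by those of \<open>\<Sum> c n |z|\<^sup>2\<^sup>n\<close>, the kernel on the
  diagonal, and of the squared norm of \<open>a\<close>.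
\<close>

lemma abs_summable:
  assumes a: "ell2 a" and z: "z \<in> ball 0 1"
  shows "summable (\<lambda>n. cmod z ^ n * hnorm E (a n))"
proof (rule summable_comparison_test')
  have "summable (\<lambda>n. c n * ((cmod z)\<^sup>2) ^ n)"
    using z alpha by (intro bergman_coeff_summable) (auto simp: power_less_one_iff)
  then show "summable (\<lambda>n. c n * ((cmod z)\<^sup>2) ^ n + (hnorm E (a n))\<^sup>2 / c n)"
    using a by (intro summable_add) (auto simp: ell2_def)
  fix n
  define u where "u = sqrt (c n) * cmod z ^ n"
  define v where "v = hnorm E (a n) / sqrt (c n)"
  have an: "a n \<in> hcarrier E" using a by (simp add: ell2_def)
  have uv: "u \<ge> 0" "v \<ge> 0" using an by (auto simp: u_def v_def less_imp_le)
  have "0 \<le> (u - v)\<^sup>2" by simp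
  then have "2 * (u * v) \<le> u\<^sup>2 + v\<^sup>2" by (simp add: power2_diff)
  moreover have "u * v = cmod z ^ n * hnorm E (a n)" by (simp add: u_def v_def)
  moreover have "u\<^sup>2 = c n * ((cmod z)\<^sup>2) ^ n"
    by (simp add: u_def power_mult_distrib power_mult[symmetric] mult.commute)
  moreover have "v\<^sup>2 = (hnorm E (a n))\<^sup>2 / c n" by (simp add: v_def power_divide)
  moreover have "u * v \<ge> 0" using uv by simp
  ultimately show "norm (cmod z ^ n * hnorm E (a n)) \<le> c n * ((cmod z)\<^sup>2) ^ n + (hnorm E (a n))\<^sup>2 / c n"
    by simp
qed

text \<open>
  Together with \<open>H_ext\<close> this identifies the Bergman space with the weighted sequence space \<open>ell2\<close>.
\<close>

lemma synthesis:
  assumes a: "ell2 a"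
  obtains f where "f \<in> hcarrier H" "T f = a"
proof -
  have an: "a n \<in> hcarrier E" for n using a by (simp add: ell2_def)
  have "\<exists>y\<in>hcarrier E. (\<lambda>N. hnorm E (y - (\<Sum>n<N. z ^ n *\<^sub>C a n))) \<longlonglongrightarrow> 0" if "z \<in> ball 0 1" for z
    using abs_summable[OF a that] an
    by (intro E.absolutely_summable_has_limit) (auto simp: E.hnorm_scaleC norm_power)
  then obtain f where f: "\<And>z. z \<in> ball 0 1 \<Longrightarrow> f z \<in> hcarrier E \<and>
      (\<lambda>N. hnorm E (f z - (\<Sum>n<N. z ^ n *\<^sub>C a n))) \<longlonglongrightarrow> 0"
    by metis
  have "has_taylor E (\<lambda>z. if z \<in> ball 0 1 then f z else 0) a"
    unfolding has_taylor_def using an f by simp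
  then show thesis using that H_intro a E.taylor_eq by blast
qed

lemma ell2_add: "ell2 a \<Longrightarrow> ell2 b \<Longrightarrow> ell2 (\<lambda>n. a n + b n)"
  unfolding ell2_def
proof (intro conjI; (elim conjE)?)
  assume *: "\<forall>n. a n \<in> hcarrier E" "\<forall>n. b n \<in> hcarrier E"
    "summable (\<lambda>n. (hnorm E (a n))\<^sup>2 / c n)" "summable (\<lambda>n. (hnorm E (b n))\<^sup>2 / c n)"
  show "summable (\<lambda>n. (hnorm E (a n + b n))\<^sup>2 / c n)"
  proof (rule summable_comparison_test')
    show "summable (\<lambda>n. 2 * ((hnorm E (a n))\<^sup>2 / c n) + 2 * ((hnorm E (b n))\<^sup>2 / c n))"
      using * by (intro summable_add summable_mult)
    show "norm ((hnorm E (a n + b n))\<^sup>2 / c n) \<le> 2 * ((hnorm E (a n))\<^sup>2 / c n) + 2 * ((hnorm E (b n))\<^sup>2 / c n)" for n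
      using divide_right_mono[OF E.hnorm_add_sq_le c_nonneg, of "a n" "b n" n] *
      by (simp add: add_divide_distrib)
  qed
qed auto

lemma ell2_scaleC: "ell2 a \<Longrightarrow> ell2 (\<lambda>n. k *\<^sub>C a n)"
  unfolding ell2_def using summable_mult[of "\<lambda>n. (hnorm E (a n))\<^sup>2 / c n" "(cmod k)\<^sup>2"]
  by (auto simp: E.hnorm_scaleC power_mult_distrib)

lemma ell2_diff: "ell2 a \<Longrightarrow> ell2 b \<Longrightarrow> ell2 (\<lambda>n. a n - b n)"
  using ell2_add[of a "\<lambda>n. (-1) *\<^sub>C b n"] ell2_scaleC[of b "-1"] by simp

lemma ell2_inner_summable:
  assumes "ell2 a" "ell2 b"
  shows "summable (\<lambda>n. hinner E (a n) (b n) / of_real (c n))"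
proof (rule summable_comparison_test')
  show "summable (\<lambda>n. (hnorm E (a n))\<^sup>2 / c n + (hnorm E (b n))\<^sup>2 / c n)"
    using assms by (intro summable_add) (auto simp: ell2_def)
  fix n
  have "cmod (hinner E (a n) (b n)) \<le> (hnorm E (a n))\<^sup>2 + (hnorm E (b n))\<^sup>2"
    using assms by (intro E.inner_le_sq) (auto simp: ell2_def)
  then have "cmod (hinner E (a n) (b n)) / c n \<le> ((hnorm E (a n))\<^sup>2 + (hnorm E (b n))\<^sup>2) / c n"
    by (intro divide_right_mono) auto
  then show "norm (hinner E (a n) (b n) / of_real (c n)) \<le> (hnorm E (a n))\<^sup>2 / c n + (hnorm E (b n))\<^sup>2 / c n"
    by (simp add: norm_divide add_divide_distrib)
qed

lemma H_add:
  assumes "f \<in> hcarrier H" "g \<in> hcarrier H"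
  shows "f + g \<in> hcarrier H" "T (f + g) n = T f n + T g n"
proof -
  have *: "has_taylor E (f + g) (\<lambda>n. T f n + T g n)"
    using assms by (intro E.has_taylor_add) (auto simp: H_carrier_iff)
  then show "f + g \<in> hcarrier H" using assms ell2_add by (intro H_intro[OF *]) (auto simp: H_carrier_iff)
  show "T (f + g) n = T f n + T g n" using E.taylor_eq[OF *] by simp
qed

lemma H_scaleC:
  assumes "f \<in> hcarrier H"
  shows "k *\<^sub>C f \<in> hcarrier H" "T (k *\<^sub>C f) n = k *\<^sub>C T f n"
proof -
  have *: "has_taylor E (k *\<^sub>C f) (\<lambda>n. k *\<^sub>C T f n)"
    using assms by (intro E.has_taylor_scaleC) (auto simp: H_carrier_iff)
  then show "k *\<^sub>C f \<in> hcarrier H" using assms ell2_scaleC by (intro H_intro[OF *]) (auto simp: H_carrier_iff)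
  show "T (k *\<^sub>C f) n = k *\<^sub>C T f n" using E.taylor_eq[OF *] by simp
qed

lemma H_diff:
  assumes "f \<in> hcarrier H" "g \<in> hcarrier H"
  shows "f - g \<in> hcarrier H" "T (f - g) n = T f n - T g n"
proof -
  have eq: "f - g = f + (-1) *\<^sub>C g" by simp
  show "f - g \<in> hcarrier H" unfolding eq by (intro H_add H_scaleC assms)
  show "T (f - g) n = T f n - T g n"
    unfolding eq using H_add(2)[OF assms(1) H_scaleC(1)[OF assms(2)], of "-1"] H_scaleC(2)[OF assms(2), of "-1"] by simp
qed

lemma H_zero: "0 \<in> hcarrier H" "T 0 n = 0"
  using H_intro[OF E.has_taylor_zero] E.taylor_eq[OF E.has_taylor_zero] by (auto simp: ell2_def)

lemma H_ext: "f \<in> hcarrier H \<Longrightarrow> g \<in> hcarrier H \<Longrightarrow> (\<And>n. T f n = T g n) \<Longrightarrow> f = g"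
  using E.has_taylor_eq[of f "T f" g] H_carrier_iff by (metis ext)

lemma H_inner: "hinner H f g = (\<Sum>n. hinner E (T f n) (T g n) / of_real (c n))"
  by (simp add: bergman_space_def)

lemma H_inner_sums:
  assumes "f \<in> hcarrier H" "g \<in> hcarrier H"
  shows "(\<lambda>n. hinner E (T f n) (T g n) / of_real (c n)) sums hinner H f g"
  unfolding H_inner using assms by (intro summable_sums ell2_inner_summable) (auto simp: H_carrier_iff)

lemma H_inner_self:
  assumes "f \<in> hcarrier H"
  shows "hinner H f f = of_real (\<Sum>n. (hnorm E (T f n))\<^sup>2 / c n)"
proof -
  have "(\<lambda>n. of_real ((hnorm E (T f n))\<^sup>2 / c n)) sums (of_real (\<Sum>n. (hnorm E (T f n))\<^sup>2 / c n) :: complex)"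
    using assms by (intro sums_of_real summable_sums) (auto simp: H_carrier_iff ell2_def)
  moreover have "of_real ((hnorm E (T f n))\<^sup>2 / c n) = hinner E (T f n) (T f n) / of_real (c n)" for n
    using assms by (simp add: E.inner_self)
  ultimately show ?thesis using sums_unique2[OF H_inner_sums[OF assms assms]] by simp
qed

lemma H_norm_sums:
  assumes "f \<in> hcarrier H"
  shows "(\<lambda>n. (hnorm E (T f n))\<^sup>2 / c n) sums (hnorm H f)\<^sup>2"
proof -
  have s: "summable (\<lambda>n. (hnorm E (T f n))\<^sup>2 / c n)" using assms by (auto simp: H_carrier_iff ell2_def)
  then have "0 \<le> (\<Sum>n. (hnorm E (T f n))\<^sup>2 / c n)" by (intro suminf_nonneg) auto
  then have "(hnorm H f)\<^sup>2 = (\<Sum>n. (hnorm E (T f n))\<^sup>2 / c n)"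
    using H_inner_self[OF assms] by (simp add: hnorm_def)
  then show ?thesis using summable_sums[OF s] by simp
qed

lemma prehilbert_H: "prehilbert H"
proof
  show "complex_vector.subspace (hcarrier H)"
    by (intro complex_vector.subspaceI H_zero H_add H_scaleC)
next
  fix f g h assume *: "f \<in> hcarrier H" "g \<in> hcarrier H" "h \<in> hcarrier H"
  show "hinner H (f + g) h = hinner H f h + hinner H g h"
    using sums_unique2[OF H_inner_sums[OF H_add(1)[OF *(1,2)] *(3)]]
      sums_add[OF H_inner_sums[OF *(1,3)] H_inner_sums[OF *(2,3)]] *
    by (simp add: H_add E.inner_add add_divide_distrib)
next
  fix f g k assume *: "f \<in> hcarrier H" "g \<in> hcarrier H"
  show "hinner H (k *\<^sub>C f) g = k * hinner H f g"
    using sums_unique2[OF H_inner_sums[OF H_scaleC(1)[OF *(1)] *(2)]]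
      sums_mult[OF H_inner_sums[OF *], of k] *
    by (simp add: H_scaleC E.inner_scaleC)
  have sym: "cnj (hinner E (T g n) (T f n) / of_real (c n)) = hinner E (T f n) (T g n) / of_real (c n)" for n
    using E.inner_commute[of "T f n" "T g n"] * by simp
  have "(\<lambda>n. cnj (hinner E (T g n) (T f n) / of_real (c n))) sums cnj (hinner H g f)"
    unfolding sums_cnj by (rule H_inner_sums[OF *(2,1)])
  then show "hinner H f g = cnj (hinner H g f)"
    unfolding sym by (rule sums_unique2[OF H_inner_sums[OF *]])
next
  fix f assume f: "f \<in> hcarrier H"
  note nn = H_norm_sums[OF f]
  show "hinner H f f \<in> \<real>\<^sub>\<ge>\<^sub>0"
    unfolding H_inner_self[OF f] using nn by (simp add: sums_iff del: of_real_power)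
  assume "hinner H f f = 0"
  then have "(\<Sum>n. (hnorm E (T f n))\<^sup>2 / c n) = 0" unfolding H_inner_self[OF f] by simp
  then have "(hnorm E (T f n))\<^sup>2 / c n = 0" for n
    using nn by (subst (asm) suminf_eq_zero_iff) (auto simp: sums_iff)
  then have "T f n = T 0 n" for n using f E.hnorm_eq_0[of "T f n"] by (simp add: H_zero)
  then show "f = 0" using H_ext[OF f H_zero(1)] by blast
qed

lemma sum_le_sums:
  fixes u :: "nat \<Rightarrow> real"
  assumes "u sums l" "finite I" "\<And>n. u n \<ge> 0"
  shows "sum u I \<le> l"
  using sum_le_suminf[of u I] assms by (simp add: sums_iff)

lemma coeff_bound:
  assumes "f \<in> hcarrier H"
  shows "hnorm E (T f n) \<le> sqrt (c n) * hnorm H f"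
proof -
  interpret P: prehilbert H by (rule prehilbert_H)
  have "(hnorm E (T f n))\<^sup>2 / c n = (\<Sum>k\<in>{n}. (hnorm E (T f k))\<^sup>2 / c k)" by simp
  also have "\<dots> \<le> (hnorm H f)\<^sup>2"
    using H_norm_sums[OF assms] by (intro sum_le_sums) auto
  finally have "(hnorm E (T f n))\<^sup>2 \<le> (sqrt (c n) * hnorm H f)\<^sup>2"
    by (simp add: power_mult_distrib pos_divide_le_eq mult.commute)
  then show ?thesis by (rule power2_le_imp_le) (use assms in simp)
qed

text \<open>
  The coefficients of a Cauchy sequence converge in \<open>E\<close>. Bounding finitely many of them at a time
  and then letting the second index tend to infinity shows that the limit coefficients belong to
  \<open>ell2\<close> and that convergence holds in norm.
\<close>

lemma hilbert_H: "hilbert_space H"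
proof -
  interpret P: prehilbert H by (rule prehilbert_H)
  have complete: "\<exists>f\<in>hcarrier H. (\<lambda>i. hnorm H (F i - f)) \<longlonglongrightarrow> 0"
    if F: "\<And>i. F i \<in> hcarrier H" and Cauchy: "\<And>\<epsilon>. \<epsilon> > 0 \<Longrightarrow> \<exists>N. \<forall>i\<ge>N. \<forall>j\<ge>N. hnorm H (F i - F j) < \<epsilon>" for F
  proof -
    have "\<exists>y\<in>hcarrier E. (\<lambda>i. hnorm E (T (F i) n - y)) \<longlonglongrightarrow> 0" for n
    proof -
      obtain y where "y \<in> hcarrier E" "(\<lambda>i. hnorm E (T (F i) n - y)) \<longlonglongrightarrow> 0"
      proof (rule E.Cauchy_converges[of "\<lambda>i. T (F i) n"])
        fix \<epsilon> :: real assume "\<epsilon> > 0"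
        then have "\<epsilon> / sqrt (c n) > 0" by simp
        then obtain N where N: "\<And>i j. i \<ge> N \<Longrightarrow> j \<ge> N \<Longrightarrow> hnorm H (F i - F j) < \<epsilon> / sqrt (c n)"
          using Cauchy by meson
        have "hnorm E (T (F i) n - T (F j) n) < \<epsilon>" if "i \<ge> N" "j \<ge> N" for i j
        proof -
          have "hnorm E (T (F i) n - T (F j) n) \<le> sqrt (c n) * hnorm H (F i - F j)"
            using coeff_bound[OF H_diff(1)[OF F F], of i j n] H_diff(2)[OF F F] by simp
          also have "\<dots> < sqrt (c n) * (\<epsilon> / sqrt (c n))"
            using N[OF that] by (intro mult_strict_left_mono) auto
          finally show ?thesis by simp
        qed
        then show "\<exists>N. \<forall>i\<ge>N. \<forall>j\<ge>N. hnorm E (T (F i) n - T (F j) n) < \<epsilon>" by blast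
      qed (use F in auto)
      then show ?thesis by blast
    qed
    then obtain a where a: "\<And>n. a n \<in> hcarrier E" "\<And>n. (\<lambda>i. hnorm E (T (F i) n - a n)) \<longlonglongrightarrow> 0"
      by metis
    have partial: "(\<Sum>n<M. (hnorm E (T (F i) n - a n))\<^sup>2 / c n) \<le> \<epsilon>\<^sup>2"
      if N: "\<And>i j. i \<ge> N \<Longrightarrow> j \<ge> N \<Longrightarrow> hnorm H (F i - F j) < \<epsilon>" and i: "i \<ge> N" for N \<epsilon> i M
    proof (rule LIMSEQ_le_const2)
      have "(\<lambda>j. hnorm E (T (F i) n - T (F j) n)) \<longlonglongrightarrow> hnorm E (T (F i) n - a n)" for n
        using a F E.hnorm_minus_commute[of "a n" "T (F _) n"]
        by (intro E.tendsto_hnorm) (auto simp: algebra_simps)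
      then show "(\<lambda>j. \<Sum>n<M. (hnorm E (T (F i) n - T (F j) n))\<^sup>2 / c n) \<longlonglongrightarrow>
          (\<Sum>n<M. (hnorm E (T (F i) n - a n))\<^sup>2 / c n)"
        by (intro tendsto_intros) auto
      show "\<exists>N. \<forall>j\<ge>N. (\<Sum>n<M. (hnorm E (T (F i) n - T (F j) n))\<^sup>2 / c n) \<le> \<epsilon>\<^sup>2"
      proof (intro exI allI impI)
        fix j assume j: "j \<ge> N"
        have s: "(\<lambda>n. (hnorm E (T (F i) n - T (F j) n))\<^sup>2 / c n) sums (hnorm H (F i - F j))\<^sup>2"
          using H_norm_sums[OF H_diff(1)[OF F F], of i j] H_diff(2)[OF F F] by simp
        then have "(\<Sum>n<M. (hnorm E (T (F i) n - T (F j) n))\<^sup>2 / c n) \<le> (hnorm H (F i - F j))\<^sup>2"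
          by (intro sum_le_sums) auto
        also have "\<dots> \<le> \<epsilon>\<^sup>2" using N[OF i j] F by (intro power_mono) auto
        finally show "(\<Sum>n<M. (hnorm E (T (F i) n - T (F j) n))\<^sup>2 / c n) \<le> \<epsilon>\<^sup>2" .
      qed
    qed
    have ell2_d: "ell2 (\<lambda>n. T (F i) n - a n)" and small: "(\<Sum>n. (hnorm E (T (F i) n - a n))\<^sup>2 / c n) \<le> \<epsilon>\<^sup>2"
      if N: "\<And>i j. i \<ge> N \<Longrightarrow> j \<ge> N \<Longrightarrow> hnorm H (F i - F j) < \<epsilon>" and i: "i \<ge> N" for N \<epsilon> i
    proof -
      show "ell2 (\<lambda>n. T (F i) n - a n)" unfolding ell2_def
        using a F partial[OF that] by (auto intro!: summableI_nonneg_bounded)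
      then show "(\<Sum>n. (hnorm E (T (F i) n - a n))\<^sup>2 / c n) \<le> \<epsilon>\<^sup>2"
        using partial[OF that] by (intro suminf_le_const) (auto simp: ell2_def)
    qed
    obtain N where N: "\<And>i j. i \<ge> N \<Longrightarrow> j \<ge> N \<Longrightarrow> hnorm H (F i - F j) < 1" using Cauchy[of 1] by auto
    have "ell2 (\<lambda>n. T (F N) n - (T (F N) n - a n))"
      by (intro ell2_diff ell2_d[OF N order_refl]) (use F H_carrier_iff in auto)
    then have "ell2 a" by simp
    then obtain f where f: "f \<in> hcarrier H" "T f = a" by (rule synthesis)
    have "(\<lambda>i. hnorm H (F i - f)) \<longlonglongrightarrow> 0"
    proof (rule LIMSEQ_I)
      fix r :: real assume r: "r > 0"
      then obtain N where N: "\<And>i j. i \<ge> N \<Longrightarrow> j \<ge> N \<Longrightarrow> hnorm H (F i - F j) < r / 2"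
        using Cauchy[of "r / 2"] by auto
      have "norm (hnorm H (F i - f) - 0) < r" if i: "i \<ge> N" for i
      proof -
        have "(hnorm H (F i - f))\<^sup>2 = (\<Sum>n. (hnorm E (T (F i) n - a n))\<^sup>2 / c n)"
          using H_norm_sums[OF H_diff(1)[OF F f(1)], of i] H_diff(2)[OF F f(1)] f(2) by (simp add: sums_iff)
        also have "\<dots> \<le> (r / 2)\<^sup>2" using N i by (rule small)
        finally have "hnorm H (F i - f) \<le> r / 2" by (rule power2_le_imp_le) (use r in simp)
        then show ?thesis using r P.hnorm_nonneg[OF H_diff(1)[OF F f(1)], of i] by simp
      qed
      then show "\<exists>N. \<forall>i\<ge>N. norm (hnorm H (F i - f) - 0) < r" by blast
    qed
    then show ?thesis using f by blast
  qed
  show ?thesis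
  proof
    show "Metric_space.mcomplete (hcarrier H) (hdist H)"
      unfolding P.mcomplete_iff using complete by blast
  qed (fact P.subspace P.inner_add P.inner_scaleC P.inner_commute P.inner_nonneg P.inner_definite)+
qed

end

section \<open>Taylor coefficients of a contractive analytic function\<close>

lemma opnorm_bound:
  assumes "prehilbert H" "prehilbert K" and A: "A \<in> bounded_ops H K" and x: "x \<in> hcarrier H"
  shows "hnorm K (A x) \<le> opnorm H K A * hnorm H x"
proof -
  interpret H: prehilbert H by fact
  interpret K: prehilbert K by fact
  obtain M where M: "M \<ge> 0" "\<And>x. x \<in> hcarrier H \<Longrightarrow> hnorm K (A x) \<le> M * hnorm H x"
    using bounded_ops_bound[OF assms(1) A] by blast
  show ?thesis
  proof (cases "x = 0")
    case True
    then show ?thesis using bounded_ops_zero[OF assms(1) A] by simp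
  next
    case False
    define n where "n = hnorm H x"
    have n: "n > 0" using False x H.hnorm_eq_0[of x] H.hnorm_nonneg[of x] by (simp add: n_def less_le)
    define u where "u = of_real (inverse n) *\<^sub>C x"
    have u: "u \<in> hcarrier H" "hnorm H u = 1" using x n by (simp_all add: u_def H.hnorm_scaleC norm_inverse flip: n_def)
    have "bdd_above ((\<lambda>x. hnorm K (A x)) ` {x \<in> hcarrier H. hnorm H x \<le> 1})"
    proof (rule bdd_aboveI2)
      fix y assume "y \<in> {x \<in> hcarrier H. hnorm H x \<le> 1}"
      then show "hnorm K (A y) \<le> M" using M(2)[of y] mult_left_mono[of "hnorm H y" 1 M] M(1) by auto
    qed
    then have "hnorm K (A u) \<le> opnorm H K A"
      unfolding opnorm_def using u by (intro cSUP_upper) auto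
    moreover have "hnorm K (A u) = inverse n * hnorm K (A x)"
      using x n bounded_opsD[OF A] by (simp add: u_def K.hnorm_scaleC norm_inverse)
    ultimately show ?thesis using n by (simp add: n_def[symmetric] field_simps)
  qed
qed

lemma power_series_unique:
  fixes a b :: "nat \<Rightarrow> complex"
  assumes "\<And>z. z \<in> ball 0 1 \<Longrightarrow> (\<lambda>n. a n * z ^ n) sums f z" "\<And>z. z \<in> ball 0 1 \<Longrightarrow> (\<lambda>n. b n * z ^ n) sums f z"
  shows "a n = b n"
proof -
  have "a n - b n = 0"
  proof (rule power_series_zero)
    fix z :: complex assume z: "z \<in> ball 0 1"
    show "(\<lambda>n. (a n - b n) * z ^ n) sums 0"
      using sums_diff[OF assms(1)[OF z] assms(2)[OF z]] by (simp add: left_diff_distrib)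
  qed
  then show ?thesis by simp
qed

text \<open>
  Cauchy's estimates on the circles of radius \<open>r < 1\<close> give \<open>|a n| r^n \<le> M\<close>; then \<open>r\<close> tends to \<open>1\<close>.
\<close>

lemma bounded_holomorphic_coeffs:
  fixes f :: "complex \<Rightarrow> complex"
  assumes f: "f holomorphic_on ball 0 1" and bound: "\<And>z. z \<in> ball 0 1 \<Longrightarrow> cmod (f z) \<le> M"
  shows "\<exists>a. (\<forall>n. cmod (a n) \<le> M) \<and> (\<forall>z\<in>ball 0 1. (\<lambda>n. a n * z ^ n) sums f z)"
proof (intro exI conjI allI ballI)
  define a where "a n = (deriv ^^ n) f 0 / fact n" for n
  show "(\<lambda>n. a n * z ^ n) sums f z" if "z \<in> ball 0 1" for z
    using holomorphic_power_series[OF f that] by (simp add: a_def)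
  fix n
  have "cmod (a n) * r ^ n \<le> M" if r: "0 < r" "r < 1" for r :: real
  proof -
    have "cmod ((deriv ^^ n) f 0) \<le> fact n * M / r ^ n"
    proof (rule Cauchy_inequality)
      show "f holomorphic_on ball 0 r" using f r by (rule_tac holomorphic_on_subset) auto
      show "continuous_on (cball 0 r) f"
        using r by (intro holomorphic_on_imp_continuous_on holomorphic_on_subset[OF f]) auto
      show "cmod (f x) \<le> M" if "cmod (0 - x) = r" for x using that r by (intro bound) auto
    qed fact
    then show ?thesis using r by (simp add: a_def norm_divide field_simps)
  qed
  then have "\<forall>\<^sub>F r in at_left 1. cmod (a n) * r ^ n \<le> M"
    using eventually_at_left_real[of 0 1] by (auto elim!: eventually_mono)
  moreover have "((\<lambda>r. cmod (a n) * r ^ n) \<longlongrightarrow> cmod (a n) * 1 ^ n) (at_left 1)"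
    by (intro tendsto_intros)
  ultimately show "cmod (a n) \<le> M"
    using tendsto_upperbound[of "\<lambda>r. cmod (a n) * r ^ n" "cmod (a n) * 1 ^ n" "at_left 1" M] by simp
qed

locale schur_function = hilbert_space E for E :: "'e::complex_vector inner_space" +
  fixes B :: "complex \<Rightarrow> 'e \<Rightarrow> 'e"
  assumes B: "B \<in> Hinf1 E"
begin

lemma B_op: "z \<in> ball 0 1 \<Longrightarrow> B z \<in> bounded_ops E E"
  using B by (simp add: Hinf1_def analytic_op_on_disk_def)

lemma B_contr:
  assumes z: "z \<in> ball 0 1" and x: "x \<in> hcarrier E"
  shows "hnorm E (B z x) \<le> hnorm E x"
proof -
  have "hnorm E (B z x) \<le> opnorm E E (B z) * hnorm E x"
    by (rule opnorm_bound[OF prehilbert_axioms prehilbert_axioms B_op[OF z] x])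
  also have "\<dots> \<le> 1 * hnorm E x"
    using B z x by (intro mult_right_mono) (auto simp: Hinf1_def)
  finally show ?thesis by simp
qed

lemma B_weakly_holomorphic:
  assumes x: "x \<in> hcarrier E" and y: "y \<in> hcarrier E"
  shows "(\<lambda>z. hinner E (B z x) y) holomorphic_on ball 0 1"
  unfolding holomorphic_on_open[OF open_ball]
proof
  fix z :: complex assume z: "z \<in> ball 0 1"
  then obtain D where D: "D \<in> bounded_ops E E"
    and lim: "((\<lambda>w. opnorm E E (inverse (w - z) *\<^sub>C (B w - B z) - D)) \<longlongrightarrow> 0) (at z)"
    using B unfolding Hinf1_def analytic_op_on_disk_def by blast
  have "((\<lambda>w. (hinner E (B w x) y - hinner E (B z x) y) / (w - z)) \<longlongrightarrow> hinner E (D x) y) (at z)"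
  proof (rule LIM_zero_cancel, rule Lim_null_comparison)
    show "((\<lambda>w. opnorm E E (inverse (w - z) *\<^sub>C (B w - B z) - D) * (hnorm E x * hnorm E y)) \<longlongrightarrow> 0) (at z)"
      using tendsto_mult_right[OF lim] by simp
    have "\<forall>\<^sub>F w in at z. w \<in> ball 0 1" using z by (intro eventually_at_in_open') auto
    then show "\<forall>\<^sub>F w in at z. norm ((hinner E (B w x) y - hinner E (B z x) y) / (w - z) - hinner E (D x) y)
        \<le> opnorm E E (inverse (w - z) *\<^sub>C (B w - B z) - D) * (hnorm E x * hnorm E y)"
    proof eventually_elim
      case (elim w)
      define Q where "Q = inverse (w - z) *\<^sub>C (B w - B z) - D"
      note ops = bounded_opsD[OF B_op[OF elim]] bounded_opsD[OF B_op[OF z]] bounded_opsD[OF D]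
      have Q_eq: "Q u = inverse (w - z) *\<^sub>C (B w u - B z u) - D u" for u
        by (simp add: Q_def scaleC_fun_def)
      have Q: "Q \<in> bounded_ops E E"
      proof -
        obtain M where M: "M \<ge> 0" "\<And>x. x \<in> hcarrier E \<Longrightarrow> hnorm E (D x) \<le> M * hnorm E x"
          using bounded_ops_bound[OF prehilbert_axioms D] by blast
        have "hnorm E (Q u) \<le> (cmod (inverse (w - z)) * 2 + M) * hnorm E u" if u: "u \<in> hcarrier E" for u
        proof -
          have c: "B w u \<in> hcarrier E" "B z u \<in> hcarrier E" "D u \<in> hcarrier E" using ops u by auto
          have "hnorm E (Q u) \<le> hnorm E (inverse (w - z) *\<^sub>C (B w u - B z u)) + hnorm E (D u)"
            unfolding Q_eq using hnorm_triangle_diff[of "inverse (w - z) *\<^sub>C (B w u - B z u)" 0 "D u"] c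
              hnorm_minus_commute[of 0 "D u"] by simp
          also have "hnorm E (B w u - B z u) \<le> hnorm E (B w u) + hnorm E (B z u)"
            using hnorm_triangle_diff[of "B w u" 0 "B z u"] c hnorm_minus_commute[of 0 "B z u"] by simp
          then have "hnorm E (B w u - B z u) \<le> 2 * hnorm E u"
            using B_contr[OF elim u] B_contr[OF z u] by simp
          then have "hnorm E (inverse (w - z) *\<^sub>C (B w u - B z u)) \<le> cmod (inverse (w - z)) * (2 * hnorm E u)"
            using c by (simp only: hnorm_scaleC carrier_diff) (intro mult_left_mono; simp)
          finally show ?thesis using M(2)[OF u] by (simp add: algebra_simps)
        qed
        moreover have "Q (u + v) = Q u + Q v" if "u \<in> hcarrier E" "v \<in> hcarrier E" for u v
          unfolding Q_eq using ops that
          by (simp add: scaleC_add_right complex_vector.scale_right_diff_distrib)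
        moreover have "Q (k *\<^sub>C u) = k *\<^sub>C Q u" if "u \<in> hcarrier E" for u k
          unfolding Q_eq using ops that
          by (simp add: scaleC_scaleC complex_vector.scale_right_diff_distrib mult.commute)
        moreover have "Q u \<in> hcarrier E" if "u \<in> hcarrier E" for u
          unfolding Q_eq using ops that by (intro carrier_diff carrier_scaleC) auto
        ultimately show ?thesis unfolding bounded_ops_def by blast
      qed
      have "(hinner E (B w x) y - hinner E (B z x) y) / (w - z) - hinner E (D x) y = hinner E (Q x) y"
        unfolding Q_eq using ops x y
        by (simp add: inner_diff inner_scaleC divide_inverse mult.commute)
      moreover have "cmod (hinner E (Q x) y) \<le> hnorm E (Q x) * hnorm E y"
        using bounded_opsD(1)[OF Q] x y by (intro Cauchy_Schwarz) auto
      moreover have "hnorm E (Q x) * hnorm E y \<le> opnorm E E Q * hnorm E x * hnorm E y"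
        using y by (intro mult_right_mono opnorm_bound prehilbert_axioms Q x) auto
      ultimately show ?case unfolding Q_def[symmetric] by (simp add: mult.assoc)
    qed
  qed
  then show "\<exists>f'. ((\<lambda>z. hinner E (B z x) y) has_field_derivative f') (at z)"
    unfolding has_field_derivative_iff by blast
qed

text \<open>
  The operators \<open>X n\<close> represent the sesquilinear forms given by the Taylor coefficients of the
  scalar functions \<open>\<langle>B z x, y\<rangle>\<close>, and inherit linearity from the uniqueness of those coefficients.
  Since the forms are bounded by \<open>\<parallel>x\<parallel> \<parallel>y\<parallel>\<close>, testing the remainder against itself gives its norm
  bound, a geometric tail.
\<close>

lemma taylor_coefficients:
  obtains X where "\<And>n. X n \<in> bounded_ops E E" "\<And>x. x \<in> hcarrier E \<Longrightarrow> X 0 x = B 0 x"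
    "\<And>z x L. z \<in> ball 0 1 \<Longrightarrow> x \<in> hcarrier E \<Longrightarrow>
      hnorm E (B z x - (\<Sum>m<L. z ^ m *\<^sub>C X m x)) \<le> cmod z ^ L / (1 - cmod z) * hnorm E x"
proof -
  have "\<exists>a. (\<forall>n. cmod (a n) \<le> hnorm E x * hnorm E y) \<and>
      (\<forall>z\<in>ball 0 1. (\<lambda>n. a n * z ^ n) sums hinner E (B z x) y)"
    if x: "x \<in> hcarrier E" and y: "y \<in> hcarrier E" for x y
  proof (rule bounded_holomorphic_coeffs[OF B_weakly_holomorphic[OF that]])
    fix z :: complex assume z: "z \<in> ball 0 1"
    show "cmod (hinner E (B z x) y) \<le> hnorm E x * hnorm E y"
      using Cauchy_Schwarz[OF bounded_opsD(1)[OF B_op[OF z] x] y]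
        mult_right_mono[OF B_contr[OF z x] hnorm_nonneg[OF y]] by linarith
  qed
  then obtain a where a_le: "\<And>x y n. x \<in> hcarrier E \<Longrightarrow> y \<in> hcarrier E \<Longrightarrow> cmod (a x y n) \<le> hnorm E x * hnorm E y"
    and a: "\<And>x y z. x \<in> hcarrier E \<Longrightarrow> y \<in> hcarrier E \<Longrightarrow> z \<in> ball 0 1 \<Longrightarrow>
      (\<lambda>n. a x y n * z ^ n) sums hinner E (B z x) y"
    by metis
  have B_carrier: "B z x \<in> hcarrier E" if "z \<in> ball 0 1" "x \<in> hcarrier E" for z x
    using bounded_opsD(1)[OF B_op] that by auto
  have "\<exists>u\<in>hcarrier E. \<forall>y\<in>hcarrier E. a x y n = hinner E u y" if x: "x \<in> hcarrier E" for x n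
  proof -
    have a_add: "a x (y + y') n = a x y n + a x y' n" if "y \<in> hcarrier E" "y' \<in> hcarrier E" for y y'
    proof (rule power_series_unique)
      fix z :: complex assume z: "z \<in> ball 0 1"
      show "(\<lambda>n. a x (y + y') n * z ^ n) sums hinner E (B z x) (y + y')" using that by (intro a x z) auto
      show "(\<lambda>n. (a x y n + a x y' n) * z ^ n) sums hinner E (B z x) (y + y')"
        using sums_add[OF a[OF x that(1) z] a[OF x that(2) z]] that x B_carrier[OF z x]
        by (simp add: inner_add_right algebra_simps)
    qed
    have a_scaleC: "a x (k *\<^sub>C y) n = cnj k * a x y n" if "y \<in> hcarrier E" for y k
    proof (rule power_series_unique)
      fix z :: complex assume z: "z \<in> ball 0 1"
      show "(\<lambda>n. a x (k *\<^sub>C y) n * z ^ n) sums hinner E (B z x) (k *\<^sub>C y)" using that by (intro a x z) auto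
      show "(\<lambda>n. (cnj k * a x y n) * z ^ n) sums hinner E (B z x) (k *\<^sub>C y)"
        using sums_mult[OF a[OF x that(1) z], of "cnj k"] that x B_carrier[OF z x]
        by (simp add: inner_scaleC_right algebra_simps)
    qed
    obtain u where u: "u \<in> hcarrier E" "\<And>y. y \<in> hcarrier E \<Longrightarrow> cnj (a x y n) = hinner E (id y) u"
      by (rule bounded_form_represented[where V = "hcarrier E" and R = id and l = "\<lambda>y. cnj (a x y n)" and C = "hnorm E x"])
        (use subspace a_le x in \<open>auto simp: a_add a_scaleC\<close>)
    have "a x y n = hinner E u y" if y: "y \<in> hcarrier E" for y
      using u(2)[OF y] inner_commute[OF y u(1)] by simp
    then show ?thesis using u by blast
  qed
  then have "\<forall>n. \<forall>x\<in>hcarrier E. \<exists>u\<in>hcarrier E. \<forall>y\<in>hcarrier E. a x y n = hinner E u y" by blast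
  then obtain X where X: "\<And>x n. x \<in> hcarrier E \<Longrightarrow> X n x \<in> hcarrier E"
    "\<And>x y n. x \<in> hcarrier E \<Longrightarrow> y \<in> hcarrier E \<Longrightarrow> a x y n = hinner E (X n x) y" by metis
  have sums: "(\<lambda>n. hinner E (X n x) y * z ^ n) sums hinner E (B z x) y"
    if "x \<in> hcarrier E" "y \<in> hcarrier E" "z \<in> ball 0 1" for x y z
    using a[OF that] X(2) that by simp
  have X_le: "cmod (hinner E (X n x) y) \<le> hnorm E x * hnorm E y" if "x \<in> hcarrier E" "y \<in> hcarrier E" for x y n
    using a_le[OF that] X(2) that by simp
  have X_contr: "hnorm E (X n x) \<le> hnorm E x" if x: "x \<in> hcarrier E" for x n
    by (rule hnorm_le_of_inner_self) (use X(1)[OF x] X_le[OF x] x in auto)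
  show thesis
  proof (rule that)
    show "X n \<in> bounded_ops E E" for n
      unfolding bounded_ops_def
    proof (intro CollectI conjI ballI allI exI)
      show "X n x \<in> hcarrier E" if "x \<in> hcarrier E" for x by (rule X(1)[OF that])
      show "hnorm E (X n x) \<le> 1 * hnorm E x" if "x \<in> hcarrier E" for x using X_contr[OF that] by simp
      show "X n (x + x') = X n x + X n x'" if x: "x \<in> hcarrier E" "x' \<in> hcarrier E" for x x'
      proof (rule inner_ext_left)
        fix y assume y: "y \<in> hcarrier E"
        have "hinner E (X n (x + x')) y = hinner E (X n x) y + hinner E (X n x') y"
        proof (rule power_series_unique)
          fix z :: complex assume z: "z \<in> ball 0 1"
          show "(\<lambda>n. hinner E (X n (x + x')) y * z ^ n) sums hinner E (B z (x + x')) y"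
            using x y z by (intro sums) auto
          show "(\<lambda>n. (hinner E (X n x) y + hinner E (X n x') y) * z ^ n) sums hinner E (B z (x + x')) y"
            using sums_add[OF sums[OF x(1) y z] sums[OF x(2) y z]] x y B_carrier[OF z] bounded_opsD(2)[OF B_op[OF z]]
            by (simp add: inner_add algebra_simps)
        qed
        then show "hinner E (X n (x + x')) y = hinner E (X n x + X n x') y"
          using x y X(1) by (simp add: inner_add)
      qed (use x X(1) in auto)
      show "X n (k *\<^sub>C x) = k *\<^sub>C X n x" if x: "x \<in> hcarrier E" for x k
      proof (rule inner_ext_left)
        fix y assume y: "y \<in> hcarrier E"
        have "hinner E (X n (k *\<^sub>C x)) y = k * hinner E (X n x) y"
        proof (rule power_series_unique)
          fix z :: complex assume z: "z \<in> ball 0 1"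
          show "(\<lambda>n. hinner E (X n (k *\<^sub>C x)) y * z ^ n) sums hinner E (B z (k *\<^sub>C x)) y"
            using x y z by (intro sums) auto
          show "(\<lambda>n. (k * hinner E (X n x) y) * z ^ n) sums hinner E (B z (k *\<^sub>C x)) y"
            using sums_mult[OF sums[OF x y z], of k] x y B_carrier[OF z] bounded_opsD(3)[OF B_op[OF z]]
            by (simp add: inner_scaleC algebra_simps)
        qed
        then show "hinner E (X n (k *\<^sub>C x)) y = hinner E (k *\<^sub>C X n x) y"
          using x y X(1) by (simp add: inner_scaleC)
      qed (use x X(1) in auto)
    qed
    show "X 0 x = B 0 x" if x: "x \<in> hcarrier E" for x
    proof (rule inner_ext_left)
      fix y assume y: "y \<in> hcarrier E"
      show "hinner E (X 0 x) y = hinner E (B 0 x) y"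
        using sums[OF x y, of 0] powser_sums_zero_iff[of "\<lambda>n. hinner E (X n x) y"] by simp
    qed (use x X(1) B_carrier in auto)
    fix z :: complex and x L assume z: "z \<in> ball 0 1" and x: "x \<in> hcarrier E"
    define v where "v = B z x - (\<Sum>m<L. z ^ m *\<^sub>C X m x)"
    have s: "(\<Sum>m<L. z ^ m *\<^sub>C X m x) \<in> hcarrier E" using X(1)[OF x] by auto
    have v: "v \<in> hcarrier E" unfolding v_def using s B_carrier[OF z x] by auto
    have "hinner E (\<Sum>m<L. z ^ m *\<^sub>C X m x) v = (\<Sum>m<L. hinner E (X m x) v * z ^ m)"
    proof -
      have "hinner E (\<Sum>m<L. z ^ m *\<^sub>C X m x) v = (\<Sum>m<L. hinner E (z ^ m *\<^sub>C X m x) v)"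
        using X(1)[OF x] v by (intro inner_sum) auto
      then show ?thesis using X(1)[OF x] v by (simp add: inner_scaleC mult.commute)
    qed
    moreover have "hinner E v v = hinner E (B z x) v - hinner E (\<Sum>m<L. z ^ m *\<^sub>C X m x) v"
      using inner_diff[OF B_carrier[OF z x] s v] by (simp flip: v_def)
    ultimately have tail: "(\<lambda>m. hinner E (X (m + L) x) v * z ^ (m + L)) sums hinner E v v"
      using sums_split_initial_segment[OF sums[OF x v z], of L] by simp
    have geo: "(\<lambda>m. hnorm E x * hnorm E v * cmod z ^ L * cmod z ^ m) sums
        (hnorm E x * hnorm E v * cmod z ^ L * (1 / (1 - cmod z)))"
      using z by (intro sums_mult geometric_sums) auto
    have "cmod (hinner E v v) \<le> hnorm E x * hnorm E v * cmod z ^ L * (1 / (1 - cmod z))"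
    proof (rule norm_sums_le[OF tail geo])
      fix m
      show "cmod (hinner E (X (m + L) x) v * z ^ (m + L)) \<le> hnorm E x * hnorm E v * cmod z ^ L * cmod z ^ m"
        using mult_right_mono[OF X_le[OF x v, of "m + L"], of "cmod z ^ (m + L)"]
        by (simp add: norm_mult norm_power power_add mult_ac)
    qed
    then show "hnorm E (B z x - (\<Sum>m<L. z ^ m *\<^sub>C X m x)) \<le> cmod z ^ L / (1 - cmod z) * hnorm E x"
      unfolding v_def[symmetric] using v z x
      by (intro hnorm_le_of_inner_self) (auto simp: mult_ac)
  qed
qed

end

section \<open>Contractive Toeplitz sequences and their defects\<close>

text \<open>
  The coefficient sequence of the product of the power series with coefficients \<open>X\<close> and \<open>g\<close>.
\<close>

definition conv :: "(nat \<Rightarrow> 'a \<Rightarrow> 'a) \<Rightarrow> (nat \<Rightarrow> 'a) \<Rightarrow> nat \<Rightarrow> 'a::comm_monoid_add"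
  where "conv X g n = (\<Sum>k\<le>n. X (n - k) (g k))"

definition contractive_toeplitz :: "'a::complex_vector inner_space \<Rightarrow> (nat \<Rightarrow> 'a \<Rightarrow> 'a) \<Rightarrow> bool"
  where "contractive_toeplitz E X \<longleftrightarrow> (\<forall>n. X n \<in> bounded_ops E E) \<and>
    (\<forall>g N. (\<forall>n. g n \<in> hcarrier E) \<longrightarrow>
      (\<Sum>n\<le>N. (hnorm E (conv X g n))\<^sup>2) \<le> (\<Sum>n\<le>N. (hnorm E (g n))\<^sup>2))"

lemma contractive_toeplitz_bounded: "contractive_toeplitz E X \<Longrightarrow> X n \<in> bounded_ops E E"
  by (simp add: contractive_toeplitz_def)

context prehilbert
begin

lemma conv_carrier:
  assumes "\<And>n. X n \<in> bounded_ops H H" "\<And>n. g n \<in> hcarrier H"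
  shows "conv X g n \<in> hcarrier H"
  unfolding conv_def using bounded_opsD(1)[OF assms(1)] assms(2) by auto

text \<open>
  This is the heart of the proof. Let \<open>P\<close> be the sum of \<open>e m\<close> over \<open>m < n\<close>, let \<open>a = X 0 (g n)\<close>, and
  let \<open>r\<close> be the part of \<open>conv X g n\<close> that comes from the earlier entries, so that
  \<open>(\<Sum>m\<le>n. e m) = P + \<parallel>g n\<parallel>\<^sup>2 - \<parallel>a + r\<parallel>\<^sup>2\<close>. Replacing \<open>g n\<close> by half of it changes neither \<open>P\<close> nor
  \<open>r\<close>, and contractivity still applies: \<open>0 \<le> P + \<parallel>g n\<parallel>\<^sup>2 / 4 - \<parallel>a / 2 + r\<parallel>\<^sup>2\<close>. The claim is four times
  this inequality with a term \<open>2 \<parallel>r\<parallel>\<^sup>2\<close> to spare.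
\<close>

lemma defect_le_partial_defects:
  assumes X: "contractive_toeplitz H X" and g: "\<And>n. g n \<in> hcarrier H"
  defines "e \<equiv> \<lambda>n. (hnorm H (g n))\<^sup>2 - (hnorm H (conv X g n))\<^sup>2"
  shows "(hnorm H (g n))\<^sup>2 - (hnorm H (X 0 (g n)))\<^sup>2 \<le> 2 * (\<Sum>m\<le>n. e m) + 2 * (\<Sum>m<n. e m)"
proof -
  note X_ops = bounded_opsD[OF contractive_toeplitz_bounded[OF X]]
  define r where "r = (\<Sum>k<n. X (n - k) (g k))"
  define a where "a = X 0 (g n)"
  define h where "h = g(n := (1/2) *\<^sub>C g n)"
  have r: "r \<in> hcarrier H" and a: "a \<in> hcarrier H" using X_ops(1) g by (auto simp: r_def a_def)
  have h: "h k \<in> hcarrier H" for k using g by (simp add: h_def)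
  have conv_g: "conv X g n = a + r"
    by (simp add: conv_def a_def r_def add.commute flip: lessThan_Suc_atMost)
  have conv_h: "conv X h n = (1/2) *\<^sub>C a + r"
    using X_ops(3)[OF g] by (simp add: conv_def h_def a_def r_def add.commute flip: lessThan_Suc_atMost)
  have conv_lt: "conv X h m = conv X g m" if "m < n" for m
    unfolding conv_def h_def using that by (intro sum.cong) auto
  have "0 \<le> (\<Sum>m\<le>n. (hnorm H (h m))\<^sup>2 - (hnorm H (conv X h m))\<^sup>2)"
    using X h by (simp add: contractive_toeplitz_def sum_subtractf)
  also have "\<dots> = (\<Sum>m<n. (hnorm H (h m))\<^sup>2 - (hnorm H (conv X h m))\<^sup>2)
      + ((hnorm H (h n))\<^sup>2 - (hnorm H (conv X h n))\<^sup>2)"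
    by (simp flip: lessThan_Suc_atMost)
  also have "(\<Sum>m<n. (hnorm H (h m))\<^sup>2 - (hnorm H (conv X h m))\<^sup>2) = (\<Sum>m<n. e m)"
    unfolding e_def by (intro sum.cong) (auto simp: conv_lt, auto simp: h_def)
  also have "(hnorm H (h n))\<^sup>2 = (hnorm H (g n))\<^sup>2 / 4"
    using g by (simp add: h_def hnorm_scaleC power_mult_distrib power2_eq_square)
  also have "(hnorm H (conv X h n))\<^sup>2 = (hnorm H a)\<^sup>2 / 4 + Re (hinner H a r) + (hnorm H r)\<^sup>2"
    unfolding conv_h using hnorm_add_sq[of "(1/2) *\<^sub>C a" r] a r
    by (simp add: hnorm_scaleC inner_scaleC power_mult_distrib power2_eq_square)
  finally have *: "0 \<le> (\<Sum>m<n. e m) + ((hnorm H (g n))\<^sup>2 / 4 - ((hnorm H a)\<^sup>2 / 4 + Re (hinner H a r) + (hnorm H r)\<^sup>2))" .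
  have "(\<Sum>m\<le>n. e m) = (\<Sum>m<n. e m) + e n" by (simp flip: lessThan_Suc_atMost)
  also have "e n = (hnorm H (g n))\<^sup>2 - ((hnorm H a)\<^sup>2 + 2 * Re (hinner H a r) + (hnorm H r)\<^sup>2)"
    unfolding e_def conv_g hnorm_add_sq[OF a r] ..
  finally have p: "(\<Sum>m\<le>n. e m) = (\<Sum>m<n. e m) +
      ((hnorm H (g n))\<^sup>2 - ((hnorm H a)\<^sup>2 + 2 * Re (hinner H a r) + (hnorm H r)\<^sup>2))" .
  have "0 \<le> (hnorm H r)\<^sup>2" by simp
  then show ?thesis using * p unfolding a_def[symmetric] by argo
qed

end

text \<open>
  Summation by parts: with \<open>u n = w n - w (n + 1)\<close> and the partial sums \<open>P n\<close> of \<open>e\<close>, the sum of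
  \<open>w n * e n\<close> is at least the sum of \<open>u n * P n\<close>. The contribution of \<open>P (n - 1)\<close> to the bound for
  \<open>\<delta> n\<close> is weighted by \<open>u n\<close>, and the growth condition moves it to \<open>u (n - 1)\<close>.
\<close>

lemma weighted_Abel:
  fixes w e \<delta> :: "nat \<Rightarrow> real"
  assumes w: "\<And>n. w n \<ge> 0" "\<And>n. w (Suc n) \<le> w n"
    and C: "C \<ge> 0" "\<And>n. w (Suc n) - w (Suc (Suc n)) \<le> C * (w n - w (Suc n))"
    and p: "\<And>n. 0 \<le> (\<Sum>m\<le>n. e m)"
    and \<delta>: "\<And>n. \<delta> n \<le> 2 * (\<Sum>m\<le>n. e m) + 2 * (\<Sum>m<n. e m)"
  shows "(\<Sum>n\<le>N. (w n - w (Suc n)) * \<delta> n) \<le> 2 * (1 + C) * (\<Sum>n\<le>N. w n * e n)"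
proof -
  define u where "u n = w n - w (Suc n)" for n
  define P where "P n = (\<Sum>m\<le>n. e m)" for n
  have u: "u n \<ge> 0" "u (Suc n) \<le> C * u n" for n using w(2)[of n] C(2)[of n] by (simp_all add: u_def)
  have P: "P n \<ge> 0" for n using p by (simp add: P_def)
  \<comment> \<open>The subtracted last term is the reserve from which the induction step pays for \<open>P N\<close>.\<close>
  have "(\<Sum>n\<le>N. u n * \<delta> n) \<le> 2 * (1 + C) * (\<Sum>n\<le>N. u n * P n) - 2 * C * (u N * P N)"
  proof (induction N)
    case 0
    have "\<delta> 0 \<le> 2 * P 0" using \<delta>[of 0] by (simp add: P_def)
    then have "u 0 * \<delta> 0 \<le> u 0 * (2 * P 0)" using u by (intro mult_left_mono) auto
    then show ?case by (simp add: algebra_simps)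
  next
    case (Suc N)
    have "\<delta> (Suc N) \<le> 2 * P (Suc N) + 2 * P N"
      using \<delta>[of "Suc N"] by (simp add: P_def lessThan_Suc_atMost)
    then have "u (Suc N) * \<delta> (Suc N) \<le> u (Suc N) * (2 * P (Suc N) + 2 * P N)" using u by (intro mult_left_mono) auto
    moreover have "u (Suc N) * P N \<le> C * u N * P N" using u P by (intro mult_right_mono) auto
    ultimately show ?case using Suc by (simp add: algebra_simps)
  qed
  also have "\<dots> \<le> 2 * (1 + C) * (\<Sum>n\<le>N. u n * P n)" using C u P by simp
  also have "(\<Sum>n\<le>N. u n * P n) = (\<Sum>n\<le>N. w n * e n) - w (Suc N) * P N"
    by (induction N) (simp_all add: u_def P_def algebra_simps)
  also have "2 * (1 + C) * \<dots> \<le> 2 * (1 + C) * (\<Sum>n\<le>N. w n * e n)"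
    using C P w by (intro mult_left_mono) auto
  finally show ?thesis by (simp add: u_def)
qed

lemma (in prehilbert) weighted_defect_bound:
  fixes w :: "nat \<Rightarrow> real"
  assumes X: "contractive_toeplitz H X" and g: "\<And>n. g n \<in> hcarrier H"
    and w: "\<And>n. w n \<ge> 0" "\<And>n. w (Suc n) \<le> w n"
    and C: "C \<ge> 0" "\<And>n. w (Suc n) - w (Suc (Suc n)) \<le> C * (w n - w (Suc n))"
  shows "(\<Sum>n\<le>N. (w n - w (Suc n)) * ((hnorm H (g n))\<^sup>2 - (hnorm H (X 0 (g n)))\<^sup>2))
    \<le> 2 * (1 + C) * (\<Sum>n\<le>N. w n * ((hnorm H (g n))\<^sup>2 - (hnorm H (conv X g n))\<^sup>2))"
proof (rule weighted_Abel[where w = w and C = C])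
  show "0 \<le> (\<Sum>m\<le>n. (hnorm H (g m))\<^sup>2 - (hnorm H (conv X g m))\<^sup>2)" for n
    using X g by (simp add: contractive_toeplitz_def sum_subtractf)
qed (fact w C defect_le_partial_defects[OF X g])+

lemma conv_reversed:
  assumes "k \<le> N"
  shows "conv X (\<lambda>j. y (N - j)) (N - k) = (\<Sum>n\<in>{k..N}. X (n - k) (y n))"
  unfolding conv_def
  by (rule sum.reindex_bij_witness[where i = "\<lambda>n. N - n" and j = "\<lambda>n. N - n"])
    (use assms in \<open>auto simp: add.commute\<close>)

lemma sum_triangle_swap:
  fixes f :: "nat \<Rightarrow> nat \<Rightarrow> 'a::comm_monoid_add"
  shows "(\<Sum>n\<le>N. \<Sum>k\<le>n. f n k) = (\<Sum>k\<le>N. \<Sum>n\<in>{k..N}. f n k)"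
proof -
  have "(\<Sum>n\<le>N. \<Sum>k\<le>n. f n k) = (\<Sum>(n, k)\<in>(SIGMA n:{..N}. {..n}). f n k)"
    by (rule sum.Sigma) auto
  also have "\<dots> = (\<Sum>(k, n)\<in>(SIGMA k:{..N}. {k..N}). f n k)"
    by (rule sum.reindex_bij_witness[where i = prod.swap and j = prod.swap]) auto
  also have "\<dots> = (\<Sum>k\<le>N. \<Sum>n\<in>{k..N}. f n k)"
    by (rule sum.Sigma[symmetric]) auto
  finally show ?thesis .
qed

text \<open>
  Reversing the order of the entries \<open>0, \<dots>, N\<close> turns the adjoint of a lower triangular Toeplitz
  matrix into the lower triangular Toeplitz matrix of the adjoint coefficients, and the adjoint of
  a contraction is a contraction.
\<close>

lemma contractive_toeplitz_adj:
  assumes E: "hilbert_space E" and X: "contractive_toeplitz E X"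
  shows "contractive_toeplitz E (\<lambda>n. adj E E (X n))"
proof -
  interpret hilbert_space E by fact
  note X_ops = contractive_toeplitz_bounded[OF X]
  note X'_ops = adj_bounded[OF E E X_ops]
  define X' where "X' = (\<lambda>n. adj E E (X n))"
  have "(\<Sum>n\<le>N. (hnorm E (conv X' x n))\<^sup>2) \<le> (\<Sum>n\<le>N. (hnorm E (x n))\<^sup>2)"
    if x: "\<And>n. x n \<in> hcarrier E" for x N
  proof -
    define y where "y = conv X' x"
    define z where "z k = conv X (\<lambda>j. y (N - j)) (N - k)" for k
    have y: "y n \<in> hcarrier E" for n unfolding y_def X'_def by (intro conv_carrier X'_ops x)
    have z: "z n \<in> hcarrier E" for n unfolding z_def by (intro conv_carrier X_ops y)
    have y_inner: "hinner E (y n) (y n) = (\<Sum>k\<le>n. hinner E (x k) (X (n - k) (y n)))" for n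
    proof -
      have "hinner E (y n) (y n) = (\<Sum>k\<le>n. hinner E (X' (n - k) (x k)) (y n))"
        unfolding y_def conv_def[of X'] using bounded_opsD(1)[OF X'_ops x] y
        by (intro inner_sum) (auto simp: X'_def y_def conv_def)
      also have "\<dots> = (\<Sum>k\<le>n. hinner E (x k) (X (n - k) (y n)))"
      proof (rule sum.cong[OF refl])
        fix k
        have "hinner E (X' (n - k) (x k)) (y n) = cnj (hinner E (y n) (X' (n - k) (x k)))"
          using x y bounded_opsD(1)[OF X'_ops x] unfolding X'_def by (intro inner_commute)
        also have "\<dots> = cnj (hinner E (X (n - k) (y n)) (x k))"
          unfolding X'_def using inner_adj[OF E E X_ops y x] by simp
        also have "\<dots> = hinner E (x k) (X (n - k) (y n))"
          using inner_commute[OF x bounded_opsD(1)[OF X_ops y]] by simp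
        finally show "hinner E (X' (n - k) (x k)) (y n) = hinner E (x k) (X (n - k) (y n))" .
      qed
      finally show ?thesis .
    qed
    have z_eq: "z k = (\<Sum>n\<in>{k..N}. X (n - k) (y n))" if "k \<le> N" for k
      unfolding z_def by (rule conv_reversed[OF that])
    have "of_real (\<Sum>n\<le>N. (hnorm E (y n))\<^sup>2) = (\<Sum>n\<le>N. hinner E (y n) (y n))"
      using y by (simp add: inner_self)
    also have "\<dots> = (\<Sum>n\<le>N. \<Sum>k\<le>n. hinner E (x k) (X (n - k) (y n)))" by (simp add: y_inner)
    also have "\<dots> = (\<Sum>k\<le>N. \<Sum>n\<in>{k..N}. hinner E (x k) (X (n - k) (y n)))"
      by (rule sum_triangle_swap)
    also have "\<dots> = (\<Sum>k\<le>N. hinner E (x k) (z k))"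
      using z_eq bounded_opsD(1)[OF X_ops y] x by (intro sum.cong refl) (simp add: inner_sum_right)
    finally have "Re (of_real (\<Sum>n\<le>N. (hnorm E (y n))\<^sup>2)) = Re (\<Sum>k\<le>N. hinner E (x k) (z k))"
      by (rule arg_cong)
    then have "(\<Sum>n\<le>N. (hnorm E (y n))\<^sup>2) = (\<Sum>k\<le>N. Re (hinner E (x k) (z k)))" by simp
    also have "\<dots> \<le> (\<Sum>k\<le>N. ((hnorm E (x k))\<^sup>2 + (hnorm E (z k))\<^sup>2) / 2)"
    proof (rule sum_mono)
      fix k
      have "0 \<le> (hnorm E (x k - z k))\<^sup>2" by simp
      then show "Re (hinner E (x k) (z k)) \<le> ((hnorm E (x k))\<^sup>2 + (hnorm E (z k))\<^sup>2) / 2"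
        using hnorm_diff_sq[OF x z, of k k] by simp
    qed
    also have "\<dots> = ((\<Sum>n\<le>N. (hnorm E (x n))\<^sup>2) + (\<Sum>n\<le>N. (hnorm E (z n))\<^sup>2)) / 2"
      by (simp add: sum.distrib flip: sum_divide_distrib)
    also have "(\<Sum>n\<le>N. (hnorm E (z n))\<^sup>2) = (\<Sum>n\<le>N. (hnorm E (conv X (\<lambda>j. y (N - j)) n))\<^sup>2)"
      unfolding z_def
      by (rule sum.reindex_bij_witness[where i = "\<lambda>n. N - n" and j = "\<lambda>n. N - n"]) auto
    also have "\<dots> \<le> (\<Sum>n\<le>N. (hnorm E (y (N - n)))\<^sup>2)"
      using X y by (simp add: contractive_toeplitz_def)
    also have "\<dots> = (\<Sum>n\<le>N. (hnorm E (y n))\<^sup>2)"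
      by (rule sum.reindex_bij_witness[where i = "\<lambda>n. N - n" and j = "\<lambda>n. N - n"]) auto
    finally show ?thesis by (simp add: y_def)
  qed
  then show ?thesis using X'_ops unfolding contractive_toeplitz_def X'_def by auto
qed


section \<open>Taylor coefficients form a contractive Toeplitz sequence\<close>

lemma sum_roots_of_unity:
  fixes r :: real and m n M :: nat
  assumes "m < M" "n < M"
  defines "z \<equiv> \<lambda>j. of_real r * cis (2 * pi * real j / real M)"
  shows "(\<Sum>j<M. z j ^ n * cnj (z j ^ m)) = (if m = n then of_nat M * of_real (r ^ (2 * n)) else 0)"
proof -
  define \<zeta> where "\<zeta> = cis (2 * pi * real n / real M) * cnj (cis (2 * pi * real m / real M))"
  have summand: "z j ^ n * cnj (z j ^ m) = of_real (r ^ (n + m)) * \<zeta> ^ j" for j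
    by (simp add: z_def \<zeta>_def power_mult_distrib Complex.DeMoivre cis_cnj cis_mult power_add algebra_simps)
  have M: "M > 0" using assms by simp
  have "\<zeta> ^ M = 1"
    using M by (simp add: \<zeta>_def power_mult_distrib Complex.DeMoivre cis_cnj)
      (simp add: complex_eq_iff cos_integer_2pi sin_integer_2pi)
  moreover have "\<zeta> = 1 \<longleftrightarrow> m = n"
  proof
    assume "\<zeta> = 1"
    then have "cis (2 * pi * real n / real M) = cis (2 * pi * real m / real M)"
      by (simp add: \<zeta>_def cis_cnj cis_inverse[symmetric] field_simps flip: divide_inverse)
    then show "m = n"
      using bij_betw_imp_inj_on[OF Complex.bij_betw_roots_unity[OF M]] assms(1,2) by (auto dest: inj_onD)
  qed (simp add: \<zeta>_def cis_cnj cis_mult)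
  ultimately show ?thesis
    unfolding summand sum_distrib_left[symmetric] sum_gp_strict by (auto simp: mult_2 mult_2_right mult.commute)
qed

text \<open>
  Parseval's identity for polynomials, with the integral over the circle of radius \<open>r\<close> replaced by
  a finite average. The average is exact as long as the degrees stay below the number \<open>M\<close> of
  nodes.
\<close>

lemma (in prehilbert) mean_inner_polynomials:
  fixes r :: real and M :: nat
  assumes p: "\<And>n. p n \<in> hcarrier H" and q: "\<And>n. q n \<in> hcarrier H"
  defines "z \<equiv> \<lambda>j. of_real r * cis (2 * pi * real j / real M)"
  shows "(\<Sum>j<M. hinner H (\<Sum>n<M. z j ^ n *\<^sub>C p n) (\<Sum>n<M. z j ^ n *\<^sub>C q n))
    = of_nat M * (\<Sum>n<M. of_real (r ^ (2 * n)) * hinner H (p n) (q n))"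
proof -
  have "hinner H (\<Sum>n<M. z j ^ n *\<^sub>C p n) (\<Sum>n<M. z j ^ n *\<^sub>C q n) =
      (\<Sum>n<M. \<Sum>m<M. z j ^ n * cnj (z j ^ m) * hinner H (p n) (q m))" for j
  proof -
    have s: "(\<Sum>n<M. z j ^ n *\<^sub>C q n) \<in> hcarrier H" using q by auto
    have "hinner H (\<Sum>n<M. z j ^ n *\<^sub>C p n) (\<Sum>n<M. z j ^ n *\<^sub>C q n) =
        (\<Sum>n<M. hinner H (z j ^ n *\<^sub>C p n) (\<Sum>n<M. z j ^ n *\<^sub>C q n))"
      using p s by (intro inner_sum) auto
    also have "\<dots> = (\<Sum>n<M. \<Sum>m<M. hinner H (z j ^ n *\<^sub>C p n) (z j ^ m *\<^sub>C q m))"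
      using p q by (intro sum.cong refl inner_sum_right) auto
    also have "\<dots> = (\<Sum>n<M. \<Sum>m<M. z j ^ n * cnj (z j ^ m) * hinner H (p n) (q m))"
      using p q by (simp add: inner_scaleC inner_scaleC_right mult_ac)
    finally show ?thesis .
  qed
  then have "(\<Sum>j<M. hinner H (\<Sum>n<M. z j ^ n *\<^sub>C p n) (\<Sum>n<M. z j ^ n *\<^sub>C q n)) =
      (\<Sum>j<M. \<Sum>n<M. \<Sum>m<M. z j ^ n * cnj (z j ^ m) * hinner H (p n) (q m))" by simp
  also have "\<dots> = (\<Sum>n<M. \<Sum>j<M. \<Sum>m<M. z j ^ n * cnj (z j ^ m) * hinner H (p n) (q m))"
    by (rule sum.swap)
  also have "\<dots> = (\<Sum>n<M. \<Sum>m<M. \<Sum>j<M. z j ^ n * cnj (z j ^ m) * hinner H (p n) (q m))"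
    by (intro sum.cong refl sum.swap)
  also have "\<dots> = (\<Sum>n<M. \<Sum>m<M. (\<Sum>j<M. z j ^ n * cnj (z j ^ m)) * hinner H (p n) (q m))"
    by (simp only: sum_distrib_right)
  also have "\<dots> = (\<Sum>n<M. \<Sum>m<M. (if m = n then of_nat M * of_real (r ^ (2 * n)) else 0) * hinner H (p n) (q m))"
    unfolding z_def by (intro sum.cong refl arg_cong2[where f = "(*)"] sum_roots_of_unity) auto
  also have "\<dots> = (\<Sum>n<M. of_nat M * of_real (r ^ (2 * n)) * hinner H (p n) (q n))"
    by (intro sum.cong refl) (simp add: if_distrib[where f = "\<lambda>x. x * _"] sum.delta' cong: if_cong)
  finally show ?thesis by (simp add: sum_distrib_left mult.assoc)
qed

lemma conv_polynomial:
  fixes g :: "nat \<Rightarrow> 'a::complex_vector"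
  shows "(\<Sum>n<M. z ^ n *\<^sub>C conv X g n) = (\<Sum>k<M. z ^ k *\<^sub>C (\<Sum>m<M - k. z ^ m *\<^sub>C X m (g k)))"
proof (induction M)
  case (Suc M)
  have "(\<Sum>k<Suc M. z ^ k *\<^sub>C (\<Sum>m<Suc M - k. z ^ m *\<^sub>C X m (g k))) =
      (\<Sum>k<Suc M. z ^ k *\<^sub>C (\<Sum>m<M - k. z ^ m *\<^sub>C X m (g k)) + z ^ M *\<^sub>C X (M - k) (g k))"
    by (intro sum.cong refl)
      (simp add: Suc_diff_le scaleC_add_right scaleC_scaleC flip: power_add)
  also have "\<dots> = (\<Sum>k<M. z ^ k *\<^sub>C (\<Sum>m<M - k. z ^ m *\<^sub>C X m (g k))) + z ^ M *\<^sub>C conv X g M"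
    by (simp add: sum.distrib conv_def complex_vector.scale_sum_right scaleC_add_right
        add.assoc flip: lessThan_Suc_atMost)
  finally show ?case using Suc by simp
qed simp

locale schur_expansion = schur_function E B for E :: "'e::complex_vector inner_space" and B +
  fixes X :: "nat \<Rightarrow> 'e \<Rightarrow> 'e"
  assumes X_ops: "X n \<in> bounded_ops E E"
    and X_0: "X 0 = B 0"
    and X_remainder: "z \<in> ball 0 1 \<Longrightarrow> x \<in> hcarrier E \<Longrightarrow>
      hnorm E (B z x - (\<Sum>m<L. z ^ m *\<^sub>C X m x)) \<le> cmod z ^ L / (1 - cmod z) * hnorm E x"
begin

text \<open>
  Cutting the series of \<open>B z (g k)\<close> off at length \<open>M - k\<close> makes the remaining polynomial exactly
  the truncation of the product series at length \<open>M\<close>.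
\<close>

lemma polynomial_remainder:
  assumes z: "z \<in> ball 0 1" and g: "\<And>n. g n \<in> hcarrier E"
  shows "hnorm E (B z (\<Sum>k<M. z ^ k *\<^sub>C g k) - (\<Sum>n<M. z ^ n *\<^sub>C conv X g n)) \<le>
    (\<Sum>k<M. (cmod z ^ k * hnorm E (g k)) * cmod z ^ (M - k)) / (1 - cmod z)"
proof -
  note Xc = bounded_opsD(1)[OF X_ops g]
  note Bz = B_op[OF z]
  have c: "(\<Sum>m<L. z ^ m *\<^sub>C X m (g k)) \<in> hcarrier E" "B z (g k) \<in> hcarrier E" for L k
    using Xc bounded_opsD(1)[OF Bz g] by auto
  have "B z (\<Sum>k<M. z ^ k *\<^sub>C g k) = (\<Sum>k<M. B z (z ^ k *\<^sub>C g k))"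
    by (rule bounded_ops_sum[OF prehilbert_axioms Bz]) (use g in auto)
  also have "\<dots> = (\<Sum>k<M. z ^ k *\<^sub>C B z (g k))" using bounded_opsD(3)[OF Bz g] by simp
  finally have "B z (\<Sum>k<M. z ^ k *\<^sub>C g k) - (\<Sum>n<M. z ^ n *\<^sub>C conv X g n) =
      (\<Sum>k<M. z ^ k *\<^sub>C (B z (g k) - (\<Sum>m<M - k. z ^ m *\<^sub>C X m (g k))))"
    by (simp add: conv_polynomial complex_vector.scale_right_diff_distrib sum_subtractf)
  also have "hnorm E \<dots> \<le> (\<Sum>k<M. hnorm E (z ^ k *\<^sub>C (B z (g k) - (\<Sum>m<M - k. z ^ m *\<^sub>C X m (g k)))))"
    using c by (intro hnorm_sum) auto
  also have "\<dots> \<le> (\<Sum>k<M. (cmod z ^ k * hnorm E (g k)) * cmod z ^ (M - k) / (1 - cmod z))"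
  proof (rule sum_mono)
    fix k
    have "hnorm E (z ^ k *\<^sub>C (B z (g k) - (\<Sum>m<M - k. z ^ m *\<^sub>C X m (g k)))) =
        cmod z ^ k * hnorm E (B z (g k) - (\<Sum>m<M - k. z ^ m *\<^sub>C X m (g k)))"
      using c by (simp add: hnorm_scaleC norm_power)
    also have "\<dots> \<le> cmod z ^ k * (cmod z ^ (M - k) / (1 - cmod z) * hnorm E (g k))"
      by (intro mult_left_mono X_remainder z g) auto
    finally show "hnorm E (z ^ k *\<^sub>C (B z (g k) - (\<Sum>m<M - k. z ^ m *\<^sub>C X m (g k)))) \<le>
        (cmod z ^ k * hnorm E (g k)) * cmod z ^ (M - k) / (1 - cmod z)" by (simp add: mult_ac)
  qed
  finally show ?thesis by (simp add: sum_divide_distrib)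
qed

text \<open>
  Let \<open>G\<close> be the polynomial with coefficients \<open>g\<close>, and let \<open>Q\<close> be the truncation of \<open>B G\<close> to degree
  \<open>N\<close>. At every node \<open>2 Re \<langle>B G, Q\<rangle> \<le> \<parallel>G\<parallel>\<^sup>2 + \<parallel>Q\<parallel>\<^sup>2\<close> by contractivity of \<open>B\<close>, while the average of
  \<open>Re \<langle>B G, Q\<rangle>\<close> is that of \<open>\<parallel>Q\<parallel>\<^sup>2\<close> up to an error of order \<open>r^M\<close>. Letting first the number of nodes
  tend to infinity and then \<open>r\<close> to \<open>1\<close> gives the claim.
\<close>

lemma toeplitz_contraction:
  shows "contractive_toeplitz E X"
  unfolding contractive_toeplitz_def
proof (intro conjI allI impI X_ops)
  fix g0 :: "nat \<Rightarrow> 'e" and N assume "\<forall>n. g0 n \<in> hcarrier E"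
  then have g0: "g0 n \<in> hcarrier E" for n by blast
  define g where "g n = (if n \<le> N then g0 n else 0)" for n
  define p where "p = conv X g"
  define q where "q n = (if n \<le> N then p n else 0)" for n
  have g: "g n \<in> hcarrier E" for n using g0 by (simp add: g_def)
  have p: "p n \<in> hcarrier E" for n unfolding p_def by (intro conv_carrier X_ops g)
  have q: "q n \<in> hcarrier E" for n using p by (simp add: q_def)
  have g_zero: "g n = 0" and q_zero: "q n = 0" if "n > N" for n using that by (simp_all add: g_def q_def)
  define K where "K = (\<Sum>n\<le>N. hnorm E (g n)) * (\<Sum>n\<le>N. hnorm E (q n))"
  have at_r: "(\<Sum>n\<le>N. r ^ (2 * n) * (hnorm E (p n))\<^sup>2) \<le> (\<Sum>n\<le>N. r ^ (2 * n) * (hnorm E (g n))\<^sup>2)"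
    if r: "0 < r" "r < 1" for r :: real
  proof -
    have step: "2 * (\<Sum>n\<le>N. r ^ (2 * n) * (hnorm E (p n))\<^sup>2) \<le> (\<Sum>n\<le>N. r ^ (2 * n) * (hnorm E (g n))\<^sup>2)
       + (\<Sum>n\<le>N. r ^ (2 * n) * (hnorm E (p n))\<^sup>2) + 2 * (r ^ M * (K / (1 - r)))" if M: "M > N" for M
    proof -
      define z where "z j = of_real r * cis (2 * pi * real j / real M)" for j
      have z: "cmod (z j) = r" "z j \<in> ball 0 1" for j using r by (auto simp: z_def norm_mult)
      define G where "G j = (\<Sum>n<M. z j ^ n *\<^sub>C g n)" for j
      define P where "P j = (\<Sum>n<M. z j ^ n *\<^sub>C p n)" for j
      define Q where "Q j = (\<Sum>n<M. z j ^ n *\<^sub>C q n)" for j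
      have carr: "G j \<in> hcarrier E" "P j \<in> hcarrier E" "Q j \<in> hcarrier E" "B (z j) (G j) \<in> hcarrier E" for j
        using g p q bounded_opsD(1)[OF B_op[OF z(2)]] by (auto simp: G_def P_def Q_def)
      have supp: "(\<Sum>n<M. r ^ (2 * n) * f n) = (\<Sum>n\<le>N. r ^ (2 * n) * f n)" if "\<And>n. n > N \<Longrightarrow> f n = 0"
        for f :: "nat \<Rightarrow> real"
        using M that by (intro sum.mono_neutral_right) auto
      have mean: "(\<Sum>j<M. Re (hinner E (\<Sum>n<M. z j ^ n *\<^sub>C a n) (\<Sum>n<M. z j ^ n *\<^sub>C b n))) =
          real M * (\<Sum>n<M. r ^ (2 * n) * Re (hinner E (a n) (b n)))"
        if "\<And>n. a n \<in> hcarrier E" "\<And>n. b n \<in> hcarrier E" for a b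
        using arg_cong[OF mean_inner_polynomials[OF that, where r = r and M = M], of Re] by (simp add: z_def)
      have mean_g: "(\<Sum>j<M. (hnorm E (G j))\<^sup>2) = real M * (\<Sum>n\<le>N. r ^ (2 * n) * (hnorm E (g n))\<^sup>2)"
        using mean[of g g] supp[of "\<lambda>n. (hnorm E (g n))\<^sup>2"] g carr g_zero
        by (simp add: inner_self flip: G_def)
      have mean_q: "(\<Sum>j<M. (hnorm E (Q j))\<^sup>2) = real M * (\<Sum>n\<le>N. r ^ (2 * n) * (hnorm E (p n))\<^sup>2)"
      proof -
        have "(\<Sum>n\<le>N. r ^ (2 * n) * (hnorm E (q n))\<^sup>2) = (\<Sum>n\<le>N. r ^ (2 * n) * (hnorm E (p n))\<^sup>2)"
          by (intro sum.cong) (auto simp: q_def)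
        then show ?thesis
          using mean[of q q] supp[of "\<lambda>n. (hnorm E (q n))\<^sup>2"] q carr q_zero
          by (simp add: inner_self flip: Q_def)
      qed
      have mean_pq: "(\<Sum>j<M. Re (hinner E (P j) (Q j))) = real M * (\<Sum>n\<le>N. r ^ (2 * n) * (hnorm E (p n))\<^sup>2)"
      proof -
        have "(\<Sum>n\<le>N. r ^ (2 * n) * Re (hinner E (p n) (q n))) = (\<Sum>n\<le>N. r ^ (2 * n) * (hnorm E (p n))\<^sup>2)"
          using p by (intro sum.cong) (auto simp: q_def inner_self)
        then show ?thesis
          using mean[of p q] supp[of "\<lambda>n. Re (hinner E (p n) (q n))"] p q q_zero
          by (simp flip: P_def Q_def)
      qed
      have pointwise: "2 * Re (hinner E (P j) (Q j)) \<le> (hnorm E (G j))\<^sup>2 + (hnorm E (Q j))\<^sup>2 + 2 * (r ^ M * (K / (1 - r)))"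
        for j
      proof -
        define R where "R = B (z j) (G j) - P j"
        have R: "R \<in> hcarrier E" using carr by (auto simp: R_def)
        have "hnorm E R \<le> (\<Sum>k<M. (cmod (z j) ^ k * hnorm E (g k)) * cmod (z j) ^ (M - k)) / (1 - cmod (z j))"
          unfolding R_def G_def P_def p_def by (intro polynomial_remainder z g)
        also have "\<dots> = (\<Sum>k<M. (r ^ k * hnorm E (g k)) * r ^ (M - k)) / (1 - r)" unfolding z ..
        also have "(\<Sum>k<M. (r ^ k * hnorm E (g k)) * r ^ (M - k)) = r ^ M * (\<Sum>k<M. hnorm E (g k))"
          unfolding sum_distrib_left by (intro sum.cong refl) (simp add: mult_ac flip: power_add)
        also have "(\<Sum>k<M. hnorm E (g k)) = (\<Sum>k\<le>N. hnorm E (g k))"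
          using M by (intro sum.mono_neutral_right) (auto simp: g_def)
        finally have R_le: "hnorm E R \<le> r ^ M * (\<Sum>k\<le>N. hnorm E (g k)) / (1 - r)" .
        have "hnorm E (Q j) \<le> (\<Sum>n<M. hnorm E (z j ^ n *\<^sub>C q n))" unfolding Q_def using q by (intro hnorm_sum) auto
        also have "\<dots> \<le> (\<Sum>n<M. hnorm E (q n))"
          using q z r by (intro sum_mono) (auto simp: hnorm_scaleC norm_power intro!: mult_left_le_one_le power_le_one)
        also have "\<dots> = (\<Sum>n\<le>N. hnorm E (q n))"
          using M by (intro sum.mono_neutral_right) (auto simp: q_def)
        finally have Q_le: "hnorm E (Q j) \<le> (\<Sum>n\<le>N. hnorm E (q n))" .
        have "- Re (hinner E R (Q j)) \<le> cmod (hinner E R (Q j))"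
          using complex_Re_le_cmod[of "- hinner E R (Q j)"] by simp
        also have "\<dots> \<le> hnorm E R * hnorm E (Q j)" using R carr by (intro Cauchy_Schwarz)
        also have "\<dots> \<le> (r ^ M * (\<Sum>k\<le>N. hnorm E (g k)) / (1 - r)) * (\<Sum>n\<le>N. hnorm E (q n))"
          using R_le Q_le R carr g r by (intro mult_mono) (auto intro!: sum_nonneg divide_nonneg_nonneg mult_nonneg_nonneg)
        also have "\<dots> = r ^ M * (K / (1 - r))" by (simp add: K_def)
        finally have e: "- Re (hinner E R (Q j)) \<le> r ^ M * (K / (1 - r))" .
        have "0 \<le> (hnorm E (B (z j) (G j) - Q j))\<^sup>2" by simp
        also have "\<dots> = (hnorm E (B (z j) (G j)))\<^sup>2 - 2 * Re (hinner E (B (z j) (G j)) (Q j)) + (hnorm E (Q j))\<^sup>2"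
          using carr by (intro hnorm_diff_sq)
        also have "(hnorm E (B (z j) (G j)))\<^sup>2 \<le> (hnorm E (G j))\<^sup>2"
          using B_contr[OF z(2) carr(1)] carr by (intro power_mono) auto
        finally have "2 * Re (hinner E (B (z j) (G j)) (Q j)) \<le> (hnorm E (G j))\<^sup>2 + (hnorm E (Q j))\<^sup>2" by simp
        moreover have "hinner E (P j) (Q j) = hinner E (B (z j) (G j)) (Q j) - hinner E R (Q j)"
          unfolding R_def using carr by (simp add: inner_diff)
        ultimately show ?thesis using e by simp
      qed
      have "(\<Sum>j<M. 2 * Re (hinner E (P j) (Q j))) \<le>
          (\<Sum>j<M. (hnorm E (G j))\<^sup>2 + (hnorm E (Q j))\<^sup>2 + 2 * (r ^ M * (K / (1 - r))))"
        by (intro sum_mono pointwise)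
      then have "real M * (2 * (\<Sum>n\<le>N. r ^ (2 * n) * (hnorm E (p n))\<^sup>2)) \<le> real M * ((\<Sum>n\<le>N. r ^ (2 * n) * (hnorm E (g n))\<^sup>2)
        + (\<Sum>n\<le>N. r ^ (2 * n) * (hnorm E (p n))\<^sup>2) + 2 * (r ^ M * (K / (1 - r))))"
        by (simp add: sum.distrib mean_g mean_q mean_pq algebra_simps flip: sum_distrib_left)
      then show ?thesis using M by (simp only: mult_le_cancel_left_pos of_nat_0_less_iff gr_implies_not0 gr0I)
    qed
    have "(\<lambda>M. (\<Sum>n\<le>N. r ^ (2 * n) * (hnorm E (g n))\<^sup>2)
       + (\<Sum>n\<le>N. r ^ (2 * n) * (hnorm E (p n))\<^sup>2) + 2 * (r ^ M * (K / (1 - r)))) \<longlonglongrightarrow>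
       (\<Sum>n\<le>N. r ^ (2 * n) * (hnorm E (g n))\<^sup>2)
       + (\<Sum>n\<le>N. r ^ (2 * n) * (hnorm E (p n))\<^sup>2) + 2 * (0 * (K / (1 - r)))"
      using r by (intro tendsto_intros LIMSEQ_power_zero) auto
    then have "2 * (\<Sum>n\<le>N. r ^ (2 * n) * (hnorm E (p n))\<^sup>2) \<le> (\<Sum>n\<le>N. r ^ (2 * n) * (hnorm E (g n))\<^sup>2)
       + (\<Sum>n\<le>N. r ^ (2 * n) * (hnorm E (p n))\<^sup>2) + 2 * (0 * (K / (1 - r)))"
      by (rule LIMSEQ_le_const) (use step in \<open>auto intro!: exI[of _ "Suc N"]\<close>)
    then show ?thesis by simp
  qed
  have "(\<Sum>n\<le>N. 1 ^ (2 * n) * (hnorm E (p n))\<^sup>2) \<le> (\<Sum>n\<le>N. 1 ^ (2 * n) * (hnorm E (g n))\<^sup>2)"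
  proof (rule tendsto_le[where F = "at_left (1::real)"])
    show "((\<lambda>r. \<Sum>n\<le>N. r ^ (2 * n) * (hnorm E (p n))\<^sup>2) \<longlongrightarrow> (\<Sum>n\<le>N. 1 ^ (2 * n) * (hnorm E (p n))\<^sup>2)) (at_left 1)"
      "((\<lambda>r. \<Sum>n\<le>N. r ^ (2 * n) * (hnorm E (g n))\<^sup>2) \<longlongrightarrow> (\<Sum>n\<le>N. 1 ^ (2 * n) * (hnorm E (g n))\<^sup>2)) (at_left 1)"
      by (intro tendsto_intros)+
    show "\<forall>\<^sub>F r in at_left 1. (\<Sum>n\<le>N. r ^ (2 * n) * (hnorm E (p n))\<^sup>2) \<le> (\<Sum>n\<le>N. r ^ (2 * n) * (hnorm E (g n))\<^sup>2)"
      using eventually_at_left_real[of 0 1] at_r by (auto elim!: eventually_mono)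
  qed simp
  moreover have "p n = conv X g0 n" if "n \<le> N" for n
    unfolding p_def conv_def g_def using that by (intro sum.cong) auto
  ultimately show "(\<Sum>n\<le>N. (hnorm E (conv X g0 n))\<^sup>2) \<le> (\<Sum>n\<le>N. (hnorm E (g0 n))\<^sup>2)"
    by (simp add: g_def)
qed
end


section \<open>Defect ranges and de Branges--Rovnyak spaces\<close>

lemma bounded_ops_comp:
  assumes H: "prehilbert H" and K: "prehilbert K" and A: "A \<in> bounded_ops H K" and A': "A' \<in> bounded_ops K L"
  shows "A' \<circ> A \<in> bounded_ops H L"
proof -
  obtain M where M: "M \<ge> 0" "\<And>x. x \<in> hcarrier H \<Longrightarrow> hnorm K (A x) \<le> M * hnorm H x"
    using bounded_ops_bound[OF H A] by blast
  obtain M' where M': "M' \<ge> 0" "\<And>x. x \<in> hcarrier K \<Longrightarrow> hnorm L (A' x) \<le> M' * hnorm K x"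
    using bounded_ops_bound[OF K A'] by blast
  have "hnorm L (A' (A x)) \<le> M' * M * hnorm H x" if "x \<in> hcarrier H" for x
    using M'(2)[OF bounded_opsD(1)[OF A that]] mult_left_mono[OF M(2)[OF that] M'(1)] by (simp add: mult.assoc)
  then show ?thesis
    using bounded_opsD[OF A] bounded_opsD[OF A'] unfolding bounded_ops_def by auto
qed


text \<open>
  Pairing a contraction with an adjoint makes the notion symmetric, so that the two defect
  operators \<open>I - A A\<^sup>*\<close> and \<open>I - A\<^sup>* A\<close> are instances of the same statements.
\<close>

definition adjoint_contractions ::
    "'a::complex_vector inner_space \<Rightarrow> 'b::complex_vector inner_space \<Rightarrow> ('a \<Rightarrow> 'b) \<Rightarrow> ('b \<Rightarrow> 'a) \<Rightarrow> bool"
  where "adjoint_contractions H K A A' \<longleftrightarrow> A \<in> bounded_ops H K \<and> A' \<in> bounded_ops K H \<and>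
    (\<forall>x\<in>hcarrier H. hnorm K (A x) \<le> hnorm H x) \<and> (\<forall>y\<in>hcarrier K. hnorm H (A' y) \<le> hnorm K y) \<and>
    (\<forall>x\<in>hcarrier H. \<forall>y\<in>hcarrier K. hinner K (A x) y = hinner H x (A' y))"

lemma adjoint_contractions_adj:
  assumes "hilbert_space H" "hilbert_space K" "A \<in> bounded_ops H K"
    and "\<And>x. x \<in> hcarrier H \<Longrightarrow> hnorm K (A x) \<le> hnorm H x"
  shows "adjoint_contractions H K A (adj H K A)"
  unfolding adjoint_contractions_def
  using assms adj_bounded[OF assms(1-3)] inner_adj[OF assms(1-3)] adj_contraction[OF assms] by blast

lemma adjoint_contractions_sym:
  assumes H: "prehilbert H" and K: "prehilbert K" and A: "adjoint_contractions H K A A'"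
  shows "adjoint_contractions K H A' A"
proof -
  have ops: "A \<in> bounded_ops H K" "A' \<in> bounded_ops K H" using A by (auto simp: adjoint_contractions_def)
  have "hinner H (A' y) x = hinner K y (A x)" if "x \<in> hcarrier H" "y \<in> hcarrier K" for x y
    using A that prehilbert.inner_commute[OF H bounded_opsD(1)[OF ops(2) that(2)] that(1)]
      prehilbert.inner_commute[OF K that(2) bounded_opsD(1)[OF ops(1) that(1)]]
    by (simp add: adjoint_contractions_def)
  then show ?thesis using A by (auto simp: adjoint_contractions_def)
qed

lemma
  assumes H: "hilbert_space H" and K: "hilbert_space K" and A: "adjoint_contractions H K A A'"
  shows self_adjoint_contraction_comp: "self_adjoint_contraction K (A \<circ> A')"
    and inner_comp: "y \<in> hcarrier K \<Longrightarrow> hinner K ((A \<circ> A') y) y = of_real ((hnorm H (A' y))\<^sup>2)"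
proof -
  interpret H: hilbert_space H by fact
  interpret K: hilbert_space K by fact
  have ops: "A \<in> bounded_ops H K" "A' \<in> bounded_ops K H" using A by (auto simp: adjoint_contractions_def)
  note ops_D = bounded_opsD(1)[OF ops(1)] bounded_opsD(1)[OF ops(2)]
  have eq: "hinner K (A x) y = hinner H x (A' y)" if "x \<in> hcarrier H" "y \<in> hcarrier K" for x y
    using A that by (simp add: adjoint_contractions_def)
  have eq': "hinner H (A' y) x = hinner K y (A x)" if "x \<in> hcarrier H" "y \<in> hcarrier K" for x y
    using adjoint_contractions_sym[OF H.prehilbert_axioms K.prehilbert_axioms A] that
    by (simp add: adjoint_contractions_def)
  show "self_adjoint_contraction K (A \<circ> A')"
  proof
    show "A \<circ> A' \<in> bounded_ops K K"
      by (rule bounded_ops_comp[OF K.prehilbert_axioms H.prehilbert_axioms ops(2,1)])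
    show "self_adjoint K (A \<circ> A')"
      using ops_D by (simp add: self_adjoint_def eq eq')
    fix y assume y: "y \<in> hcarrier K"
    have "hnorm K (A (A' y)) \<le> hnorm H (A' y)" "hnorm H (A' y) \<le> hnorm K y"
      using A y ops_D by (auto simp: adjoint_contractions_def)
    then show "hnorm K ((A \<circ> A') y) \<le> hnorm K y" by simp
  qed
  show "y \<in> hcarrier K \<Longrightarrow> hinner K ((A \<circ> A') y) y = of_real ((hnorm H (A' y))\<^sup>2)"
    using ops_D by (simp add: eq H.inner_self)
qed

lemma
  assumes H: "hilbert_space H" and K: "hilbert_space K" and A: "adjoint_contractions H K A A'"
  defines "S \<equiv> sqrt_op K (id - (A \<circ> A'))"
  shows defect_root_bounded: "S \<in> bounded_ops K K"
    and defect_root_self_adjoint: "self_adjoint K S"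
    and defect_root_norm: "y \<in> hcarrier K \<Longrightarrow> (hnorm K (S y))\<^sup>2 = (hnorm K y)\<^sup>2 - (hnorm H (A' y))\<^sup>2"
proof -
  interpret self_adjoint_contraction K "A \<circ> A'" by (rule self_adjoint_contraction_comp[OF H K A])
  show "S \<in> bounded_ops K K" "self_adjoint K S"
    unfolding S_def by (fact root_bounded root_self_adjoint)+
  show "y \<in> hcarrier K \<Longrightarrow> (hnorm K (S y))\<^sup>2 = (hnorm K y)\<^sup>2 - (hnorm H (A' y))\<^sup>2"
    unfolding S_def by (simp only: root_norm inner_comp[OF H K A] Re_complex_of_real)
qed

text \<open>
  The square root \<open>S\<close> of \<open>I - A A\<^sup>*\<close> satisfies \<open>\<parallel>S g\<parallel>\<^sup>2 = \<parallel>g\<parallel>\<^sup>2 - \<parallel>A\<^sup>* g\<parallel>\<^sup>2\<close>, so the hypothesis is the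
  range criterion for \<open>S\<close>.
\<close>

lemma in_defect_range:
  assumes H: "hilbert_space H" and K: "hilbert_space K" and A: "adjoint_contractions H K A A'"
    and f: "f \<in> hcarrier K"
    and bound: "\<And>g. g \<in> hcarrier K \<Longrightarrow> (cmod (hinner K g f))\<^sup>2 \<le> C * ((hnorm K g)\<^sup>2 - (hnorm H (A' g))\<^sup>2)"
  shows "f \<in> hcarrier (range_space K (sqrt_op K (id - (A \<circ> A'))))"
proof -
  interpret K: hilbert_space K by fact
  define S where "S = sqrt_op K (id - (A \<circ> A'))"
  have S: "S \<in> bounded_ops K K" "self_adjoint K S"
    and norm: "\<And>y. y \<in> hcarrier K \<Longrightarrow> (hnorm K (S y))\<^sup>2 = (hnorm K y)\<^sup>2 - (hnorm H (A' y))\<^sup>2"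
    unfolding S_def using defect_root_bounded[OF H K A] defect_root_self_adjoint[OF H K A]
      defect_root_norm[OF H K A] by blast+
  have "\<exists>h\<in>ker_perp K S. f = S h"
  proof (rule K.range_self_adjoint[OF S f])
    fix g assume g: "g \<in> hcarrier K"
    note Sg = bounded_opsD(1)[OF S(1) g]
    have "(cmod (hinner K g f))\<^sup>2 \<le> C * (hnorm K (S g))\<^sup>2" using bound[OF g] norm[OF g] by simp
    also have "\<dots> \<le> \<bar>C\<bar> * (hnorm K (S g))\<^sup>2" by (intro mult_right_mono) auto
    also have "\<dots> = (sqrt \<bar>C\<bar> * hnorm K (S g))\<^sup>2" by (simp add: power_mult_distrib)
    finally show "cmod (hinner K g f) \<le> sqrt \<bar>C\<bar> * hnorm K (S g)"
      by (rule power2_le_imp_le) (use Sg in simp)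
  qed
  then show ?thesis by (auto simp: range_space_def ker_perp_def S_def)
qed

lemma dBR_space_bounds:
  assumes E: "hilbert_space E" and A: "adjoint_contractions E E A (adj E E A)"
  defines "F \<equiv> dBR_space E E A"
  shows "complex_vector.subspace (hcarrier F)" "hcarrier F \<subseteq> hcarrier E"
    and "x \<in> hcarrier F \<Longrightarrow> 0 \<le> hnorm F x" "x \<in> hcarrier F \<Longrightarrow> hnorm E x \<le> hnorm F x"
    and "x \<in> hcarrier F \<Longrightarrow> y \<in> hcarrier E \<Longrightarrow>
      cmod (hinner E x y) \<le> hnorm F x * sqrt ((hnorm E y)\<^sup>2 - (hnorm E (adj E E A y))\<^sup>2)"
proof -
  interpret hilbert_space E by fact
  define S where "S = sqrt_op E (id - (A \<circ> adj E E A))"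
  have S: "S \<in> bounded_ops E E" "self_adjoint E S"
    and norm: "\<And>y. y \<in> hcarrier E \<Longrightarrow> (hnorm E (S y))\<^sup>2 = (hnorm E y)\<^sup>2 - (hnorm E (adj E E A y))\<^sup>2"
    unfolding S_def using defect_root_bounded[OF E E A] defect_root_self_adjoint[OF E E A]
      defect_root_norm[OF E E A] by blast+
  note SD = bounded_opsD[OF S(1)]
  have F: "F = range_space E S" by (simp add: F_def dBR_space_def S_def)
  have carrier: "hcarrier F = S ` hcarrier E" by (simp add: F range_space_def)
  show "hcarrier F \<subseteq> hcarrier E" using SD by (auto simp: carrier)
  show "complex_vector.subspace (hcarrier F)"
  proof (rule complex_vector.subspaceI)
    show "0 \<in> hcarrier F" unfolding carrier using bounded_ops_zero[OF prehilbert_axioms S(1)] by force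
  next
    fix x y assume "x \<in> hcarrier F" "y \<in> hcarrier F"
    then obtain u v where "u \<in> hcarrier E" "v \<in> hcarrier E" "x = S u" "y = S v" by (auto simp: carrier)
    then show "x + y \<in> hcarrier F" unfolding carrier using SD(2)[of u v] by (intro image_eqI[of _ _ "u + v"]) auto
  next
    fix c x assume "x \<in> hcarrier F"
    then obtain u where "u \<in> hcarrier E" "x = S u" by (auto simp: carrier)
    then show "c *\<^sub>C x \<in> hcarrier F" unfolding carrier using SD(3)[of u c] by (intro image_eqI[of _ _ "c *\<^sub>C u"]) auto
  qed
  show nonneg: "0 \<le> hnorm F x" if x: "x \<in> hcarrier F" for x
    using range_space_norm[OF S, of x] x carrier F hnorm_nonneg by metis
  show bound: "cmod (hinner E x y) \<le> hnorm F x * sqrt ((hnorm E y)\<^sup>2 - (hnorm E (adj E E A y))\<^sup>2)"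
    if x: "x \<in> hcarrier F" and y: "y \<in> hcarrier E" for x y
  proof -
    have "hnorm E (S y) = sqrt ((hnorm E y)\<^sup>2 - (hnorm E (adj E E A y))\<^sup>2)"
      using norm[OF y] SD(1)[OF y] by (metis real_sqrt_unique hnorm_nonneg)
    then show ?thesis using range_space_inner_bound[OF S _ y, of x] x carrier F by simp
  qed
  show "hnorm E x \<le> hnorm F x" if x: "x \<in> hcarrier F"
  proof -
    have xE: "x \<in> hcarrier E" using x SD by (auto simp: carrier)
    have "cmod (hinner E x x) \<le> hnorm F x * sqrt ((hnorm E x)\<^sup>2 - (hnorm E (adj E E A x))\<^sup>2)" by (rule bound[OF x xE])
    also have "\<dots> \<le> hnorm F x * hnorm E x"
      using nonneg[OF x] xE by (intro mult_left_mono) (auto intro: real_le_lsqrt)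
    finally show ?thesis using xE nonneg[OF x] by (intro hnorm_le_of_inner_self)
  qed
qed

text \<open>
  The left-hand spaces enter the inclusions through the numbers \<open>N n\<close>: \<open>N n\<close> is the norm of the
  \<open>n\<close>-th coefficient in the de Branges--Rovnyak space, and the range norm controls inner products
  with the coefficient through the defect of \<open>A\<close>.
\<close>

lemma (in bergman) bergman_dBR_space:
  assumes A: "adjoint_contractions E E A (adj E E A)"
    and f: "f \<in> hcarrier (bergman_space (\<alpha> - 1) (dBR_space E E A))"
  obtains N where "f \<in> hcarrier H" "\<And>n. 0 \<le> N n" "summable (\<lambda>n. (N n)\<^sup>2 / bergman_coeff (\<alpha> - 1) n)"
    "\<And>n y. y \<in> hcarrier E \<Longrightarrow>
      cmod (hinner E y (T f n)) \<le> N n * sqrt ((hnorm E y)\<^sup>2 - (hnorm E (adj E E A y))\<^sup>2)"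
proof -
  define F where "F = dBR_space E E A"
  note F = dBR_space_bounds[OF E.hilbert_space_axioms A, folded F_def]
  obtain a where a: "has_taylor F f a" and sm: "summable (\<lambda>n. (hnorm F (a n))\<^sup>2 / bergman_coeff (\<alpha> - 1) n)"
    using f unfolding F_def[symmetric] by (auto simp: bergman_space_def)
  have aF: "a n \<in> hcarrier F" and fF: "z \<in> ball 0 1 \<Longrightarrow> f z \<in> hcarrier F" for n z
    using a by (auto simp: has_taylor_def)
  have aE: "a n \<in> hcarrier E" for n using aF F(2) by auto
  have ft: "has_taylor E f a"
    unfolding has_taylor_def
  proof (intro conjI allI ballI impI)
    fix z :: complex assume z: "z \<in> ball 0 1"
    show "f z \<in> hcarrier E" using fF[OF z] F(2) by auto
    have carr: "f z - (\<Sum>n<N. z ^ n *\<^sub>C a n) \<in> hcarrier F" for N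
      by (intro complex_vector.subspace_diff complex_vector.subspace_sum complex_vector.subspace_scale F(1) aF fF z)
    show "(\<lambda>N. hnorm E (f z - (\<Sum>n<N. z ^ n *\<^sub>C a n))) \<longlonglongrightarrow> 0"
    proof (rule Lim_null_comparison[OF always_eventually], rule allI)
      show "(\<lambda>N. hnorm F (f z - (\<Sum>n<N. z ^ n *\<^sub>C a n))) \<longlonglongrightarrow> 0"
        using a z by (auto simp: has_taylor_def)
      fix N
      have "f z - (\<Sum>n<N. z ^ n *\<^sub>C a n) \<in> hcarrier E" using carr F(2) by auto
      then show "norm (hnorm E (f z - (\<Sum>n<N. z ^ n *\<^sub>C a n))) \<le> hnorm F (f z - (\<Sum>n<N. z ^ n *\<^sub>C a n))"
        using F(4)[OF carr] by simp
    qed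
  qed (use aE a in \<open>auto simp: has_taylor_def\<close>)
  then have T: "T f = a" by (rule E.taylor_eq)
  have "ell2 a" unfolding ell2_def
  proof (intro conjI allI aE summable_comparison_test'[OF sm])
    fix n
    define d where "d = bergman_coeff (\<alpha> - 1) n"
    have d: "d > 0" unfolding d_def using alpha by (intro bergman_coeff_pos) simp
    have "d * (\<alpha> + 1) \<le> d * (real n + \<alpha> + 1)" using d by (intro mult_left_mono) auto
    then have "d * (\<alpha> + 1) \<le> c n * (\<alpha> + 1)" unfolding d_def bergman_coeff_shift[OF alpha] .
    then have "d \<le> c n" using alpha by simp
    then have "(hnorm E (a n))\<^sup>2 / c n \<le> (hnorm F (a n))\<^sup>2 / d"
      using F(4)[OF aF] aE d by (intro frac_le power_mono) auto
    then show "norm ((hnorm E (a n))\<^sup>2 / c n) \<le> (hnorm F (a n))\<^sup>2 / bergman_coeff (\<alpha> - 1) n"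
      by (simp add: d_def)
  qed
  with ft have "f \<in> hcarrier H" by (rule H_intro)
  moreover have "cmod (hinner E y (T f n)) \<le> hnorm F (a n) * sqrt ((hnorm E y)\<^sup>2 - (hnorm E (adj E E A y))\<^sup>2)"
    if "y \<in> hcarrier E" for y n
    unfolding T using F(5)[OF aF that, of n] E.inner_commute[OF that aE, of n] by simp
  ultimately show thesis using that[of "\<lambda>n. hnorm F (a n)"] F(3)[OF aF] sm by blast
qed


section \<open>Multiplication on the Bergman space\<close>

locale bergman_multiplier = bergman E \<alpha> + schur_expansion E B X
  for E :: "'e::complex_vector inner_space" and \<alpha> B X
begin

abbreviation "d \<equiv> bergman_coeff (\<alpha> - 1)"
abbreviation "M \<equiv> mult_op B"
abbreviation "M' \<equiv> adj H H M"
text \<open>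
  A common bound for \<open>d n / d (n + 1)\<close> and for the ratio of \<open>d n / (c n)\<^sup>2\<close> to the differences of
  \<open>1 / c n\<close>. It is finite because \<open>\<alpha> > -1\<close>.
\<close>

definition "\<kappa> = 1 + 1 / (\<alpha> + 1)"

lemma d_pos: "d n > 0" using alpha by (intro bergman_coeff_pos) simp

lemma \<kappa>_pos: "\<kappa> > 0" using alpha by (simp add: \<kappa>_def add_pos_nonneg)

lemma \<kappa>_ratio: "(real n + \<alpha> + 2) / (real n + \<alpha> + 1) \<le> \<kappa>"
proof -
  have "(real n + \<alpha> + 2) / (real n + \<alpha> + 1) = 1 + 1 / (real n + \<alpha> + 1)"
    using alpha by (simp add: field_simps)
  also have "1 / (real n + \<alpha> + 1) \<le> 1 / (\<alpha> + 1)" using alpha by (intro divide_left_mono) auto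
  finally show ?thesis by (simp add: \<kappa>_def)
qed

lemma d_ratio: "d n \<le> \<kappa> * d (Suc n)"
proof -
  have "(real n + 1) / (real n + \<alpha> + 1) \<le> (real n + \<alpha> + 2) / (real n + \<alpha> + 1)"
    using alpha by (intro divide_right_mono) auto
  then have "(real n + 1) / (real n + \<alpha> + 1) \<le> \<kappa>" using \<kappa>_ratio[of n] by linarith
  then have "(real n + 1) / (real n + \<alpha> + 1) * d (Suc n) \<le> \<kappa> * d (Suc n)"
    using d_pos[of "Suc n"] by (intro mult_right_mono) auto
  moreover have "(real n + 1) / (real n + \<alpha> + 1) * d (Suc n) = d n"
    using bergman_coeff_Suc[of "\<alpha> - 1" n] alpha by (simp add: field_simps)
  ultimately show ?thesis by simp
qed

lemma c_Suc: "c (Suc n) * (real n + 1) = c n * (real n + \<alpha> + 2)"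
  using bergman_coeff_Suc[of \<alpha> n] alpha by simp

lemma inverse_c_diff: "1 / c n - 1 / c (Suc n) = (\<alpha> + 1) / (real n + \<alpha> + 2) * (1 / c n)"
proof -
  have "(real n + 1) / (real n + \<alpha> + 2) * (1 / c n) = (real n + 1) / (c n * (real n + \<alpha> + 2))"
    by simp
  also have "\<dots> = 1 / c (Suc n)" unfolding c_Suc[symmetric] using of_nat_0_le_iff[of n] by simp
  finally have "1 / c (Suc n) = (real n + 1) / (real n + \<alpha> + 2) * (1 / c n)" ..
  then have "1 / c n - 1 / c (Suc n) = (1 - (real n + 1) / (real n + \<alpha> + 2)) * (1 / c n)"
    by (simp add: algebra_simps)
  also have "1 - (real n + 1) / (real n + \<alpha> + 2) = (\<alpha> + 1) / (real n + \<alpha> + 2)"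
    using alpha by (simp add: field_simps)
  finally show ?thesis .
qed

lemma inverse_c_mono: "1 / c (Suc n) \<le> 1 / c n"
proof -
  have "0 \<le> (\<alpha> + 1) / (real n + \<alpha> + 2) * (1 / c n)" using alpha by simp
  then show ?thesis using inverse_c_diff[of n] by linarith
qed

lemma inverse_c_diff_mono: "1 / c (Suc n) - 1 / c (Suc (Suc n)) \<le> 1 * (1 / c n - 1 / c (Suc n))"
  unfolding inverse_c_diff mult_1 using alpha
  by (intro mult_mono divide_left_mono inverse_c_mono) auto

lemma weight_ratio: "d n / (c n)\<^sup>2 \<le> \<kappa> * (1 / c n - 1 / c (Suc n))"
proof -
  have "d n / (c n)\<^sup>2 = (\<alpha> + 1) / (real n + \<alpha> + 1) * (1 / c n)"
    using bergman_coeff_shift[OF alpha, of n] alpha c_nz[of n]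
    by (simp add: power2_eq_square divide_simps) (simp add: algebra_simps)
  also have "\<dots> = (real n + \<alpha> + 2) / (real n + \<alpha> + 1) * (1 / c n - 1 / c (Suc n))"
    unfolding inverse_c_diff using alpha by simp
  also have "\<dots> \<le> \<kappa> * (1 / c n - 1 / c (Suc n))"
    using inverse_c_mono[of n] by (intro mult_right_mono \<kappa>_ratio) simp
  finally show ?thesis .
qed

text \<open>
  Decreasing weights preserve the contractivity of the partial sums; this is summation by parts
  with \<open>\<delta> = 0\<close>.
\<close>

lemma conv_weighted_le:
  assumes a: "\<And>n. a n \<in> hcarrier E"
  shows "(\<Sum>n\<le>N. (hnorm E (conv X a n))\<^sup>2 / c n) \<le> (\<Sum>n\<le>N. (hnorm E (a n))\<^sup>2 / c n)"
proof -
  let ?e = "\<lambda>n. (hnorm E (a n))\<^sup>2 - (hnorm E (conv X a n))\<^sup>2"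
  have p: "0 \<le> (\<Sum>m\<le>n. ?e m)" for n
    using toeplitz_contraction a by (simp add: contractive_toeplitz_def sum_subtractf)
  have "0 \<le> (\<Sum>m<n. ?e m)" for n using p by (cases n) (simp_all flip: lessThan_Suc_atMost)
  then have "(\<Sum>n\<le>N. (1 / c n - 1 / c (Suc n)) * 0) \<le> 2 * (1 + 1) * (\<Sum>n\<le>N. 1 / c n * ?e n)"
    using p inverse_c_mono inverse_c_diff_mono by (intro weighted_Abel) auto
  then have "0 \<le> (\<Sum>n\<le>N. 1 / c n * ?e n)" by simp
  also have "\<dots> = (\<Sum>n\<le>N. (hnorm E (a n))\<^sup>2 / c n) - (\<Sum>n\<le>N. (hnorm E (conv X a n))\<^sup>2 / c n)"
    by (simp add: diff_divide_distrib sum_subtractf)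
  finally show ?thesis by simp
qed

text \<open>
  The error of the truncated product at \<open>z\<close> is at most \<open>\<parallel>f z - P N\<parallel>\<close> plus a fixed multiple of a term of
  the Cauchy product of two absolutely convergent series, which tends to \<open>0\<close>.
\<close>

lemma mult_op_taylor:
  assumes f: "f \<in> hcarrier H"
  shows "has_taylor E (M f) (conv X (T f))"
  unfolding has_taylor_def
proof (intro conjI allI ballI impI)
  have ft: "has_taylor E f (T f)" and ell2: "ell2 (T f)" using f by (simp_all add: H_carrier_iff)
  note fD = E.has_taylorD[OF ft]
  show "conv X (T f) n \<in> hcarrier E" for n by (intro E.conv_carrier X_ops fD)
  fix z :: complex
  show "M f z = 0" if "z \<notin> ball 0 1" using that by (simp add: mult_op_def)
  assume z: "z \<in> ball 0 1"
  note Bz = B_op[OF z]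
  show Mf: "M f z \<in> hcarrier E" using z bounded_opsD(1)[OF Bz fD(2)[OF z]] by (simp add: mult_op_def)
  define P where "P N = (\<Sum>k<N. z ^ k *\<^sub>C T f k)" for N
  define Q where "Q N = (\<Sum>n<N. z ^ n *\<^sub>C conv X (T f) n)" for N
  define \<rho> where "\<rho> N = (\<Sum>k\<le>N. (cmod z ^ k * hnorm E (T f k)) * cmod z ^ (N - k))" for N
  have P: "P N \<in> hcarrier E" for N unfolding P_def by (intro E.carrier_sum E.carrier_scaleC fD)
  have Q: "Q N \<in> hcarrier E" for N unfolding Q_def by (intro E.carrier_sum E.carrier_scaleC E.conv_carrier X_ops fD)
  have "summable \<rho>" unfolding \<rho>_def
    using abs_summable[OF ell2 z] z fD(1) by (intro summable_Cauchy_product) auto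
  then have "\<rho> \<longlonglongrightarrow> 0" by (rule summable_LIMSEQ_zero)
  then have "(\<lambda>N. hnorm E (f z - P N) + \<rho> N / (1 - cmod z)) \<longlonglongrightarrow> 0 + 0 / (1 - cmod z)"
    unfolding P_def using z by (intro tendsto_add tendsto_divide tendsto_const fD(3)) auto
  then have lim: "(\<lambda>N. hnorm E (f z - P N) + \<rho> N / (1 - cmod z)) \<longlonglongrightarrow> 0" by simp
  show "(\<lambda>N. hnorm E (M f z - (\<Sum>n<N. z ^ n *\<^sub>C conv X (T f) n))) \<longlonglongrightarrow> 0"
  proof (rule Lim_null_comparison[OF always_eventually lim], rule allI)
    fix N
    have BP: "B z (P N) \<in> hcarrier E" using bounded_opsD(1)[OF Bz P] .
    have "hnorm E (M f z - Q N) \<le> hnorm E (M f z - B z (P N)) + hnorm E (B z (P N) - Q N)"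
      by (rule E.hnorm_triangle_diff[OF Mf BP Q])
    also have "M f z - B z (P N) = B z (f z - P N)"
      using z bounded_ops_diff[OF E.prehilbert_axioms Bz fD(2)[OF z] P] by (simp add: mult_op_def)
    also have "hnorm E \<dots> \<le> hnorm E (f z - P N)" using fD(2)[OF z] P by (intro B_contr z) auto
    also have "hnorm E (B z (P N) - Q N) \<le> (\<Sum>k<N. (cmod z ^ k * hnorm E (T f k)) * cmod z ^ (N - k)) / (1 - cmod z)"
      unfolding P_def Q_def by (intro polynomial_remainder z fD)
    also have "\<dots> \<le> \<rho> N / (1 - cmod z)"
      unfolding \<rho>_def using z fD(1) by (intro divide_right_mono sum_mono2) auto
    finally show "norm (hnorm E (M f z - (\<Sum>n<N. z ^ n *\<^sub>C conv X (T f) n))) \<le> hnorm E (f z - P N) + \<rho> N / (1 - cmod z)"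
      unfolding Q_def[symmetric] using Mf Q by simp
  qed
qed

lemma mult_op_H:
  assumes f: "f \<in> hcarrier H"
  shows "M f \<in> hcarrier H" "T (M f) = conv X (T f)" "hnorm H (M f) \<le> hnorm H f"
proof -
  have carr: "conv X (T f) n \<in> hcarrier E" for n using E.has_taylorD(1)[OF mult_op_taylor[OF f]] .
  have le: "(\<Sum>n\<le>N. (hnorm E (conv X (T f) n))\<^sup>2 / c n) \<le> (hnorm H f)\<^sup>2" for N
    using conv_weighted_le[of "T f" N] sum_le_sums[OF H_norm_sums[OF f], of "{..N}"] f by simp
  have "summable (\<lambda>n. (hnorm E (conv X (T f) n))\<^sup>2 / c n)"
  proof (rule summableI_nonneg_bounded)
    show "(\<Sum>i<n. (hnorm E (conv X (T f) i))\<^sup>2 / c i) \<le> (hnorm H f)\<^sup>2" for n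
      using le[of "n - 1"] by (cases n) (auto simp: lessThan_Suc_atMost)
  qed auto
  then have "ell2 (conv X (T f))" using carr by (simp add: ell2_def)
  then show Mf: "M f \<in> hcarrier H" using mult_op_taylor[OF f] by (intro H_intro)
  show TM: "T (M f) = conv X (T f)" by (rule E.taylor_eq[OF mult_op_taylor[OF f]])
  have "(hnorm H (M f))\<^sup>2 \<le> (hnorm H f)\<^sup>2"
  proof (rule LIMSEQ_le_const2)
    show "(\<lambda>N. \<Sum>n\<le>N. (hnorm E (conv X (T f) n))\<^sup>2 / c n) \<longlonglongrightarrow> (hnorm H (M f))\<^sup>2"
      using H_norm_sums[OF Mf] unfolding TM sums_def_le .
  qed (use le in blast)
  then show "hnorm H (M f) \<le> hnorm H f"
    using prehilbert.hnorm_nonneg[OF prehilbert_H f] by (rule power2_le_imp_le)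
qed

lemma M_bounded: "M \<in> bounded_ops H H"
  unfolding bounded_ops_def
proof (intro CollectI conjI ballI allI exI)
  show "M f \<in> hcarrier H" if "f \<in> hcarrier H" for f by (rule mult_op_H(1)[OF that])
  show "hnorm H (M f) \<le> 1 * hnorm H f" if "f \<in> hcarrier H" for f using mult_op_H(3)[OF that] by simp
  have val: "f z \<in> hcarrier E" if "f \<in> hcarrier H" "z \<in> ball 0 1" for f z
    using that E.has_taylorD(2) H_carrier_iff by metis
  show "M (f + g) = M f + M g" if "f \<in> hcarrier H" "g \<in> hcarrier H" for f g
    using bounded_opsD(2)[OF B_op val[OF that(1)] val[OF that(2)]] by (auto simp: mult_op_def fun_eq_iff)
  show "M (k *\<^sub>C f) = k *\<^sub>C M f" if "f \<in> hcarrier H" for k f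
    using bounded_opsD(3)[OF B_op val[OF that]] by (auto simp: mult_op_def fun_eq_iff scaleC_fun_def)
qed

lemma M_adjoint: "adjoint_contractions H H M (M')"
  by (intro adjoint_contractions_adj hilbert_H M_bounded mult_op_H(3))



section \<open>The inclusions\<close>

text \<open>
  On a polynomial the adjoint of multiplication is given by finite sums: in the coordinates
  \<open>g n / c n\<close> it is the upper triangular Toeplitz matrix of the adjoint coefficients.
\<close>

lemma taylor_adj_mult_op:
  assumes g: "g \<in> hcarrier H" and G: "\<And>n. n > N \<Longrightarrow> T g n = 0"
  defines "y \<equiv> \<lambda>k. \<Sum>n\<in>{k..N}. adj E E (X (n - k)) (of_real (1 / c n) *\<^sub>C T g n)"
  shows "T (M' g) = (\<lambda>k. if k \<le> N then of_real (c k) *\<^sub>C y k else 0)" (is "_ = ?t")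
proof -
  interpret HH: hilbert_space H by (rule hilbert_H)
  note adj_X = adj_bounded[OF E.hilbert_space_axioms E.hilbert_space_axioms X_ops]
  have Tg: "T g n \<in> hcarrier E" for n using g by simp
  have y: "y k \<in> hcarrier E" for k
    unfolding y_def using Tg by (intro E.carrier_sum bounded_opsD(1)[OF adj_X] E.carrier_scaleC)
  have "ell2 ?t"
    unfolding ell2_def using y by (auto intro!: summable_finite[of "{..N}"] split: if_splits)
  then obtain h where h: "h \<in> hcarrier H" "T h = ?t" by (rule synthesis)
  have adj_g: "M' g \<in> hcarrier H"
    using bounded_opsD(1)[OF adj_bounded[OF hilbert_H hilbert_H M_bounded] g] .
  have "M' g = h"
  proof (rule HH.inner_ext[OF adj_g h(1)])
    fix f assume f: "f \<in> hcarrier H"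
    have Tf: "T f n \<in> hcarrier E" for n using f by simp
    have "(\<lambda>n. hinner E (T (M f) n) (T g n) / of_real (c n)) sums
        (\<Sum>n\<le>N. hinner E (T (M f) n) (T g n) / of_real (c n))"
      by (rule sums_finite) (use G mult_op_H(1)[OF f] in auto)
    then have "hinner H (M f) g = (\<Sum>n\<le>N. hinner E (T (M f) n) (T g n) / of_real (c n))"
      by (rule sums_unique2[OF H_inner_sums[OF mult_op_H(1)[OF f] g]])
    also have "\<dots> = (\<Sum>n\<le>N. \<Sum>k\<le>n. hinner E (T f k) (adj E E (X (n - k)) (of_real (1 / c n) *\<^sub>C T g n)))"
    proof (rule sum.cong[OF refl])
      fix n
      have gn: "of_real (1 / c n) *\<^sub>C T g n \<in> hcarrier E" using Tg by auto
      have "hinner E (T (M f) n) (T g n) / of_real (c n) = hinner E (conv X (T f) n) (of_real (1 / c n) *\<^sub>C T g n)"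
        unfolding mult_op_H(2)[OF f] using E.conv_carrier[OF X_ops Tf] Tg by (simp add: E.inner_scaleC_right)
      also have "\<dots> = (\<Sum>k\<le>n. hinner E (X (n - k) (T f k)) (of_real (1 / c n) *\<^sub>C T g n))"
        unfolding conv_def using bounded_opsD(1)[OF X_ops Tf] gn by (intro E.inner_sum) auto
      also have "\<dots> = (\<Sum>k\<le>n. hinner E (T f k) (adj E E (X (n - k)) (of_real (1 / c n) *\<^sub>C T g n)))"
        by (intro sum.cong refl inner_adj[OF E.hilbert_space_axioms E.hilbert_space_axioms X_ops] Tf gn)
      finally show "hinner E (T (M f) n) (T g n) / of_real (c n) =
          (\<Sum>k\<le>n. hinner E (T f k) (adj E E (X (n - k)) (of_real (1 / c n) *\<^sub>C T g n)))" .
    qed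
    also have "\<dots> = (\<Sum>k\<le>N. \<Sum>n\<in>{k..N}. hinner E (T f k) (adj E E (X (n - k)) (of_real (1 / c n) *\<^sub>C T g n)))"
      by (rule sum_triangle_swap)
    also have "\<dots> = (\<Sum>k\<le>N. hinner E (T f k) (y k))"
      unfolding y_def using Tg Tf
      by (intro sum.cong refl E.inner_sum_right[symmetric] bounded_opsD(1)[OF adj_X] E.carrier_scaleC)
    also have "\<dots> = (\<Sum>k\<le>N. hinner E (T f k) (T h k) / of_real (c k))"
      unfolding h(2) using y Tf by (intro sum.cong refl) (simp add: E.inner_scaleC_right)
    also have "(\<lambda>k. hinner E (T f k) (T h k) / of_real (c k)) sums \<dots>"
      by (rule sums_finite) (use h(2) Tf in auto)
    then have "(\<Sum>k\<le>N. hinner E (T f k) (T h k) / of_real (c k)) = hinner H f h"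
      by (rule sums_unique2[OF _ H_inner_sums[OF f h(1)]])
    finally show "hinner H f (M' g) = hinner H f h"
      using inner_adj[OF hilbert_H hilbert_H M_bounded f g] by simp
  qed
  then show ?thesis using h by simp
qed

lemma hnorm_finite_support:
  assumes "f \<in> hcarrier H" "\<And>n. n > N \<Longrightarrow> T f n = 0"
  shows "(hnorm H f)\<^sup>2 = (\<Sum>n\<le>N. (hnorm E (T f n))\<^sup>2 / c n)"
  using sums_unique2[OF H_norm_sums[OF assms(1)] sums_finite[of "{..N}"]] assms(2) by auto

text \<open>
  The coordinates \<open>g n / c n\<close>, read backwards from \<open>N\<close>, are acted upon by the contractive Toeplitz
  sequence of the adjoint coefficients, with weights \<open>c (N - j)\<close>. The differences of these weights
  are \<open>d (N - j)\<close>; the last one, \<open>c 0 - 0\<close>, fits because \<open>c 0 = d 0 = 1\<close>.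
\<close>

lemma adj_defect_bound_finite_support:
  assumes g: "g \<in> hcarrier H" and G: "\<And>n. n > N \<Longrightarrow> T g n = 0"
  shows "(\<Sum>n\<le>N. d n / (c n)\<^sup>2 * ((hnorm E (T g n))\<^sup>2 - (hnorm E (adj E E (X 0) (T g n)))\<^sup>2))
    \<le> 2 * (1 + \<kappa>) * ((hnorm H g)\<^sup>2 - (hnorm H (M' g))\<^sup>2)"
proof -
  define X' where "X' = (\<lambda>n. adj E E (X n))"
  have X': "contractive_toeplitz E X'"
    unfolding X'_def by (rule contractive_toeplitz_adj[OF E.hilbert_space_axioms toeplitz_contraction])
  note X'_ops = contractive_toeplitz_bounded[OF X']
  define v where "v n = of_real (1 / c n) *\<^sub>C T g n" for n
  have v: "v n \<in> hcarrier E" for n using g by (simp add: v_def)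
  define x where "x j = v (N - j)" for j
  define w where "w j = (if j \<le> N then c (N - j) else 0)" for j
  have w_diff: "w j - w (Suc j) = (if j \<le> N then d (N - j) else 0)" for j
  proof (cases "j < N")
    case True
    then obtain i where i: "N = Suc (j + i)" using less_imp_Suc_add by blast
    then show ?thesis using bergman_coeff_diff[OF alpha, of i] by (simp add: w_def Suc_diff_le)
  next
    case False
    then show ?thesis using alpha by (auto simp: w_def bergman_coeff_0)
  qed
  have "(\<Sum>j\<le>N. (w j - w (Suc j)) * ((hnorm E (x j))\<^sup>2 - (hnorm E (X' 0 (x j)))\<^sup>2))
      \<le> 2 * (1 + \<kappa>) * (\<Sum>j\<le>N. w j * ((hnorm E (x j))\<^sup>2 - (hnorm E (conv X' x j))\<^sup>2))"
  proof (rule E.weighted_defect_bound[OF X'])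
    show "x j \<in> hcarrier E" "w j \<ge> 0" for j using v by (auto simp: x_def w_def)
    have "w j - w (Suc j) \<ge> 0" for j unfolding w_diff using d_pos[of "N - j"] by simp
    then show "w (Suc j) \<le> w j" for j by (simp add: algebra_simps)
    show "w (Suc j) - w (Suc (Suc j)) \<le> \<kappa> * (w j - w (Suc j))" for j
    proof (cases "j < N")
      case True
      then have "Suc (N - Suc j) = N - j" by simp
      then show ?thesis unfolding w_diff using True d_ratio[of "N - Suc j"] by simp
    next
      case False
      then show ?thesis unfolding w_diff using d_pos[of "N - j"] \<kappa>_pos by simp
    qed
  qed (use \<kappa>_pos in simp)
  also have "(\<Sum>j\<le>N. (w j - w (Suc j)) * ((hnorm E (x j))\<^sup>2 - (hnorm E (X' 0 (x j)))\<^sup>2)) =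
      (\<Sum>n\<le>N. d n / (c n)\<^sup>2 * ((hnorm E (T g n))\<^sup>2 - (hnorm E (X' 0 (T g n)))\<^sup>2))"
  proof (rule sum.reindex_bij_witness[where i = "\<lambda>n. N - n" and j = "\<lambda>n. N - n"])
    fix j assume j: "j \<in> {..N}"
    have "(hnorm E (v n))\<^sup>2 - (hnorm E (X' 0 (v n)))\<^sup>2 =
        ((hnorm E (T g n))\<^sup>2 - (hnorm E (X' 0 (T g n)))\<^sup>2) / (c n)\<^sup>2" for n
      unfolding v_def using g bounded_opsD(1,3)[OF X'_ops]
      by (simp add: E.hnorm_scaleC norm_divide power_divide diff_divide_distrib)
    then show "d (N - j) / (c (N - j))\<^sup>2 * ((hnorm E (T g (N - j)))\<^sup>2 - (hnorm E (X' 0 (T g (N - j))))\<^sup>2) =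
        (w j - w (Suc j)) * ((hnorm E (x j))\<^sup>2 - (hnorm E (X' 0 (x j)))\<^sup>2)"
      unfolding w_diff x_def using j by simp
  qed auto
  also have "(\<Sum>j\<le>N. w j * ((hnorm E (x j))\<^sup>2 - (hnorm E (conv X' x j))\<^sup>2)) =
      (hnorm H g)\<^sup>2 - (hnorm H (M' g))\<^sup>2"
  proof -
    define y where "y k = (\<Sum>n\<in>{k..N}. X' (n - k) (v n))" for k
    have y: "y k \<in> hcarrier E" for k
      unfolding y_def by (intro E.carrier_sum bounded_opsD(1)[OF X'_ops] v)
    have T_adj: "T (M' g) = (\<lambda>k. if k \<le> N then of_real (c k) *\<^sub>C y k else 0)"
      using taylor_adj_mult_op[OF g G] unfolding y_def X'_def v_def by simp
    have adj_g: "M' g \<in> hcarrier H"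
      using bounded_opsD(1)[OF adj_bounded[OF hilbert_H hilbert_H M_bounded] g] .
    have "(hnorm H g)\<^sup>2 = (\<Sum>n\<le>N. (hnorm E (T g n))\<^sup>2 / c n)" by (rule hnorm_finite_support[OF g G])
    also have "\<dots> = (\<Sum>n\<le>N. c n * (hnorm E (v n))\<^sup>2)"
      unfolding v_def using g
      by (intro sum.cong refl) (simp add: E.hnorm_scaleC norm_divide power_divide power2_eq_square)
    finally have "(hnorm H g)\<^sup>2 = (\<Sum>n\<le>N. c n * (hnorm E (v n))\<^sup>2)" .
    moreover have "(hnorm H (M' g))\<^sup>2 = (\<Sum>n\<le>N. c n * (hnorm E (y n))\<^sup>2)"
    proof -
      have "(hnorm H (M' g))\<^sup>2 = (\<Sum>n\<le>N. (hnorm E (T (M' g) n))\<^sup>2 / c n)"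
        by (rule hnorm_finite_support[OF adj_g]) (simp add: T_adj)
      also have "\<dots> = (\<Sum>n\<le>N. c n * (hnorm E (y n))\<^sup>2)"
        unfolding T_adj using y
        by (intro sum.cong refl) (simp add: E.hnorm_scaleC power_mult_distrib power2_eq_square)
      finally show ?thesis .
    qed
    moreover have "(\<Sum>j\<le>N. w j * ((hnorm E (x j))\<^sup>2 - (hnorm E (conv X' x j))\<^sup>2)) =
        (\<Sum>n\<le>N. c n * ((hnorm E (v n))\<^sup>2 - (hnorm E (y n))\<^sup>2))"
    proof (rule sum.reindex_bij_witness[where i = "\<lambda>n. N - n" and j = "\<lambda>n. N - n"])
      fix j assume j: "j \<in> {..N}"
      have "y (N - j) = conv X' (\<lambda>j. v (N - j)) (N - (N - j))"
        unfolding y_def by (rule conv_reversed[symmetric]) simp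
      then show "c (N - j) * ((hnorm E (v (N - j)))\<^sup>2 - (hnorm E (y (N - j)))\<^sup>2) =
          w j * ((hnorm E (x j))\<^sup>2 - (hnorm E (conv X' x j))\<^sup>2)"
        using j by (simp add: w_def x_def[abs_def])
    qed auto
    ultimately show ?thesis by (simp add: right_diff_distrib sum_subtractf)
  qed
  finally show ?thesis by (simp add: X'_def)
qed

lemma mult_op_defect_bound:
  assumes g: "g \<in> hcarrier H"
  shows "(\<Sum>n\<le>N. d n / (c n)\<^sup>2 * ((hnorm E (T g n))\<^sup>2 - (hnorm E (X 0 (T g n)))\<^sup>2))
    \<le> 4 * \<kappa> * (\<Sum>n\<le>N. (hnorm E (T g n))\<^sup>2 / c n - (hnorm E (T (M g) n))\<^sup>2 / c n)"
proof -
  have Tg: "T g n \<in> hcarrier E" for n using g by simp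
  have X0: "hnorm E (X 0 x) \<le> hnorm E x" if "x \<in> hcarrier E" for x
    unfolding X_0 by (rule B_contr) (use that in auto)
  have "(\<Sum>n\<le>N. d n / (c n)\<^sup>2 * ((hnorm E (T g n))\<^sup>2 - (hnorm E (X 0 (T g n)))\<^sup>2)) \<le>
      (\<Sum>n\<le>N. \<kappa> * (1 / c n - 1 / c (Suc n)) * ((hnorm E (T g n))\<^sup>2 - (hnorm E (X 0 (T g n)))\<^sup>2))"
    using X0[OF Tg] bounded_opsD(1)[OF X_ops Tg]
    by (intro sum_mono mult_right_mono weight_ratio) (auto intro!: power_mono)
  also have "\<dots> = \<kappa> * (\<Sum>n\<le>N. (1 / c n - 1 / c (Suc n)) * ((hnorm E (T g n))\<^sup>2 - (hnorm E (X 0 (T g n)))\<^sup>2))"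
    by (simp add: sum_distrib_left mult.assoc)
  also have "\<dots> \<le> \<kappa> * (2 * (1 + 1) * (\<Sum>n\<le>N. 1 / c n * ((hnorm E (T g n))\<^sup>2 - (hnorm E (conv X (T g) n))\<^sup>2)))"
    using \<kappa>_pos inverse_c_mono inverse_c_diff_mono
    by (intro mult_left_mono E.weighted_defect_bound toeplitz_contraction Tg) auto
  finally show ?thesis by (simp add: mult_op_H(2)[OF g] diff_divide_distrib mult_ac)
qed

lemma X0_adjoint: "adjoint_contractions E E (X 0) (adj E E (X 0))"
proof (rule adjoint_contractions_adj[OF E.hilbert_space_axioms E.hilbert_space_axioms X_ops])
  show "hnorm E (X 0 x) \<le> hnorm E x" if "x \<in> hcarrier E" for x
    unfolding X_0 by (rule B_contr) (use that in auto)
qed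

text \<open>
  Cauchy--Schwarz with the factors \<open>N n / sqrt (d n)\<close> and \<open>sqrt (d n) / c n * sqrt (\<delta> n)\<close>, where
  \<open>N n\<close> is the range norm of the coefficient \<open>T f n\<close> and \<open>\<delta> n\<close> is the defect of \<open>A\<close> at \<open>a n\<close>. The
  constant \<open>S\<close> is the sum of \<open>(N n)\<^sup>2 / d n\<close>, the squared norm of \<open>f\<close> in the smaller space.
\<close>

lemma inner_partial_bound:
  assumes A: "adjoint_contractions E E A (adj E E A)"
    and "f \<in> hcarrier (bergman_space (\<alpha> - 1) (dBR_space E E A))"
  obtains S where "f \<in> hcarrier H" "0 \<le> S" "\<And>a m. (\<And>n. a n \<in> hcarrier E) \<Longrightarrow>
    (cmod (\<Sum>n\<le>m. hinner E (a n) (T f n) / of_real (c n)))\<^sup>2 \<le>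
      S * (\<Sum>n\<le>m. d n / (c n)\<^sup>2 * ((hnorm E (a n))\<^sup>2 - (hnorm E (adj E E A (a n)))\<^sup>2))"
proof -
  obtain N where f: "f \<in> hcarrier H" and N: "\<And>n. 0 \<le> N n" "summable (\<lambda>n. (N n)\<^sup>2 / d n)"
    and le: "\<And>n y. y \<in> hcarrier E \<Longrightarrow>
      cmod (hinner E y (T f n)) \<le> N n * sqrt ((hnorm E y)\<^sup>2 - (hnorm E (adj E E A y))\<^sup>2)"
    by (rule bergman_dBR_space[OF assms]) blast
  define S where "S = (\<Sum>n. (N n)\<^sup>2 / d n)"
  have dn: "d n > 0" for n by (rule d_pos)
  show thesis
  proof (rule that[OF f])
    show "0 \<le> S" unfolding S_def using N dn by (intro suminf_nonneg) (auto simp: less_imp_le)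
    fix a :: "nat \<Rightarrow> 'e" and m assume a: "\<And>n. a n \<in> hcarrier E"
    define u where "u n = hinner E (a n) (T f n)" for n
    define \<delta> where "\<delta> n = (hnorm E (a n))\<^sup>2 - (hnorm E (adj E E A (a n)))\<^sup>2" for n
    have \<delta>: "0 \<le> \<delta> n" for n
      using A a[of n] by (auto simp: \<delta>_def adjoint_contractions_def bounded_opsD(1) intro!: power_mono)
    have "cmod (\<Sum>n\<le>m. u n / of_real (c n)) \<le> (\<Sum>n\<le>m. cmod (u n / of_real (c n)))" by (rule norm_sum)
    also have "\<dots> \<le> (\<Sum>n\<le>m. (N n / sqrt (d n)) * (sqrt (d n) / c n * sqrt (\<delta> n)))"
    proof (rule sum_mono)
      fix n
      have "cmod (u n) / c n \<le> N n * sqrt (\<delta> n) / c n"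
        unfolding u_def \<delta>_def using le[OF a] by (intro divide_right_mono) auto
      then show "cmod (u n / of_real (c n)) \<le> (N n / sqrt (d n)) * (sqrt (d n) / c n * sqrt (\<delta> n))"
        using dn[of n] by (simp add: norm_divide)
    qed
    finally have "(cmod (\<Sum>n\<le>m. u n / of_real (c n)))\<^sup>2 \<le> (\<Sum>n\<le>m. (N n / sqrt (d n)) * (sqrt (d n) / c n * sqrt (\<delta> n)))\<^sup>2"
      by (rule power_mono) simp
    also have "\<dots> \<le> (\<Sum>n\<le>m. (N n / sqrt (d n))\<^sup>2) * (\<Sum>n\<le>m. (sqrt (d n) / c n * sqrt (\<delta> n))\<^sup>2)"
      by (rule Cauchy_Schwarz_ineq_sum)
    also have "\<dots> = (\<Sum>n\<le>m. (N n)\<^sup>2 / d n) * (\<Sum>n\<le>m. d n / (c n)\<^sup>2 * \<delta> n)"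
      using dn \<delta> by (simp add: power_divide power_mult_distrib less_imp_le)
    also have "\<dots> \<le> S * (\<Sum>n\<le>m. d n / (c n)\<^sup>2 * \<delta> n)"
      unfolding S_def using dn \<delta> N
      by (intro mult_right_mono sum_le_suminf sum_nonneg) (auto simp: less_imp_le)
    finally show "(cmod (\<Sum>n\<le>m. hinner E (a n) (T f n) / of_real (c n)))\<^sup>2 \<le>
        S * (\<Sum>n\<le>m. d n / (c n)\<^sup>2 * ((hnorm E (a n))\<^sup>2 - (hnorm E (adj E E A (a n)))\<^sup>2))"
      by (simp add: u_def \<delta>_def)
  qed
qed

lemma truncation:
  assumes g: "g \<in> hcarrier H"
  obtains G where "\<And>N. G N \<in> hcarrier H" "\<And>N n. T (G N) n = (if n \<le> N then T g n else 0)"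
    "(\<lambda>N. hnorm H (G N - g)) \<longlonglongrightarrow> 0"
proof -
  have "\<exists>h\<in>hcarrier H. T h = (\<lambda>n. if n \<le> N then T g n else 0)" for N
  proof -
    have "ell2 (\<lambda>n. if n \<le> N then T g n else 0)"
      unfolding ell2_def using g by (auto intro!: summable_finite[of "{..N}"] split: if_splits)
    then show ?thesis by (rule synthesis) blast
  qed
  then obtain G where G: "\<And>N. G N \<in> hcarrier H" "\<And>N. T (G N) = (\<lambda>n. if n \<le> N then T g n else 0)"
    by metis
  have "(hnorm H (G N - g))\<^sup>2 = (hnorm H g)\<^sup>2 - (\<Sum>n\<le>N. (hnorm E (T g n))\<^sup>2 / c n)" for N
  proof (rule sums_unique2[OF H_norm_sums[OF H_diff(1)[OF G(1) g]]])
    have "(\<lambda>n. (hnorm E (T g n))\<^sup>2 / c n - (if n \<in> {..N} then (hnorm E (T g n))\<^sup>2 / c n else 0)) sums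
        ((hnorm H g)\<^sup>2 - (\<Sum>n\<le>N. (hnorm E (T g n))\<^sup>2 / c n))"
      by (intro sums_diff H_norm_sums[OF g] sums_If_finite_set) auto
    moreover have "(hnorm E (T (G N - g) n))\<^sup>2 / c n =
        (hnorm E (T g n))\<^sup>2 / c n - (if n \<in> {..N} then (hnorm E (T g n))\<^sup>2 / c n else 0)" for n
      using H_diff(2)[OF G(1) g] g E.hnorm_minus_commute[of 0 "T g n"] by (simp add: G(2))
    ultimately show "(\<lambda>n. (hnorm E (T (G N - g) n))\<^sup>2 / c n) sums
        ((hnorm H g)\<^sup>2 - (\<Sum>n\<le>N. (hnorm E (T g n))\<^sup>2 / c n))" by simp
  qed
  moreover have "(\<lambda>N. (hnorm H g)\<^sup>2 - (\<Sum>n\<le>N. (hnorm E (T g n))\<^sup>2 / c n)) \<longlonglongrightarrow> (hnorm H g)\<^sup>2 - (hnorm H g)\<^sup>2"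
    using H_norm_sums[OF g] unfolding sums_def_le by (intro tendsto_intros)
  ultimately have "(\<lambda>N. (hnorm H (G N - g))\<^sup>2) \<longlonglongrightarrow> 0" by simp
  then have "(\<lambda>N. sqrt ((hnorm H (G N - g))\<^sup>2)) \<longlonglongrightarrow> sqrt 0" by (rule tendsto_real_sqrt)
  then have "(\<lambda>N. hnorm H (G N - g)) \<longlonglongrightarrow> 0"
    using prehilbert.hnorm_nonneg[OF prehilbert_H H_diff(1)[OF G(1) g]] by simp
  then show thesis using that[of G] G by simp
qed

text \<open>
  The bound for the adjoint is available for polynomials \<open>g\<close>; both sides are continuous in \<open>g\<close>, and
  the truncations of \<open>g\<close> converge to \<open>g\<close>.
\<close>

lemma sub_bergman_inclusion:
  "hcarrier (bergman_space (\<alpha> - 1) (dBR_space E E (X 0))) \<subseteq> hcarrier (sub_bergman \<alpha> E B)"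
proof
  fix f assume "f \<in> hcarrier (bergman_space (\<alpha> - 1) (dBR_space E E (X 0)))"
  then obtain S where f: "f \<in> hcarrier H" and S: "0 \<le> S"
    and partial: "\<And>a m. (\<And>n. a n \<in> hcarrier E) \<Longrightarrow>
      (cmod (\<Sum>n\<le>m. hinner E (a n) (T f n) / of_real (c n)))\<^sup>2 \<le>
      S * (\<Sum>n\<le>m. d n / (c n)\<^sup>2 * ((hnorm E (a n))\<^sup>2 - (hnorm E (adj E E (X 0) (a n)))\<^sup>2))"
    by (rule inner_partial_bound[OF X0_adjoint]) blast
  interpret HH: hilbert_space H by (rule hilbert_H)
  note ops = M_adjoint[unfolded adjoint_contractions_def]
  have adj_ops: "M' \<in> bounded_ops H H"
    and adj_le: "\<And>g. g \<in> hcarrier H \<Longrightarrow> hnorm H (M' g) \<le> hnorm H g" using ops by auto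
  note adj_carrier = bounded_opsD(1)[OF adj_ops]
  have truncated: "(cmod (hinner H g f))\<^sup>2 \<le> S * (2 * (1 + \<kappa>) * ((hnorm H g)\<^sup>2 - (hnorm H (M' g))\<^sup>2))"
    if g: "g \<in> hcarrier H" and G: "\<And>n. n > m \<Longrightarrow> T g n = 0" for g m
  proof -
    have Tg: "T g n \<in> hcarrier E" for n using g by simp
    have "(\<lambda>n. hinner E (T g n) (T f n) / of_real (c n)) sums (\<Sum>n\<le>m. hinner E (T g n) (T f n) / of_real (c n))"
      by (rule sums_finite) (use f G in auto)
    then have "hinner H g f = (\<Sum>n\<le>m. hinner E (T g n) (T f n) / of_real (c n))"
      by (rule sums_unique2[OF H_inner_sums[OF g f]])
    also have "(cmod \<dots>)\<^sup>2 \<le> S * (\<Sum>n\<le>m. d n / (c n)\<^sup>2 * ((hnorm E (T g n))\<^sup>2 - (hnorm E (adj E E (X 0) (T g n)))\<^sup>2))"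
      by (rule partial[OF Tg])
    also have "\<dots> \<le> S * (2 * (1 + \<kappa>) * ((hnorm H g)\<^sup>2 - (hnorm H (M' g))\<^sup>2))"
      using S by (intro mult_left_mono adj_defect_bound_finite_support g G)
    finally show ?thesis .
  qed
  have "f \<in> hcarrier (range_space H (sqrt_op H (id - (M \<circ> M'))))"
  proof (rule in_defect_range[OF hilbert_H hilbert_H M_adjoint f])
    fix g assume g: "g \<in> hcarrier H"
    obtain G where G: "\<And>N. G N \<in> hcarrier H" "\<And>N n. T (G N) n = (if n \<le> N then T g n else 0)"
      "(\<lambda>N. hnorm H (G N - g)) \<longlonglongrightarrow> 0" by (rule truncation[OF g]) blast
    have "(\<lambda>N. hnorm H (M' (G N) - M' g)) \<longlonglongrightarrow> 0"
    proof (rule Lim_null_comparison[OF always_eventually G(3)], rule allI)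
      fix N
      show "norm (hnorm H (M' (G N) - M' g)) \<le> hnorm H (G N - g)"
        using bounded_ops_diff[OF prehilbert_H adj_ops G(1) g] adj_le[OF H_diff(1)[OF G(1) g]]
          adj_carrier G(1) g by (simp add: HH.hnorm_nonneg HH.carrier_diff)
    qed
    then have l1: "(\<lambda>N. hnorm H (M' (G N))) \<longlonglongrightarrow> hnorm H (M' g)"
      by (intro HH.tendsto_hnorm adj_carrier G g)
    have l2: "(\<lambda>N. hnorm H (G N)) \<longlonglongrightarrow> hnorm H g" by (intro HH.tendsto_hnorm G g)
    have l3: "(\<lambda>N. hinner H (G N) f) \<longlonglongrightarrow> hinner H g f" by (intro HH.tendsto_hinner G g f)
    show "(cmod (hinner H g f))\<^sup>2 \<le> (S * (2 * (1 + \<kappa>))) * ((hnorm H g)\<^sup>2 - (hnorm H (M' g))\<^sup>2)"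
    proof (rule LIMSEQ_le)
      show "(\<lambda>N. (cmod (hinner H (G N) f))\<^sup>2) \<longlonglongrightarrow> (cmod (hinner H g f))\<^sup>2" by (intro tendsto_intros l3)
      show "(\<lambda>N. (S * (2 * (1 + \<kappa>))) * ((hnorm H (G N))\<^sup>2 - (hnorm H (M' (G N)))\<^sup>2)) \<longlonglongrightarrow>
          (S * (2 * (1 + \<kappa>))) * ((hnorm H g)\<^sup>2 - (hnorm H (M' g))\<^sup>2)" by (intro tendsto_intros l1 l2)
      have "(cmod (hinner H (G n) f))\<^sup>2 \<le>
          S * (2 * (1 + \<kappa>) * ((hnorm H (G n))\<^sup>2 - (hnorm H (M' (G n)))\<^sup>2))" for n
        by (rule truncated[where m = n and g = "G n"]) (simp_all add: G)
      then show "\<exists>N. \<forall>n\<ge>N. (cmod (hinner H (G n) f))\<^sup>2 \<le>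
          (S * (2 * (1 + \<kappa>))) * ((hnorm H (G n))\<^sup>2 - (hnorm H (M' (G n)))\<^sup>2)"
        by (simp only: mult.assoc) blast
    qed
  qed
  then show "f \<in> hcarrier (sub_bergman \<alpha> E B)" by (simp add: sub_bergman_def Let_def)
qed

lemma sub_bergman_star_inclusion:
  "hcarrier (bergman_space (\<alpha> - 1) (dBR_space E E (adj E E (X 0)))) \<subseteq> hcarrier (sub_bergman_star \<alpha> E B)"
proof
  note E = E.hilbert_space_axioms
  note adj_X0 = adj_adj[OF E E X_ops, of _ 0]
  have adjoint: "adjoint_contractions E E (adj E E (X 0)) (adj E E (adj E E (X 0)))"
    using X0_adjoint adjoint_contractions_adj[OF E E, of "adj E E (X 0)"] by (auto simp: adjoint_contractions_def)
  fix f assume "f \<in> hcarrier (bergman_space (\<alpha> - 1) (dBR_space E E (adj E E (X 0))))"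
  then obtain S where f: "f \<in> hcarrier H" and S: "0 \<le> S"
    and le: "\<And>a m. (\<And>n. a n \<in> hcarrier E) \<Longrightarrow>
      (cmod (\<Sum>n\<le>m. hinner E (a n) (T f n) / of_real (c n)))\<^sup>2 \<le>
      S * (\<Sum>n\<le>m. d n / (c n)\<^sup>2 * ((hnorm E (a n))\<^sup>2 - (hnorm E (adj E E (adj E E (X 0)) (a n)))\<^sup>2))"
    by (rule inner_partial_bound[OF adjoint]) blast
  have "f \<in> hcarrier (range_space H (sqrt_op H (id - (M' \<circ> M))))"
  proof (rule in_defect_range[OF hilbert_H hilbert_H adjoint_contractions_sym[OF prehilbert_H prehilbert_H M_adjoint] f])
    fix g assume g: "g \<in> hcarrier H"
    have Tg: "T g n \<in> hcarrier E" for n using g by simp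
    have partial: "(cmod (\<Sum>n\<le>m. hinner E (T g n) (T f n) / of_real (c n)))\<^sup>2 \<le>
        S * (4 * \<kappa> * (\<Sum>n\<le>m. (hnorm E (T g n))\<^sup>2 / c n - (hnorm E (T (M g) n))\<^sup>2 / c n))" for m
    proof -
      have "(cmod (\<Sum>n\<le>m. hinner E (T g n) (T f n) / of_real (c n)))\<^sup>2 \<le>
          S * (\<Sum>n\<le>m. d n / (c n)\<^sup>2 * ((hnorm E (T g n))\<^sup>2 - (hnorm E (X 0 (T g n)))\<^sup>2))"
        using le[of "T g" m, OF Tg] by (simp add: adj_X0[OF Tg])
      also have "\<dots> \<le> S * (4 * \<kappa> * (\<Sum>n\<le>m. (hnorm E (T g n))\<^sup>2 / c n - (hnorm E (T (M g) n))\<^sup>2 / c n))"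
        using S by (intro mult_left_mono mult_op_defect_bound g)
      finally show ?thesis .
    qed
    show "(cmod (hinner H g f))\<^sup>2 \<le> (S * (4 * \<kappa>)) * ((hnorm H g)\<^sup>2 - (hnorm H (M g))\<^sup>2)"
    proof (rule LIMSEQ_le)
      show "(\<lambda>m. (cmod (\<Sum>n\<le>m. hinner E (T g n) (T f n) / of_real (c n)))\<^sup>2) \<longlonglongrightarrow> (cmod (hinner H g f))\<^sup>2"
        using H_inner_sums[OF g f] unfolding sums_def_le by (intro tendsto_intros)
      show "(\<lambda>m. (S * (4 * \<kappa>)) * (\<Sum>n\<le>m. (hnorm E (T g n))\<^sup>2 / c n - (hnorm E (T (M g) n))\<^sup>2 / c n)) \<longlonglongrightarrow>
          (S * (4 * \<kappa>)) * ((hnorm H g)\<^sup>2 - (hnorm H (M g))\<^sup>2)"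
        using sums_diff[OF H_norm_sums[OF g] H_norm_sums[OF mult_op_H(1)[OF g]]]
        unfolding sums_def_le by (intro tendsto_intros)
    qed (use partial in \<open>auto simp: mult.assoc\<close>)
  qed
  then show "f \<in> hcarrier (sub_bergman_star \<alpha> E B)" by (simp add: sub_bergman_star_def Let_def)
qed

end

theorem theorem1p1:
  fixes E :: "'e::complex_vector inner_space"
    and B :: "complex \<Rightarrow> 'e \<Rightarrow> 'e"
    and \<alpha> :: real
  assumes "separable_hilbert E"
    and "B \<in> Hinf1 E"
    and "\<alpha> > -1"
  shows "hcarrier (bergman_space (\<alpha> - 1) (dBR_space E E (B 0)))
           \<subseteq> hcarrier (sub_bergman \<alpha> E B) \<and>
         hcarrier (bergman_space (\<alpha> - 1) (dBR_space E E (adj E E (B 0))))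
           \<subseteq> hcarrier (sub_bergman_star \<alpha> E B)"
proof -
  have E: "hilbert_space E" using assms(1) by (simp add: separable_hilbert_def)
  interpret schur_function E B by (intro schur_function.intro E schur_function_axioms.intro assms(2))
  obtain X where X: "\<And>n. X n \<in> bounded_ops E E" "\<And>x. x \<in> hcarrier E \<Longrightarrow> X 0 x = B 0 x"
    "\<And>z x L. z \<in> ball 0 1 \<Longrightarrow> x \<in> hcarrier E \<Longrightarrow>
      hnorm E (B z x - (\<Sum>m<L. z ^ m *\<^sub>C X m x)) \<le> cmod z ^ L / (1 - cmod z) * hnorm E x"
    by (rule taylor_coefficients) blast
  \<comment> \<open>The coefficient \<open>X 0\<close> agrees with \<open>B 0\<close> on the carrier only, while the spaces in the conclusion
    are formed from \<open>B 0\<close> itself.\<close>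
  define Y where "Y n = (if n = 0 then B 0 else X n)" for n
  have Y: "Y n x = X n x" if "x \<in> hcarrier E" for n x using X(2)[OF that] by (simp add: Y_def)
  interpret bergman_multiplier E \<alpha> B Y
  proof (unfold_locales)
    show "Y n \<in> bounded_ops E E" for n using X(1) B_op[of 0] by (simp add: Y_def)
    show "Y 0 = B 0" by (simp add: Y_def)
    show "hnorm E (B z x - (\<Sum>m<L. z ^ m *\<^sub>C Y m x)) \<le> cmod z ^ L / (1 - cmod z) * hnorm E x"
      if "z \<in> ball 0 1" "x \<in> hcarrier E" for z x L
      using X(3)[OF that, of L] by (simp add: Y that(2))
  qed (fact assms(3))
  show ?thesis using sub_bergman_inclusion sub_bergman_star_inclusion by (simp add: X_0)
qed

end
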